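(* Let $\beta\in(0,1)$ and $\alpha\in(1,2)$ with $\mu=\mathbb E[\xi_1]\neq0$. For $t\in[0,+\infty)$ and $n\in\mathbb Z^+$ define $$\hat Y^{(n)}(t):=\frac{Y_{\lfloor nt\rfloor}}{n^{1/\beta}}.$$ Then, as $n\to\infty$, $$\hat Y^{(n)}\xrightarrow{\ d\ }\operatorname{sgn}(\mu)\,|\mu|^{1/\beta}\,Z^{(\beta)}_+\qquad\text{in }(\mathcal D^+,J_2).$$
   Context: Medium: $\zeta=(\zeta_i)_{i\in\mathbb Z}$ are i.i.d. positive random variables in the normal domain of attraction of a $\beta$-stable law, which for $\beta\in(0,1)$ means $n^{-1/\beta}\sum_{i=1}^n\zeta_i\xrightarrow{d}Z^{(\beta)}_1$, where $Z^{(\beta)}_1$ is a (non-degenerate) stable variable of index $\beta$ (with skewness parameter $1$). Put $\omega_0=0$, $\omega_k=\sum_{i=1}^k\zeta_i$ for $k>0$, $\omega_k=-\sum_{i=k}^{-1}\zeta_i$ for $k<0$. Underlying random walk: $S_0=0$, $S_n=\sum_{i=1}^n\xi_i$, where $(\xi_i)_{i\ge1}$ are i.i.d. $\mathbb Z$-valued random variables, independent of $\zeta$, in the normal domain of attraction of an $\alpha$-stable law, which for $\alpha\in(1,2)$ means $n^{-1/\alpha}\sum_{i=1}^n(\xi_i-\mu)\xrightarrow{d}\widetilde W^{(\alpha)}_1$, with $\mu=\mathbb E[\xi_1]$ and $\widetilde W^{(\alpha)}_1$ a (non-degenerate) stable variable of index $\alpha$. Random walk on the random medium: $Y_n:=\omega_{S_n}$,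 $n\in\mathbb N$. All laws are with respect to the probability governing both $\zeta$ and $(\xi_i)$ (annealed law). Limit process: $(Z^{(\beta)}_+(s))_{s\ge0}$ is a càdlàg Lévy $\beta$-stable process with $Z^{(\beta)}_+(0)=0$ and $Z^{(\beta)}_+(1)$ distributed like $Z^{(\beta)}_1$. Topology: $\mathcal D^+$ is the space of càdlàg functions $f:[0,+\infty)\to\mathbb R$. For a bounded interval $I\subset[0,+\infty)$ and càdlàg $f,g$ on $I$, the $J_2$ distance is $d_{J_2,I}(f,g):=\inf_\lambda\max\{\sup_{t\in I}|f(\lambda(t))-g(t)|,\ \sup_{t\in I}|\lambda(t)-t|\}$, the infimum being over all (possibly discontinuous) bijections $\lambda:I\to I$. $f_n\to f$ in $(\mathcal D^+,J_2)$ means $d_{J_2,[0,T]}(f_n,f)\to0$ for every $T>0$ at which $f$ is continuous; this is a metrizable topology, and $\xrightarrow{d}$ in $(\mathcal D^+,J_2)$ denotes convergence in distribution with respect to it. *)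

theory Defs
  imports "HOL-Probability.Probability"
begin

section \<open>Stable laws and normal domains of attraction\<close>

text \<open>
  Characteristic exponent of the stable law with index \<open>a\<close>, scale \<open>s\<close>, skewness \<open>r\<close> and shift
  \<open>d\<close>, in the parametrization of Samorodnitsky and Taqqu. For \<open>t = 0\<close> the factor
  \<open>\<bar>t\<bar> powr a\<close> vanishes, so the value of \<open>ln 0\<close> is irrelevant.
\<close>

definition stable_exponent :: "real \<Rightarrow> real \<Rightarrow> real \<Rightarrow> real \<Rightarrow> real \<Rightarrow> complex" where
  "stable_exponent a s r d t =
     \<i> * of_real (d * t)
     - of_real (s powr a * \<bar>t\<bar> powr a)
       * (1 - \<i> * of_real (r * sgn t * (if a = 1 then - (2 / pi) * ln \<bar>t\<bar> else tan (pi * a / 2))))"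

text \<open>Non-degeneracy is the requirement \<open>s > 0\<close>.\<close>

definition stable_law :: "real \<Rightarrow> real \<Rightarrow> real measure \<Rightarrow> bool" where
  "stable_law a r \<nu> \<longleftrightarrow>
     0 < a \<and> a \<le> 2 \<and> - 1 \<le> r \<and> r \<le> 1 \<and> real_distribution \<nu> \<and>
     (\<exists>s d. 0 < s \<and> (\<forall>t. char \<nu> t = exp (stable_exponent a s r d t)))"

text \<open>
  The limit theorem with normalization \<open>n powr (1 / a)\<close> and centering \<open>c\<close>: here \<open>c = 0\<close> for
  an index \<open>a\<close> below 1, and \<open>c\<close> is the mean for \<open>a\<close> between 1 and 2.
\<close>

definition normally_attracted ::
    "'a measure \<Rightarrow> (nat \<Rightarrow> 'a \<Rightarrow> real) \<Rightarrow> real \<Rightarrow> real \<Rightarrow> real measure \<Rightarrow> bool" where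
  "normally_attracted M X a c \<nu> \<longleftrightarrow>
     weak_conv_m
       (\<lambda>n. distr M borel (\<lambda>x. (\<Sum>i=1..n. (X i x - c)) / real n powr (1 / a))) \<nu>"

definition iid :: "'a measure \<Rightarrow> 'b measure \<Rightarrow> ('i \<Rightarrow> 'a \<Rightarrow> 'b) \<Rightarrow> 'i set \<Rightarrow> bool" where
  "iid M K X I \<longleftrightarrow>
     prob_space.indep_vars M (\<lambda>_. K) X I \<and>
     (\<forall>i\<in>I. \<forall>j\<in>I. distr M K (X i) = distr M K (X j))"

text \<open>
  Independence of two random elements, as independence of the generated \<open>\<sigma>\<close>-algebras; the
  constant \<open>indep_var\<close> would force both to have the same value type.
\<close>

definition independent_of ::
    "'a measure \<Rightarrow> 'b measure \<Rightarrow> ('a \<Rightarrow> 'b) \<Rightarrow> 'c measure \<Rightarrow> ('a \<Rightarrow> 'c) \<Rightarrow> bool" where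
  "independent_of M K X L Y \<longleftrightarrow>
     X \<in> measurable M K \<and> Y \<in> measurable M L \<and>
     prob_space.indep_set M
       (sets (vimage_algebra (space M) X K)) (sets (vimage_algebra (space M) Y L))"

section \<open>Random walk on a random medium\<close>

definition medium :: "(int \<Rightarrow> real) \<Rightarrow> int \<Rightarrow> real" where
  "medium z k =
     (if k > 0 then \<Sum>i=1..k. z i
      else if k < 0 then - (\<Sum>i=k..-1. z i)
      else 0)"

definition walk :: "(nat \<Rightarrow> int) \<Rightarrow> nat \<Rightarrow> int" where
  "walk x n = (\<Sum>i=1..n. x i)"

definition rw_on_medium :: "(int \<Rightarrow> real) \<Rightarrow> (nat \<Rightarrow> int) \<Rightarrow> nat \<Rightarrow> real" where
  "rw_on_medium z x n = medium z (walk x n)"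

section \<open>Cadlag functions and the $J_2$ topology\<close>

definition cadlag :: "(real \<Rightarrow> real) \<Rightarrow> bool" where
  "cadlag f \<longleftrightarrow>
     (\<forall>t\<ge>0. (f \<longlongrightarrow> f t) (at_right t)) \<and> (\<forall>t>0. \<exists>l. (f \<longlongrightarrow> l) (at_left t))"

text \<open>
  Functions on \<open>{0..}\<close> are represented by total functions that are \<open>undefined\<close> at negative
  arguments, so that equality of representatives is equality of functions on \<open>{0..}\<close>.
\<close>

definition Dplus :: "(real \<Rightarrow> real) set" where
  "Dplus = {f \<in> extensional {0..}. cadlag f}"

definition J2_dist :: "real set \<Rightarrow> (real \<Rightarrow> real) \<Rightarrow> (real \<Rightarrow> real) \<Rightarrow> real" where
  "J2_dist I f g =
     (INF l\<in>{l. bij_betw l I I}.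
        max (SUP t\<in>I. \<bar>f (l t) - g t\<bar>) (SUP t\<in>I. \<bar>l t - t\<bar>))"

definition J2_converges :: "(nat \<Rightarrow> real \<Rightarrow> real) \<Rightarrow> (real \<Rightarrow> real) \<Rightarrow> bool" where
  "J2_converges F f \<longleftrightarrow>
     (\<forall>T>0. isCont f T \<longrightarrow> (\<lambda>n. J2_dist {0..T} (F n) f) \<longlonglongrightarrow> 0)"

text \<open>
  A metrizable topology is determined by its convergent sequences: the open sets are the
  sequentially open ones.
\<close>

definition J2_open :: "(real \<Rightarrow> real) set \<Rightarrow> bool" where
  "J2_open U \<longleftrightarrow>
     U \<subseteq> Dplus \<and>
     (\<forall>f\<in>U. \<forall>F. range F \<subseteq> Dplus \<longrightarrow> J2_converges F f \<longrightarrow> (\<forall>\<^sub>F n in sequentially. F n \<in> U))"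

definition J2_topology :: "(real \<Rightarrow> real) topology" where
  "J2_topology = topology J2_open"

lemma istopology_J2_open: "istopology J2_open"
  unfolding istopology_def
proof (intro conjI allI impI)
  fix S T assume "J2_open S" "J2_open T"
  then show "J2_open (S \<inter> T)"
    unfolding J2_open_def by (auto simp: eventually_conj_iff)
next
  fix \<K> assume K: "\<forall>S\<in>\<K>. J2_open S"
  show "J2_open (\<Union>\<K>)"
    unfolding J2_open_def
  proof (intro conjI ballI allI impI)
    show "\<Union>\<K> \<subseteq> Dplus" using K by (auto simp: J2_open_def)
  next
    fix f F
    assume f: "f \<in> \<Union>\<K>" and F: "range F \<subseteq> Dplus" "J2_converges F f"
    then obtain S where S: "S \<in> \<K>" "f \<in> S" by blast
    with K F have "\<forall>\<^sub>F n in sequentially. F n \<in> S" unfolding J2_open_def by blast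
    then show "\<forall>\<^sub>F n in sequentially. F n \<in> \<Union>\<K>"
      by (rule eventually_mono) (use S in blast)
  qed
qed

lemma openin_J2_topology: "openin J2_topology U \<longleftrightarrow> J2_open U"
  by (simp add: J2_topology_def istopology_J2_open)

lemma topspace_J2_topology: "topspace J2_topology = Dplus"
proof
  show "topspace J2_topology \<subseteq> Dplus"
    by (metis J2_open_def openin_J2_topology openin_topspace)
  have "J2_open Dplus"
    unfolding J2_open_def by (auto intro!: always_eventually simp: image_subset_iff)
  then show "Dplus \<subseteq> topspace J2_topology"
    by (metis openin_J2_topology openin_subset)
qed

section \<open>Convergence in distribution in a topological space\<close>

definition borel_sets_of :: "'a topology \<Rightarrow> 'a measure" where
  "borel_sets_of X = sigma (topspace X) {U. openin X U}"

text \<open>The approximating random elements live on \<open>M\<close>, the limit on \<open>N\<close>.\<close>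

definition converges_in_distribution ::
    "'c topology \<Rightarrow> 'a measure \<Rightarrow> (nat \<Rightarrow> 'a \<Rightarrow> 'c) \<Rightarrow> 'b measure \<Rightarrow> ('b \<Rightarrow> 'c) \<Rightarrow> bool" where
  "converges_in_distribution X M A N B \<longleftrightarrow>
     (\<forall>n. A n \<in> measurable M (borel_sets_of X)) \<and>
     B \<in> measurable N (borel_sets_of X) \<and>
     (\<forall>h. continuous_map X euclideanreal h \<longrightarrow> bounded (h ` topspace X) \<longrightarrow>
        (\<lambda>n. \<integral>x. h (A n x) \<partial>M) \<longlonglongrightarrow> (\<integral>y. h (B y) \<partial>N))"

section \<open>Stable Levy processes\<close>

definition cadlag_levy_process :: "'b measure \<Rightarrow> (real \<Rightarrow> 'b \<Rightarrow> real) \<Rightarrow> bool" where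
  "cadlag_levy_process N Z \<longleftrightarrow>
     prob_space N \<and>
     (\<forall>t\<ge>0. Z t \<in> borel_measurable N) \<and>
     (\<forall>y\<in>space N. cadlag (\<lambda>t. Z t y)) \<and>
     (AE y in N. Z 0 y = 0) \<and>
     (\<forall>n s. 0 \<le> s 0 \<longrightarrow> (\<forall>i<n. s i < s (Suc i)) \<longrightarrow>
        prob_space.indep_vars N (\<lambda>_. borel) (\<lambda>i y. Z (s (Suc i)) y - Z (s i) y) {..<n::nat}) \<and>
     (\<forall>s\<ge>0. \<forall>t\<ge>0. distr N borel (\<lambda>y. Z (s + t) y - Z s y) = distr N borel (Z t))"

definition cadlag_stable_levy_process ::
    "real \<Rightarrow> real \<Rightarrow> 'b measure \<Rightarrow> (real \<Rightarrow> 'b \<Rightarrow> real) \<Rightarrow> bool" where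
  "cadlag_stable_levy_process a r N Z \<longleftrightarrow>
     cadlag_levy_process N Z \<and> stable_law a r (distr N borel (Z 1))"

end

theory Submission
  imports Defs
begin

text \<open>
  A cadlag function \<open>f\<close> is encoded by the distances of the rational points of the plane to the graph of
  \<open>arctan \<circ> f\<close>. Pointwise convergence of these distances is local Hausdorff convergence of graphs;
  for right-continuous functions it already yields good bijections, hence \<open>J\<^sub>2\<close> convergence, so
  the countable product of lines is a metric model of the path space.

  As \<open>\<beta> < 1\<close>, on the scale \<open>n powr (1 / \<beta>)\<close> the small gaps of the medium have negligible sum and the big
  ones are few and far apart, while the walk stays uniformly within \<open>o(n)\<close> of its drift. Hence in graph
  distance the process is close to the step function through the values of the medium at the sites
  \<open>k \<lfloor>n \<mu> / m\<rfloor>\<close>. This step function is a continuous functional of i.i.d. block sums, whose limits are the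
  increments of the Levy process, and \<open>m \<rightarrow> \<infinity>\<close> recovers the process itself.
\<close>

section \<open>Bijections close to the identity and the $J_2$ distance\<close>

text \<open>The walk need not be monotone: near a big gap it may cross back and forth many times, so
  its path oscillates between two levels, while the limit jumps once. Order-preserving time changes
  cannot undo this, whereas arbitrary bijections only compare which values occur near which times.
  Closeness of graphs, which ignores order, expresses exactly this. The topology is given by its
  convergent sequences alone. For the passage to a metric space one implication suffices: if the
  graph distances converge, so do the paths. Measurability and convergence of expectations both
  follow from it, with Lipschitz functions of the graph distances as test functions. The parameters
  are fixed in the order \<theta>, m, n. The truncation level \<theta> makes the sum of the small
  gaps small whatever the grid; a fine grid then makes two big gaps in neighbouring blocks unlikely,
  with probability of order 1/m for all large n; large n finally confines the walk to a fraction of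
  one block around its drift.\<close>

lemma rationally_independent_injection:
  includes cardinal_syntax
  shows "\<exists>\<kappa>::real \<Rightarrow> real. \<forall>x y. x \<noteq> y \<longrightarrow> \<kappa> x - \<kappa> y \<notin> \<rat>"
proof -
  define rep where "rep x = (SOME y::real. x - y \<in> \<rat>)" for x :: real
  have rep: "x - rep x \<in> \<rat>" for x
    unfolding rep_def by (rule someI[of _ x]) simp
  \<comment> \<open>Congruent points define the same predicate under \<open>SOME\<close>, hence have
    the same representative.\<close>
  have rep_eq: "rep x = rep y" if "x - y \<in> \<rat>" for x y
  proof -
    have "x - z \<in> \<rat> \<longleftrightarrow> y - z \<in> \<rat>" for z
    proof -
      have "x - z = (x - y) + (y - z)" "y - z = (x - z) - (x - y)" by auto
      then show ?thesis using that by (metis Rats_add Rats_diff)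
    qed
    then show ?thesis by (simp add: rep_def)
  qed
  let ?V = "range rep"
  have V: "x = y" if "x \<in> ?V" "y \<in> ?V" "x - y \<in> \<rat>" for x y
  proof -
    from that obtain a b where ab: "x = rep a" "y = rep b" by auto
    have "a - b = (a - rep a) + (x - y) - (b - rep b)" using ab by simp
    then have "a - b \<in> \<rat>" using rep that(3) by (metis Rats_add Rats_diff)
    then show ?thesis using rep_eq ab by simp
  qed
  \<comment> \<open>\<open>?V\<close> is a transversal of the reals modulo the rationals, so every
    real is a sum of an element of \<open>?V\<close> and a rational. As \<open>?V\<close> is
    infinite and the rationals are countable, the product of the two is equinumerous with
    \<open>?V\<close>. Hence the reals inject into \<open>?V\<close>, and any such injection is a
    suitable \<open>\<kappa>\<close>.\<close>
  have sub: "UNIV \<subseteq> (\<lambda>(v, q). v + q) ` (?V \<times> \<rat>)"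
  proof
    fix x :: real
    show "x \<in> (\<lambda>(v, q). v + q) ` (?V \<times> \<rat>)"
      using rep[of x] by (intro image_eqI[of _ _ "(rep x, x - rep x)"]) auto
  qed
  have inf: "infinite ?V"
  proof
    assume "finite ?V"
    then have "countable (?V \<times> (\<rat>::real set))"
      by (intro countable_SIGMA countable_finite countable_rat)
    then have "countable (UNIV :: real set)"
      using sub countable_subset by blast
    then show False using uncountable_UNIV_real by blast
  qed
  have "|\<rat>::real set| \<le>o |UNIV::nat set|"
    using countable_rat[where 'a = real] unfolding countable_def card_of_ordLeq[symmetric] by auto
  moreover have "|UNIV::nat set| \<le>o |?V|" using inf infinite_iff_card_of_nat by blast
  ultimately have "|\<rat>::real set| \<le>o |?V|" by (rule ordLeq_transitive)
  then have "|?V \<times> (\<rat>::real set)| =o |?V|"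
    using inf by (intro card_of_Times_infinite_simps) auto
  moreover have "|UNIV::real set| \<le>o |?V \<times> (\<rat>::real set)|"
    by (rule surj_imp_ordLeq[OF sub])
  ultimately have "|UNIV::real set| \<le>o |?V|" using ordLeq_ordIso_trans by blast
  then obtain \<kappa> :: "real \<Rightarrow> real" where "inj \<kappa>" "range \<kappa> \<subseteq> ?V"
    unfolding card_of_ordLeq[symmetric] by auto
  then show ?thesis
    by (intro exI[of _ \<kappa>]) (metis V injD rangeI subsetD)
qed

text \<open>The \<open>t\<close>-th value is moved by a rational number from the \<open>t\<close>-th element of a family that is
  pairwise incongruent modulo the rationals, so that no two values collide.\<close>

lemma injective_selection_from_open_sets:
  fixes J :: "real \<Rightarrow> real set"
  assumes "\<And>t. t \<in> A \<Longrightarrow> open (J t)" "\<And>t. t \<in> A \<Longrightarrow> J t \<noteq> {}"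
  obtains l where "inj_on l A" "\<And>t. t \<in> A \<Longrightarrow> l t \<in> J t"
proof -
  obtain \<kappa> :: "real \<Rightarrow> real" where \<kappa>: "\<And>x y. x \<noteq> y \<Longrightarrow> \<kappa> x - \<kappa> y \<notin> \<rat>"
    using rationally_independent_injection by blast
  have "\<exists>q\<in>\<rat>. \<kappa> t + q \<in> J t" if "t \<in> A" for t
  proof -
    from assms(2)[OF that] obtain x where x: "x \<in> J t" by auto
    with assms(1)[OF that] obtain e where e: "e > 0" "ball x e \<subseteq> J t"
      using open_contains_ball by blast
    obtain q where "q \<in> \<rat>" "x - \<kappa> t < q" "q < x - \<kappa> t + e"
      using Rats_dense_in_real[of "x - \<kappa> t" "x - \<kappa> t + e"] e by auto
    then have "\<kappa> t + q \<in> ball x e" by (auto simp: dist_real_def)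
    with \<open>q \<in> \<rat>\<close> e show ?thesis by blast
  qed
  then obtain q where q: "\<And>t. t \<in> A \<Longrightarrow> q t \<in> \<rat>" "\<And>t. t \<in> A \<Longrightarrow> \<kappa> t + q t \<in> J t" by metis
  have "inj_on (\<lambda>t. \<kappa> t + q t) A"
  proof (rule inj_onI, rule ccontr)
    fix x y assume xy: "x \<in> A" "y \<in> A" "\<kappa> x + q x = \<kappa> y + q y" "x \<noteq> y"
    then have "\<kappa> x - \<kappa> y = q y - q x" by linarith
    then show False using \<kappa> xy q by (metis Rats_diff)
  qed
  with q that show ?thesis by blast
qed

text \<open>The Cantor-Bernstein bijection takes only values of \<open>f\<close> and inverse values
  of \<open>g\<close>, so a relation that both injections respect pointwise is inherited by
  it.\<close>

lemma Schroeder_Bernstein_relation: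
  assumes f: "inj_on f A" "\<And>a. a \<in> A \<Longrightarrow> f a \<in> B \<and> R a (f a)"
    and g: "inj_on g B" "\<And>b. b \<in> B \<Longrightarrow> g b \<in> A \<and> R (g b) b"
  obtains h where "bij_betw h A B" "\<And>a. a \<in> A \<Longrightarrow> R a (h a)"
proof -
  \<comment> \<open>The points of \<open>A\<close> whose chain of alternating preimages under
    \<open>g\<close> and \<open>f\<close> ends in \<open>A\<close> outside the range of
    \<open>g\<close>. There \<open>f\<close> is used, elsewhere the inverse of
    \<open>g\<close>.\<close>
  define X where "X = lfp (\<lambda>X. A - g ` (B - f ` X))"
  have X: "X = A - g ` (B - f ` X)"
    unfolding X_def by (rule lfp_unfold) (blast intro: monoI)
  then have XA: "X \<subseteq> A" by blast
  have AX: "A - X = g ` (B - f ` X)" using g(2) by (subst X) blast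
  have ginj: "inj_on g (B - f ` X)" using g(1) by (rule inj_on_subset) auto
  have b1: "bij_betw f X (f ` X)" using f(1) XA by (metis inj_on_imp_bij_betw inj_on_subset)
  have b2: "bij_betw (the_inv_into (B - f ` X) g) (A - X) (B - f ` X)"
    using ginj AX by (metis bij_betw_the_inv_into inj_on_imp_bij_betw)
  let ?h = "\<lambda>a. if a \<in> X then f a else the_inv_into (B - f ` X) g a"
  have "bij_betw ?h (X \<union> (A - X)) (f ` X \<union> (B - f ` X))"
    by (rule bij_betw_disjoint_Un[OF b1 b2]) auto
  moreover have "X \<union> (A - X) = A" using XA by blast
  moreover have "f ` X \<union> (B - f ` X) = B" using XA f(2) by blast
  moreover have "R a (?h a)" if "a \<in> A" for a
  proof (cases "a \<in> X")
    case True then show ?thesis using f(2) XA by auto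
  next
    case False
    then have "a \<in> g ` (B - f ` X)" using AX that by blast
    then obtain b where b: "b \<in> B - f ` X" "a = g b" by blast
    then have "the_inv_into (B - f ` X) g a = b" using ginj by (simp add: the_inv_into_f_f)
    then show ?thesis using False b g(2) by auto
  qed
  ultimately show ?thesis using that[of ?h] by simp
qed

lemma cadlag_right_interval:
  assumes "cadlag f" "s \<ge> 0" "s < T" "\<bar>s - t\<bar> < e" "\<bar>f s - c\<bar> < (e::real)"
  obtains d where "d > 0" "s + d \<le> T" "\<And>u. s < u \<Longrightarrow> u < s + d \<Longrightarrow> \<bar>u - t\<bar> < e \<and> \<bar>f u - c\<bar> < e"
proof -
  have lim: "(f \<longlongrightarrow> f s) (at_right s)" using assms by (auto simp: cadlag_def)
  have "\<forall>\<^sub>F u in at_right s. \<bar>f u - c\<bar> < e"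
  proof -
    have "((\<lambda>u. \<bar>f u - c\<bar>) \<longlongrightarrow> \<bar>f s - c\<bar>) (at_right s)" by (intro tendsto_intros lim)
    then show ?thesis using assms(5) by (rule order_tendstoD)
  qed
  moreover have "\<forall>\<^sub>F u in at_right s. \<bar>u - t\<bar> < e"
  proof -
    have "((\<lambda>u. \<bar>u - t\<bar>) \<longlongrightarrow> \<bar>s - t\<bar>) (at_right s)" by (intro tendsto_intros)
    then show ?thesis using assms(4) by (rule order_tendstoD)
  qed
  ultimately have "\<forall>\<^sub>F u in at_right s. \<bar>u - t\<bar> < e \<and> \<bar>f u - c\<bar> < e" by eventually_elim simp
  then obtain b where b: "b > s" "\<And>u. s < u \<Longrightarrow> u < b \<Longrightarrow> \<bar>u - t\<bar> < e \<and> \<bar>f u - c\<bar> < e"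
    unfolding eventually_at_right_field by blast
  show ?thesis
    by (rule that[of "min (b - s) (T - s)"]) (use b assms in auto)
qed

text \<open>A real infimum is meaningful only with a lower bound. The displacement of the bijection
  provides it: it is bounded by \<open>T\<close>, so its supremum is genuine and nonnegative,
  whereas the supremum of the value differences may range over an unbounded set.\<close>

lemma J2_dist_bounds:
  assumes "T \<ge> 0" shows "J2_dist {0..T} f g \<ge> 0"
    and "bdd_below ((\<lambda>l. max (SUP t\<in>{0..T}. \<bar>f (l t) - g t\<bar>) (SUP t\<in>{0..T}. \<bar>l t - t\<bar>)) `
      {l. bij_betw l {0..T} {0..T}})"
proof -
  have *: "0 \<le> max (SUP t\<in>{0..T}. \<bar>f (l t) - g t\<bar>) (SUP t\<in>{0..T}. \<bar>l t - t\<bar>)"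
    if "bij_betw l {0..T} {0..T}" for l
  proof -
    have "\<bar>l t - t\<bar> \<le> T" if "t \<in> {0..T}" for t
      using \<open>bij_betw l _ _\<close> that bij_betwE by fastforce
    then have "bdd_above ((\<lambda>t. \<bar>l t - t\<bar>) ` {0..T})" by (intro bdd_aboveI[of _ T]) auto
    then have "0 \<le> (SUP t\<in>{0..T}. \<bar>l t - t\<bar>)"
      using assms by (intro cSUP_upper2[of _ _ 0]) auto
    then show ?thesis by simp
  qed
  show "bdd_below ((\<lambda>l. max (SUP t\<in>{0..T}. \<bar>f (l t) - g t\<bar>) (SUP t\<in>{0..T}. \<bar>l t - t\<bar>)) `
      {l. bij_betw l {0..T} {0..T}})"
    using * by (intro bdd_belowI[of _ 0]) auto
  have "{l. bij_betw l {0..T} {0..T}} \<noteq> {}" using bij_betw_id by blast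
  then show "J2_dist {0..T} f g \<ge> 0"
    unfolding J2_dist_def using * by (intro cINF_greatest) auto
qed

text \<open>Right continuity turns each single witness into an interval of witnesses, from which
  injections in both directions can be selected.\<close>

lemma J2_dist_le:
  assumes "cadlag f" "cadlag g" "T > 0"
    and fg: "\<And>t. t \<in> {0..T} \<Longrightarrow> \<exists>s\<in>{0..<T}. \<bar>s - t\<bar> < e \<and> \<bar>f s - g t\<bar> < e"
    and gf: "\<And>s. s \<in> {0..T} \<Longrightarrow> \<exists>t\<in>{0..<T}. \<bar>s - t\<bar> < e \<and> \<bar>f s - g t\<bar> < e"
  shows "J2_dist {0..T} f g \<le> e"
proof -
  let ?I = "{0..T}"
  define R where "R t s \<longleftrightarrow> \<bar>s - t\<bar> < e \<and> \<bar>f s - g t\<bar> < e" for t s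
  have selection: "\<exists>a. inj_on a ?I \<and> (\<forall>t\<in>?I. a t \<in> ?I \<and> \<bar>a t - t\<bar> < e \<and> \<bar>h (a t) - k t\<bar> < e)"
    if h: "cadlag h" and w: "\<And>t. t \<in> ?I \<Longrightarrow> \<exists>s\<in>{0..<T}. \<bar>s - t\<bar> < e \<and> \<bar>h s - k t\<bar> < e" for h k
  proof -
    have "\<exists>J. open J \<and> J \<noteq> {} \<and> J \<subseteq> ?I \<and> (\<forall>u\<in>J. \<bar>u - t\<bar> < e \<and> \<bar>h u - k t\<bar> < e)"
      if "t \<in> ?I" for t
    proof -
      \<comment> \<open>The witness is strictly below \<open>T\<close>: at \<open>T\<close> itself
        there would be no room on the right for an interval inside \<open>?I\<close>.\<close>
      from w[OF that] obtain s where s: "s \<in> {0..<T}" "\<bar>s - t\<bar> < e" "\<bar>h s - k t\<bar> < e" by blast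
      from cadlag_right_interval[OF h _ _ s(2,3), of T] s(1)
      obtain d where "d > 0" "s + d \<le> T"
        "\<And>u. s < u \<Longrightarrow> u < s + d \<Longrightarrow> \<bar>u - t\<bar> < e \<and> \<bar>h u - k t\<bar> < e" by auto
      with s show ?thesis by (intro exI[of _ "{s<..<s+d}"]) auto
    qed
    then obtain J where J: "\<And>t. t \<in> ?I \<Longrightarrow> open (J t)" "\<And>t. t \<in> ?I \<Longrightarrow> J t \<noteq> {}"
      "\<And>t. t \<in> ?I \<Longrightarrow> J t \<subseteq> ?I \<and> (\<forall>u\<in>J t. \<bar>u - t\<bar> < e \<and> \<bar>h u - k t\<bar> < e)" by metis
    obtain a where "inj_on a ?I" "\<And>t. t \<in> ?I \<Longrightarrow> a t \<in> J t"
      using injective_selection_from_open_sets[of ?I J] J(1,2) by blast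
    with J(3) show ?thesis by (intro exI[of _ a]) blast
  qed
  obtain a where a: "inj_on a ?I" "\<forall>t\<in>?I. a t \<in> ?I \<and> R t (a t)"
    using selection[OF assms(1) fg] unfolding R_def by blast
  obtain b where b: "inj_on b ?I" "\<forall>s\<in>?I. b s \<in> ?I \<and> R (b s) s"
    using selection[OF assms(2), of f] gf unfolding R_def by (auto simp: abs_minus_commute)
  obtain l where l: "bij_betw l ?I ?I" "\<And>t. t \<in> ?I \<Longrightarrow> R t (l t)"
    by (rule Schroeder_Bernstein_relation[of a ?I ?I R b]) (use a b in auto)
  have ne: "?I \<noteq> {}" using assms by auto
  have "J2_dist ?I f g \<le> max (SUP t\<in>?I. \<bar>f (l t) - g t\<bar>) (SUP t\<in>?I. \<bar>l t - t\<bar>)"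
    unfolding J2_dist_def
    by (rule cINF_lower) (use l J2_dist_bounds(2) assms in auto)
  also have "\<dots> \<le> e"
    using l(2) ne by (intro max.boundedI cSUP_least) (auto simp: R_def less_imp_le)
  finally show ?thesis .
qed

text \<open>The one-sided limits bound \<open>f\<close> near every point, and bounds on adjacent
  intervals combine, so bisection applies.\<close>

lemma cadlag_bounded_on_interval:
  assumes "cadlag f"
  obtains K where "K \<ge> 0" "\<And>t. 0 \<le> t \<Longrightarrow> t \<le> T \<Longrightarrow> \<bar>f t\<bar> \<le> K"
proof (cases "T \<ge> 0")
  case True
  have "\<exists>K. \<forall>t. 0 \<le> t \<longrightarrow> 0 \<le> t \<and> t \<le> T \<longrightarrow> \<bar>f t\<bar> \<le> K"
    using True
  \<comment> \<open>The guard \<open>0 \<le> t\<close> is part of the predicate because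
    neighbourhoods of 0 reach into the negative axis, about which \<open>cadlag\<close> says
    nothing.\<close>
  proof (induction rule: Bolzano[where P = "\<lambda>a b. \<exists>K. \<forall>t. 0 \<le> t \<longrightarrow> a \<le> t \<and> t \<le> b \<longrightarrow> \<bar>f t\<bar> \<le> K"])
    case (trans a b c)
    then obtain K K' where "\<forall>t. 0 \<le> t \<longrightarrow> a \<le> t \<and> t \<le> b \<longrightarrow> \<bar>f t\<bar> \<le> K"
      "\<forall>t. 0 \<le> t \<longrightarrow> b \<le> t \<and> t \<le> c \<longrightarrow> \<bar>f t\<bar> \<le> K'" by blast
    then show ?case by (intro exI[of _ "max K K'"]) (metis le_max_iff_disj linorder_linear)
  next
    case (local x)
    have "(f \<longlongrightarrow> f x) (at_right x)" using assms local by (auto simp: cadlag_def)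
    then have "((\<lambda>t. \<bar>f t\<bar>) \<longlongrightarrow> \<bar>f x\<bar>) (at_right x)" by (intro tendsto_intros)
    then have "\<forall>\<^sub>F t in at_right x. \<bar>f t\<bar> < \<bar>f x\<bar> + 1" by (rule order_tendstoD) simp
    then obtain b where b: "b > x" "\<And>t. x < t \<Longrightarrow> t < b \<Longrightarrow> \<bar>f t\<bar> < \<bar>f x\<bar> + 1"
      unfolding eventually_at_right_field by blast
    obtain a K where a: "a < x" "\<And>t. 0 \<le> t \<Longrightarrow> a < t \<Longrightarrow> t < x \<Longrightarrow> \<bar>f t\<bar> \<le> K"
    proof (cases "x > 0")
      case True
      then obtain l where "(f \<longlongrightarrow> l) (at_left x)" using assms by (auto simp: cadlag_def)
      then have "((\<lambda>t. \<bar>f t\<bar>) \<longlongrightarrow> \<bar>l\<bar>) (at_left x)" by (intro tendsto_intros)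
      then have "\<forall>\<^sub>F t in at_left x. \<bar>f t\<bar> < \<bar>l\<bar> + 1" by (rule order_tendstoD) simp
      then obtain a where "a < x" "\<And>t. a < t \<Longrightarrow> t < x \<Longrightarrow> \<bar>f t\<bar> < \<bar>l\<bar> + 1"
        unfolding eventually_at_left_field by blast
      then show ?thesis using that[of a "\<bar>l\<bar> + 1"] by force
    next
      case False
      then show ?thesis using local by (intro that[of "x - 1" 0]) auto
    qed
    have bd: "\<bar>f t\<bar> \<le> max K (\<bar>f x\<bar> + 1)" if "0 \<le> t" "a < t" "t < b" for t
      using that a(2)[of t] b(2)[of t] by (cases "t = x"; cases "t < x") (auto simp: le_max_iff_disj)
    show ?case
      by (intro exI[of _ "min (b - x) (x - a)"] conjI allI impI exI[of _ "max K (\<bar>f x\<bar> + 1)"] bd)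
         (use a b in auto)
  qed
  then obtain K where K: "\<And>t. 0 \<le> t \<Longrightarrow> t \<le> T \<Longrightarrow> \<bar>f t\<bar> \<le> K" by blast
  then have "K \<ge> 0" using True by (metis abs_ge_zero order_trans order_refl)
  with K that show ?thesis by blast
qed (use that[of 0] in auto)

section \<open>Distance functions of graphs\<close>

text \<open>The bounded function \<open>arctan\<close> keeps values that escape to infinity visible at a finite distance,
  so that pointwise convergence of the distances does not lose them.\<close>

abbreviation arctan_graph :: "(real \<Rightarrow> real) \<Rightarrow> (real \<times> real) set" where
  "arctan_graph f \<equiv> (\<lambda>t. (t, arctan (f t))) ` {0..}"

definition graph_dist :: "(real \<Rightarrow> real) \<Rightarrow> rat \<times> rat \<Rightarrow> real" where
  "graph_dist f = (\<lambda>(a, b). infdist (of_rat a, of_rat b) (arctan_graph f))"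

text \<open>Closeness in the sense of Hausdorff on the window from 0 to \<open>T\<close>. The
  partner time may lie outside the window, which avoids any care at its right end, and values are
  compared without \<open>arctan\<close>, which is the stronger requirement.\<close>

definition hclose :: "real \<Rightarrow> real \<Rightarrow> (real \<Rightarrow> real) \<Rightarrow> (real \<Rightarrow> real) \<Rightarrow> bool" where
  "hclose T e f g \<longleftrightarrow>
     (\<forall>t\<in>{0..T}. \<exists>s\<ge>0. \<bar>s - t\<bar> \<le> e \<and> \<bar>g s - f t\<bar> \<le> e) \<and>
     (\<forall>t\<in>{0..T}. \<exists>s\<ge>0. \<bar>s - t\<bar> \<le> e \<and> \<bar>f s - g t\<bar> \<le> e)"

lemma abs_arctan_diff_le: "\<bar>arctan x - arctan y\<bar> \<le> \<bar>x - y\<bar>"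
proof -
  have *: "arctan b - arctan a \<le> b - a \<and> 0 \<le> arctan b - arctan a" if "a < b" for a b :: real
  proof -
    have "\<exists>z>a. z < b \<and> arctan b - arctan a = (b - a) * inverse (1 + z\<^sup>2)"
      by (rule MVT2[OF that]) (rule DERIV_arctan)
    then obtain z where "arctan b - arctan a = (b - a) * inverse (1 + z\<^sup>2)" by blast
    moreover have "inverse (1 + z\<^sup>2) \<le> 1" "0 \<le> inverse (1 + z\<^sup>2)"
      by (simp_all add: inverse_le_1_iff add_pos_nonneg less_imp_le)
    ultimately show ?thesis using that by (simp add: mult_left_le)
  qed
  show ?thesis using *[of x y] *[of y x] by (cases x y rule: linorder_cases) auto
qed

lemma prod_dist_le: "dist (a, b) (c, d) \<le> \<bar>a - c\<bar> + \<bar>b - (d::real)\<bar>" for a c :: real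
  by (simp add: dist_Pair_Pair dist_real_def) (metis sqrt_sum_squares_le_sum_abs power2_abs)

lemma dist_arctan_graph_le: "dist (x, y) (t, arctan c) \<le> \<bar>x - t\<bar> + \<bar>y\<bar> + 2"
proof -
  have "\<bar>arctan c\<bar> < 2" using arctan_bounded[of c] pi_less_4 by linarith
  then show ?thesis using prod_dist_le[of x y t "arctan c"] by linarith
qed

lemma infdist_graph_less_iff:
  "infdist p (arctan_graph f) < c \<longleftrightarrow> (\<exists>t\<ge>0. dist p (t, arctan (f t)) < c)"
  for p :: "real \<times> real"
proof -
  have "bdd_below ((\<lambda>t. dist p (t, arctan (f t))) ` {0..})" by (intro bdd_belowI[of _ 0]) auto
  then show ?thesis
    by (subst infdist_notempty) (auto simp: image_image cINF_less_iff)
qed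

lemma infdist_graph_le: "t \<ge> 0 \<Longrightarrow>
  infdist p (arctan_graph f) \<le> dist p (t, arctan (f t))" for p :: "real \<times> real"
  by (rule infdist_le) auto

text \<open>A nearly closest graph point to a given rational point sits at a time of at most twice
  the first coordinate plus the second plus 3, in absolute values: 2 bounds \<open>arctan\<close>
  and 1 is the slack of the near-minimizer. So it lies in the window, and moving to its partner
  costs at most \<open>e\<close> in time and \<open>e\<close> in value.\<close>

lemma graph_dist_diff_le:
  assumes "hclose T e f g" "e \<ge> 0" "T \<ge> 2 * \<bar>real_of_rat (fst p)\<bar> + \<bar>real_of_rat (snd p)\<bar> + 3"
  shows "\<bar>graph_dist f p - graph_dist g p\<bar> \<le> 2 * e"
proof -
  define x y where "x = real_of_rat (fst p)" and "y = real_of_rat (snd p)"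
  have *: "infdist (x, y) (arctan_graph g) \<le> infdist (x, y) (arctan_graph f) + 2 * e" if "hclose T e f g" for f g
  proof (rule field_le_epsilon)
    fix d :: real assume "d > 0"
    define d' where "d' = min d 1"
    have "infdist (x, y) (arctan_graph f) < infdist (x, y) (arctan_graph f) + d'" using \<open>d > 0\<close> by (simp add: d'_def)
    then obtain t where t: "t \<ge> 0" "dist (x, y) (t, arctan (f t)) < infdist (x, y) (arctan_graph f) + d'"
      unfolding infdist_graph_less_iff by blast
    have "infdist (x, y) (arctan_graph f) \<le> \<bar>x\<bar> + \<bar>y\<bar> + 2"
      using infdist_graph_le[of "max x 0" "(x, y)" f] dist_arctan_graph_le[of x y "max x 0" "f (max x 0)"]
      by linarith
    moreover have "\<bar>x - t\<bar> \<le> dist (x, y) (t, arctan (f t))"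
      using dist_fst_le[of "(x, y)" "(t, arctan (f t))"] by (simp add: dist_real_def)
    moreover have "T \<ge> 2 * \<bar>x\<bar> + \<bar>y\<bar> + 3" using assms(3) by (simp add: x_def y_def)
    moreover have "d' \<le> 1" by (simp add: d'_def)
    ultimately have "t \<le> T" using t by linarith
    then obtain s where s: "s \<ge> 0" "\<bar>s - t\<bar> \<le> e" "\<bar>g s - f t\<bar> \<le> e"
      using \<open>hclose T e f g\<close> t(1) unfolding hclose_def by (meson atLeastAtMost_iff)
    have "dist (t, arctan (f t)) (s, arctan (g s)) \<le> 2 * e"
      using prod_dist_le[of t "arctan (f t)" s "arctan (g s)"] s abs_arctan_diff_le[of "g s" "f t"]
      by (simp add: abs_minus_commute)
    then show "infdist (x, y) (arctan_graph g) \<le> infdist (x, y) (arctan_graph f) + 2 * e + d"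
      using infdist_graph_le[OF s(1), of "(x, y)" g] t(2)
        dist_triangle[of "(x, y)" "(s, arctan (g s))" "(t, arctan (f t))"]
      by (simp add: d'_def)
  qed
  have "hclose T e g f" using assms(1) by (auto simp: hclose_def)
  from *[OF assms(1)] *[OF this] show ?thesis
    by (simp add: graph_dist_def case_prod_beta x_def y_def)
qed

text \<open>The coordinates are weighted by powers of 1/2 in the product metric. Twice the maximum
  over the first coordinates plus the tail \<open>(1/2) ^ k\<close> bounds the distance, whence the
  shares \<open>\<eta> / 4\<close> per coordinate and \<open>\<eta> / 2\<close> for the
  tail.\<close>

lemma dist_fun_small:
  fixes \<eta> :: real
  assumes "\<eta> > 0"
  obtains I :: "'i::countable set" and \<delta> where "finite I" "\<delta> > 0"
    "\<And>u v :: 'i \<Rightarrow> 'm::metric_space. (\<And>i. i \<in> I \<Longrightarrow> dist (u i) (v i) \<le> \<delta>) \<Longrightarrow> dist u v < \<eta>"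
proof -
  obtain k where k: "(1/2::real) ^ k < \<eta> / 2"
    using real_arch_pow_inv[of "\<eta> / 2" "1/2"] assms by auto
  show ?thesis
  proof (rule that[of "from_nat ` {..k}" "\<eta> / 4"])
    fix u v :: "'i \<Rightarrow> 'm"
    assume *: "\<And>i. i \<in> from_nat ` {..k} \<Longrightarrow> dist (u i) (v i) \<le> \<eta> / 4"
    have "{dist (u (from_nat n)) (v (from_nat n)) |n. n \<le> k} =
       (\<lambda>n. dist (u (from_nat n)) (v (from_nat n))) ` {..k}" by auto
    then have "Max {dist (u (from_nat n)) (v (from_nat n)) |n. n \<le> k} \<le> \<eta> / 4"
      using * by (subst Max_le_iff) auto
    then show "dist u v < \<eta>"
      using dist_fun_le_dist_first_terms[of u v k] k by linarith
  qed (use assms in auto)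
qed

lemma tendsto_fun_iff:
  fixes F :: "nat \<Rightarrow> 'i::countable \<Rightarrow> 'm::metric_space"
  shows "F \<longlonglongrightarrow> f \<longleftrightarrow> (\<forall>i. (\<lambda>n. F n i) \<longlonglongrightarrow> f i)"
proof safe
  fix i assume "F \<longlonglongrightarrow> f"
  then show "(\<lambda>n. F n i) \<longlonglongrightarrow> f i"
    using continuous_on_tendsto_compose[OF continuous_on_product_coordinates[of i], of F f sequentially]
    by simp
next
  assume *: "\<forall>i. (\<lambda>n. F n i) \<longlonglongrightarrow> f i"
  show "F \<longlonglongrightarrow> f"
  proof (rule tendstoI)
    fix e :: real assume "e > 0"
    then obtain I :: "'i set" and d where I: "finite I" "d > 0"
      "\<And>u v :: 'i \<Rightarrow> 'm. (\<And>i. i \<in> I \<Longrightarrow> dist (u i) (v i) \<le> d) \<Longrightarrow> dist u v < e"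
      using dist_fun_small by blast
    have "\<forall>\<^sub>F n in sequentially. \<forall>i\<in>I. dist (F n i) (f i) < d"
      using I(1,2) * by (intro eventually_ball_finite ballI) (auto simp: tendsto_iff)
    then show "\<forall>\<^sub>F n in sequentially. dist (F n) f < e"
      by eventually_elim (auto intro!: I(3) less_imp_le)
  qed
qed

text \<open>At precision \<open>\<eta>\<close> only finitely many rational points matter, and one
  window is long enough for all of them. The choice of \<open>T\<close> and \<open>e\<close> is
  uniform in the two paths; this is how a deterministic comparison of paths enters the probabilistic
  argument.\<close>

lemma hclose_imp_graph_dist_close:
  assumes "\<eta> > 0"
  obtains T e where "T > 0" "e > 0" "\<And>f g. hclose T e f g \<Longrightarrow> dist (graph_dist f) (graph_dist g) < \<eta>"
proof -
  obtain I :: "(rat \<times> rat) set" and d where I: "finite I" "d > 0"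
      "\<And>u v :: rat \<times> rat \<Rightarrow> real. (\<And>i. i \<in> I \<Longrightarrow> dist (u i) (v i) \<le> d) \<Longrightarrow> dist u v < \<eta>"
    using dist_fun_small[OF assms] by blast
  define T where "T = (\<Sum>p\<in>I. 2 * \<bar>real_of_rat (fst p)\<bar> + \<bar>real_of_rat (snd p)\<bar>) + 3"
  have T: "T \<ge> 2 * \<bar>real_of_rat (fst p)\<bar> + \<bar>real_of_rat (snd p)\<bar> + 3" if "p \<in> I" for p
    unfolding T_def using member_le_sum[OF that, of "\<lambda>p. 2 * \<bar>real_of_rat (fst p)\<bar> + \<bar>real_of_rat (snd p)\<bar>"] I(1)
    by simp
  have "T > 0" unfolding T_def by (intro add_nonneg_pos sum_nonneg) auto
  then show ?thesis
  proof (rule that[of T "d / 2"])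
    fix f g assume "hclose T (d / 2) f g"
    then show "dist (graph_dist f) (graph_dist g) < \<eta>"
      using graph_dist_diff_le[of T "d / 2" f g] I(2) T by (intro I(3)) (auto simp: dist_real_def)
  qed (use I in auto)
qed

section \<open>Step functions and discretized paths\<close>

definition step_fun :: "real \<Rightarrow> (nat \<Rightarrow> real) \<Rightarrow> real \<Rightarrow> real" where
  "step_fun r u = (\<lambda>t\<in>{0..}. u (nat \<lfloor>r * t\<rfloor>))"

lemma floor_eventually_at_right: "\<forall>\<^sub>F s in at_right t. \<lfloor>r * s\<rfloor> = \<lfloor>r * t\<rfloor>" if "r \<ge> 0" for r t :: real
proof -
  have "((\<lambda>s. r * s) \<longlongrightarrow> r * t) (at_right t)" by (intro tendsto_intros)
  then have "\<forall>\<^sub>F s in at_right t. r * s < of_int \<lfloor>r * t\<rfloor> + 1" by (rule order_tendstoD) linarith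
  moreover have "\<forall>\<^sub>F s in at_right t. s > t" by (rule eventually_at_right_less)
  ultimately show ?thesis
  proof eventually_elim
    case (elim s)
    then have "r * t \<le> r * s" using that by (intro mult_left_mono) auto
    with elim show ?case by linarith
  qed
qed

lemma floor_eventually_at_left: "\<exists>k. \<forall>\<^sub>F s in at_left t. \<lfloor>r * s\<rfloor> = k" if "r \<ge> 0" for r t :: real
proof (cases "r = 0")
  case False
  \<comment> \<open>Just before \<open>t\<close> the floor is the ceiling of \<open>r * t\<close>
    minus 1, whether or not \<open>r * t\<close> is an integer.\<close>
  let ?k = "\<lceil>r * t\<rceil> - 1"
  have "((\<lambda>s. r * s) \<longlongrightarrow> r * t) (at_left t)" by (intro tendsto_intros)
  then have "\<forall>\<^sub>F s in at_left t. r * s > of_int ?k" by (rule order_tendstoD) linarith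
  moreover have "\<forall>\<^sub>F s in at_left t. s < t" by (simp add: eventually_at_filter)
  ultimately have "\<forall>\<^sub>F s in at_left t. \<lfloor>r * s\<rfloor> = ?k"
  proof eventually_elim
    case (elim s)
    then have "r * s < r * t" using that False by simp
    with elim show ?case by linarith
  qed
  then show ?thesis by blast
qed auto

lemma step_fun_Dplus: assumes "r \<ge> 0" shows "step_fun r u \<in> Dplus"
proof -
  have "cadlag (step_fun r u)"
    unfolding cadlag_def
  proof safe
    fix t :: real assume t: "t \<ge> 0"
    have "\<forall>\<^sub>F s in at_right t. step_fun r u s = step_fun r u t"
      using floor_eventually_at_right[OF assms, of t] eventually_at_right_less[of t]
      by eventually_elim (use t in \<open>auto simp: step_fun_def\<close>)
    then show "(step_fun r u \<longlongrightarrow> step_fun r u t) (at_right t)"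
      by (rule tendsto_eventually)
  next
    fix t :: real assume t: "t > 0"
    obtain k where k: "\<forall>\<^sub>F s in at_left t. \<lfloor>r * s\<rfloor> = k" using floor_eventually_at_left[OF assms] by blast
    have "\<forall>\<^sub>F s in at_left t. s > 0" using t by (rule order_tendstoD[OF tendsto_ident_at])
    with k have "\<forall>\<^sub>F s in at_left t. step_fun r u s = u (nat k)"
      by eventually_elim (auto simp: step_fun_def)
    then show "\<exists>l. (step_fun r u \<longlongrightarrow> l) (at_left t)"
      by (intro exI[of _ "u (nat k)"] tendsto_eventually)
  qed
  then show ?thesis by (auto simp: Dplus_def step_fun_def)
qed

text \<open>Only finitely many steps meet a bounded window, so convergence of every step height is
  uniform there.\<close>

lemma graph_dist_step_fun_tendsto:
  assumes "\<And>k. (\<lambda>n. u n k) \<longlonglongrightarrow> v k"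
  shows "(\<lambda>n. graph_dist (step_fun r (u n))) \<longlonglongrightarrow> graph_dist (step_fun r v)"
proof (rule tendstoI)
  fix \<eta> :: real assume "\<eta> > 0"
  from hclose_imp_graph_dist_close[OF this] obtain T e where
    T: "T > 0" "e > 0" "\<And>f g. hclose T e f g \<Longrightarrow> dist (graph_dist f) (graph_dist g) < \<eta>" by metis
  have "\<forall>\<^sub>F n in sequentially. \<forall>k\<in>{..nat \<lfloor>\<bar>r\<bar> * T\<rfloor>}. dist (u n k) (v k) < e"
    using assms T(2) by (intro eventually_ball_finite ballI) (auto simp: tendsto_iff)
  then show "\<forall>\<^sub>F n in sequentially. dist (graph_dist (step_fun r (u n))) (graph_dist (step_fun r v)) < \<eta>"
  proof eventually_elim
    case (elim n)
    have "\<bar>step_fun r (u n) t - step_fun r v t\<bar> \<le> e" if "t \<in> {0..T}" for t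
    proof -
      have "r * t \<le> \<bar>r\<bar> * T" using that by (intro mult_mono) auto
      then have "nat \<lfloor>r * t\<rfloor> \<in> {..nat \<lfloor>\<bar>r\<bar> * T\<rfloor>}" by (auto intro!: nat_mono floor_mono)
      with elim that show ?thesis by (force simp: step_fun_def dist_real_def)
    qed
    then show ?case
      using T(2) by (intro T(3)) (force simp: hclose_def abs_minus_commute)
  qed
qed

text \<open>Every point on the graph of the discretization is within one mesh width of a graph point
  of \<open>f\<close>, so distances to it are not much smaller. Conversely a nearly closest graph
  point of \<open>f\<close> is approached from the right by grid times, so distances are not much
  larger in the limit.\<close>

lemma graph_dist_discretize:
  assumes "f \<in> Dplus"
  shows "(\<lambda>m. graph_dist (step_fun (real (Suc m)) (\<lambda>k. f (real k / real (Suc m))))) \<longlonglongrightarrow> graph_dist f"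
  unfolding tendsto_fun_iff
proof (intro allI)
  fix i :: "rat \<times> rat"
  define p where "p = (real_of_rat (fst i), real_of_rat (snd i))"
  let ?g = "\<lambda>m. step_fun (real (Suc m)) (\<lambda>k. f (real k / real (Suc m)))"
  let ?D = "\<lambda>f. infdist p (arctan_graph f)"
  have lim1: "(\<lambda>m. 1 / real (Suc m)) \<longlonglongrightarrow> 0"
    using LIMSEQ_inverse_real_of_nat by (simp add: inverse_eq_divide)
  have lower: "?D f - 1 / real (Suc m) \<le> ?D (?g m)" for m
  proof (rule field_le_epsilon)
    fix d :: real assume "d > 0"
    then have "?D (?g m) < ?D (?g m) + d" by simp
    then obtain t where t: "t \<ge> 0" "dist p (t, arctan (?g m t)) < ?D (?g m) + d"
      unfolding infdist_graph_less_iff by blast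
    define s where "s = real (nat \<lfloor>real (Suc m) * t\<rfloor>) / real (Suc m)"
    have "of_int \<lfloor>real (Suc m) * t\<rfloor> \<le> real (Suc m) * t" "real (Suc m) * t < of_int \<lfloor>real (Suc m) * t\<rfloor> + 1"
      by linarith+
    moreover have "real (nat \<lfloor>real (Suc m) * t\<rfloor>) = of_int \<lfloor>real (Suc m) * t\<rfloor>" using t by simp
    moreover have "t - s = (real (Suc m) * t - real (nat \<lfloor>real (Suc m) * t\<rfloor>)) / real (Suc m)"
      unfolding s_def by (simp add: diff_divide_distrib del: of_nat_Suc)
    ultimately have "\<bar>t - s\<bar> \<le> 1 / real (Suc m)"
      by (simp only: abs_divide) (intro frac_le; linarith)
    then have "dist (t, arctan (?g m t)) (s, arctan (f s)) \<le> 1 / real (Suc m)"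
      using t(1) prod_dist_le[of t "arctan (?g m t)" s "arctan (f s)"]
      by (simp add: step_fun_def s_def)
    moreover have "?D f \<le> dist p (s, arctan (f s))" by (rule infdist_graph_le) (simp add: s_def)
    ultimately show "?D f - 1 / real (Suc m) \<le> ?D (?g m) + d"
      using t(2) dist_triangle[of p "(s, arctan (f s))" "(t, arctan (?g m t))"] by linarith
  qed
  have upper: "\<forall>\<^sub>F m in sequentially. ?D (?g m) < c" if "?D f < c" for c
  proof -
    from that obtain t where t: "t \<ge> 0" "dist p (t, arctan (f t)) < c"
      unfolding infdist_graph_less_iff by blast
    \<comment> \<open>Rounding up, not down: \<open>f\<close> is continuous only from the
      right.\<close>
    define s where "s m = real (nat \<lceil>real (Suc m) * t\<rceil>) / real (Suc m)" for m
    have sb: "t \<le> s m \<and> s m \<le> t + 1 / real (Suc m)" for m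
    proof -
      have "real (nat \<lceil>real (Suc m) * t\<rceil>) = of_int \<lceil>real (Suc m) * t\<rceil>" using t by simp
      moreover have "real (Suc m) * t \<le> of_int \<lceil>real (Suc m) * t\<rceil>"
        "of_int \<lceil>real (Suc m) * t\<rceil> \<le> real (Suc m) * t + 1" by linarith+
      ultimately show ?thesis unfolding s_def by (simp add: field_simps del: of_nat_Suc)
    qed
    have "s \<longlonglongrightarrow> t"
    proof (rule real_tendsto_sandwich[where f = "\<lambda>_. t" and h = "\<lambda>m. t + 1 / real (Suc m)"])
      show "(\<lambda>m. t + 1 / real (Suc m)) \<longlonglongrightarrow> t" using tendsto_add[OF tendsto_const lim1, of t] by simp
    qed (use sb in auto)
    have gs: "?g m (s m) = f (s m)" for m
      using sb[of m] t(1) by (simp add: step_fun_def s_def del: of_nat_Suc)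
    have "(f \<longlongrightarrow> f t) (at_right t)" using assms t by (auto simp: Dplus_def cadlag_def)
    then have "(f \<longlongrightarrow> f t) (at t within {t..})"
      by (metis at_within_Icc_at_right tendsto_within_subset continuous_within
          at_within_Ici_at_right)
    then have "continuous (at t within {t..}) f" by (simp add: continuous_within)
    then have "(\<lambda>m. f (s m)) \<longlonglongrightarrow> f t"
      using \<open>s \<longlonglongrightarrow> t\<close> sb unfolding continuous_within_sequentially by (auto simp: comp_def)
    then have "(\<lambda>m. dist p (s m, arctan (f (s m)))) \<longlonglongrightarrow> dist p (t, arctan (f t))"
      using \<open>s \<longlonglongrightarrow> t\<close> by (intro tendsto_intros)
    then have "\<forall>\<^sub>F m in sequentially. dist p (s m, arctan (f (s m))) < c" using t(2) by (rule order_tendstoD)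
    then show ?thesis
    proof eventually_elim
      case (elim m)
      have "?D (?g m) \<le> dist p (s m, arctan (?g m (s m)))"
        by (rule infdist_graph_le) (use sb[of m] t in linarith)
      with elim gs show ?case by simp
    qed
  qed
  have "(\<lambda>m. ?D (?g m)) \<longlonglongrightarrow> ?D f"
  proof (rule order_tendstoI)
    fix a assume "a < ?D f"
    moreover have "(\<lambda>m. ?D f - 1 / real (Suc m)) \<longlonglongrightarrow> ?D f"
      using tendsto_diff[OF tendsto_const lim1, of "?D f"] by simp
    ultimately have "\<forall>\<^sub>F m in sequentially. a < ?D f - 1 / real (Suc m)" by (metis order_tendstoD(1))
    then show "\<forall>\<^sub>F m in sequentially. a < ?D (?g m)"
      by eventually_elim (use lower less_le_trans in blast)
  qed (rule upper)
  then show "(\<lambda>m. graph_dist (?g m) i) \<longlonglongrightarrow> graph_dist f i"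
    by (simp add: graph_dist_def case_prod_beta p_def)
qed

text \<open>By right continuity rational times suffice to witness that the infimum is below a bound,
  so the sublevel sets are countable unions of events.\<close>

lemma graph_dist_measurable:
  assumes "\<And>t. t \<ge> 0 \<Longrightarrow> (\<lambda>x. A x t) \<in> borel_measurable M"
    and "\<And>x. x \<in> space M \<Longrightarrow> cadlag (A x)"
  shows "(\<lambda>x. graph_dist (A x)) \<in> borel_measurable M"
proof (rule measurable_coordinatewise_then_product)
  fix i :: "rat \<times> rat"
  define p where "p = (real_of_rat (fst i), real_of_rat (snd i))"
  let ?D = "\<lambda>f. infdist p (arctan_graph f)"
  have eq: "{x \<in> space M. ?D (A x) < c} =
     {x \<in> space M. \<exists>q\<in>\<rat> \<inter> {0..}. dist p (q, arctan (A x q)) < c}" for c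
  proof (intro Collect_cong conj_cong refl iffI)
    fix x assume x: "x \<in> space M" "?D (A x) < c"
    then obtain t where t: "t \<ge> 0" "dist p (t, arctan (A x t)) < c"
      unfolding infdist_graph_less_iff by blast
    have "(A x \<longlongrightarrow> A x t) (at_right t)" using assms(2)[OF x(1)] t by (auto simp: cadlag_def)
    then have "((\<lambda>s. dist p (s, arctan (A x s))) \<longlongrightarrow> dist p (t, arctan (A x t))) (at_right t)"
      by (intro tendsto_intros)
    then have "\<forall>\<^sub>F s in at_right t. dist p (s, arctan (A x s)) < c" using t(2) by (rule order_tendstoD)
    then obtain b where b: "b > t" "\<And>s. t < s \<Longrightarrow> s < b \<Longrightarrow> dist p (s, arctan (A x s)) < c"
      unfolding eventually_at_right_field by blast
    then obtain q where "q \<in> \<rat>" "t < q" "q < b" using Rats_dense_in_real by blast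
    with b t show "\<exists>q\<in>\<rat> \<inter> {0..}. dist p (q, arctan (A x q)) < c"
      by (intro bexI[of _ q]) auto
  qed (auto simp: infdist_graph_less_iff)
  have "{x \<in> space M. ?D (A x) < c} \<in> sets M" for c
    unfolding eq
  proof (rule sets.sets_Collect_countable_Ex')
    fix q :: real assume q: "q \<in> \<rat> \<inter> {0..}"
    have [measurable]: "(\<lambda>x. A x q) \<in> borel_measurable M" using q by (intro assms(1)) auto
    show "{x \<in> space M. dist p (q, arctan (A x q)) < c} \<in> sets M" by measurable
  qed (intro countable_Int1 countable_rat)
  then have "(\<lambda>x. ?D (A x)) \<in> borel_measurable M" by (simp add: borel_measurable_iff_less)
  then show "(\<lambda>x. graph_dist (A x) i) \<in> borel_measurable M"
    by (simp add: graph_dist_def case_prod_beta p_def)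
qed

section \<open>From convergence of graph distances to $J_2$ convergence\<close>

lemma finite_rational_net:
  assumes "d > 0"
  obtains P :: "(rat \<times> rat) set" where "finite P"
    "\<And>x y. 0 \<le> x \<Longrightarrow> x \<le> L \<Longrightarrow> \<bar>y\<bar> \<le> 2 \<Longrightarrow>
      \<exists>p\<in>P. dist (real_of_rat (fst p), real_of_rat (snd p)) (x, y) < d"
proof -
  let ?b = "\<lambda>p. ball (real_of_rat (fst p), real_of_rat (snd p)) d"
  have cover: "{0..L} \<times> {-2..2} \<subseteq> (\<Union>p\<in>UNIV. ?b p)"
  proof
    fix z assume "z \<in> {0..L} \<times> {-2..2::real}"
    obtain x y where z: "z = (x, y)" by (cases z)
    obtain a where a: "x < real_of_rat a" "real_of_rat a < x + d / 2" using of_rat_dense[of x "x + d / 2"] assms by auto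
    obtain b where b: "y < real_of_rat b" "real_of_rat b < y + d / 2" using of_rat_dense[of y "y + d / 2"] assms by auto
    have "dist (real_of_rat a, real_of_rat b) (x, y) < d"
      using prod_dist_le[of "real_of_rat a" "real_of_rat b" x y] a b by linarith
    then show "z \<in> (\<Union>p\<in>UNIV. ?b p)" unfolding z by (intro UN_I[of "(a, b)"]) auto
  qed
  have "compact ({0..L} \<times> {-2..2::real})" by (intro compact_Times compact_Icc)
  then obtain P where P: "finite P" "{0..L} \<times> {-2..2} \<subseteq> (\<Union>p\<in>P. ?b p)"
    by (rule compactE_image[OF _ _ cover]) auto
  show ?thesis
  proof (rule that[OF P(1)])
    fix x y :: real assume "0 \<le> x" "x \<le> L" "\<bar>y\<bar> \<le> 2"
    then have "(x, y) \<in> (\<Union>p\<in>P. ?b p)" using P(2) by (intro subsetD[OF P(2)]) auto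
    then show "\<exists>p\<in>P. dist (real_of_rat (fst p), real_of_rat (snd p)) (x, y) < d" by auto
  qed
qed

text \<open>The strip over the window is compact, so finitely many rational points form a net of
  mesh \<open>d / 4\<close> and convergence at these points is enough. A point on one graph is
  within \<open>d / 4\<close> of a net point, whose distance to the other graph is then below
  \<open>d / 2\<close>; the total stays below \<open>d\<close>.\<close>

lemma graph_dist_tendsto_imp_hausdorff:
  assumes "(\<lambda>n. graph_dist (F n)) \<longlonglongrightarrow> graph_dist f" "d > 0"
  shows "\<forall>\<^sub>F n in sequentially.
     (\<forall>t\<in>{0..L}. \<exists>s\<ge>0. \<bar>s - t\<bar> < d \<and> \<bar>arctan (F n s) - arctan (f t)\<bar> < d) \<and>
     (\<forall>s\<in>{0..L}. \<exists>t\<ge>0. \<bar>s - t\<bar> < d \<and> \<bar>arctan (F n s) - arctan (f t)\<bar> < d)"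
proof -
  obtain P :: "(rat \<times> rat) set" where P: "finite P"
    "\<And>x y. 0 \<le> x \<Longrightarrow> x \<le> L \<Longrightarrow> \<bar>y\<bar> \<le> 2 \<Longrightarrow>
      \<exists>p\<in>P. dist (real_of_rat (fst p), real_of_rat (snd p)) (x, y) < d / 4"
    using finite_rational_net[of "d / 4" L] assms(2) by (metis zero_less_divide_iff zero_less_numeral)
  let ?p = "\<lambda>p. (real_of_rat (fst p), real_of_rat (snd p))"
  have tr: "\<exists>s\<ge>0. \<bar>s - t\<bar> < d \<and> \<bar>arctan (g s) - arctan (h t)\<bar> < d"
    if t: "t \<in> {0..L}" and c: "\<And>p. p \<in> P \<Longrightarrow> \<bar>graph_dist g p - graph_dist h p\<bar> < d / 4" for g h t
  proof -
    have "\<bar>arctan (h t)\<bar> \<le> 2" using arctan_bounded[of "h t"] pi_less_4 by linarith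
    then obtain p where p: "p \<in> P" "dist (?p p) (t, arctan (h t)) < d / 4"
      using P(2)[of t "arctan (h t)"] t by (simp only: atLeastAtMost_iff) blast
    then have "graph_dist h p < d / 4"
      using t infdist_graph_less_iff[of "?p p" h "d / 4"]
      by (auto simp: graph_dist_def case_prod_beta)
    then have "graph_dist g p < d / 2" using c[OF p(1)] by linarith
    then obtain s where s: "s \<ge> 0" "dist (?p p) (s, arctan (g s)) < d / 2"
      using infdist_graph_less_iff[of "?p p" g "d / 2"] by (auto simp: graph_dist_def case_prod_beta)
    have "dist (s, arctan (g s)) (t, arctan (h t)) < d"
      using p(2) s(2) dist_triangle2[of "(s, arctan (g s))" "(t, arctan (h t))" "?p p"]
        dist_triangle3[of "(s, arctan (g s))" "(t, arctan (h t))" "?p p"] assms(2) by linarith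
    then have "\<bar>s - t\<bar> < d" "\<bar>arctan (g s) - arctan (h t)\<bar> < d"
      using dist_fst_le[of "(s, arctan (g s))" "(t, arctan (h t))"]
        dist_snd_le[of "(s, arctan (g s))" "(t, arctan (h t))"] by (auto simp: dist_real_def)
    with s show ?thesis by blast
  qed
  have "\<forall>\<^sub>F n in sequentially. \<forall>p\<in>P. \<bar>graph_dist (F n) p - graph_dist f p\<bar> < d / 4"
  proof (intro eventually_ball_finite ballI P(1))
    fix p
    have "(\<lambda>n. graph_dist (F n) p) \<longlonglongrightarrow> graph_dist f p" using assms(1) unfolding tendsto_fun_iff by blast
    then show "\<forall>\<^sub>F n in sequentially. \<bar>graph_dist (F n) p - graph_dist f p\<bar> < d / 4"
      using assms(2) by (auto simp: tendsto_iff dist_real_def dest!: spec[of _ "d / 4"])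
  qed
  then show ?thesis
  proof eventually_elim
    case (elim n)
    show ?case
    proof (intro conjI ballI)
      fix t assume "t \<in> {0..L}"
      then show "\<exists>s\<ge>0. \<bar>s - t\<bar> < d \<and> \<bar>arctan (F n s) - arctan (f t)\<bar> < d"
        using elim by (intro tr) auto
    next
      fix t assume "t \<in> {0..L}"
      then have "\<exists>s\<ge>0. \<bar>s - t\<bar> < d \<and> \<bar>arctan (f s) - arctan (F n t)\<bar> < d"
        using elim by (intro tr) (auto simp: abs_minus_commute)
      then show "\<exists>s\<ge>0. \<bar>t - s\<bar> < d \<and> \<bar>arctan (F n t) - arctan (f s)\<bar> < d"
        by (simp add: abs_minus_commute)
    qed
  qed
qed

text \<open>Only \<open>a\<close> is bounded: it is a value of the limit path, while
  \<open>b\<close> is a value of an approximating path, on which there is no bound beforehand.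
  Closeness to \<open>arctan a\<close> itself confines \<open>b\<close>, and compactness in
  \<open>a\<close> makes the threshold uniform.\<close>

lemma arctan_inverse_uniform:
  fixes e :: real
  assumes "e > 0"
  obtains d where "d > 0" "\<And>a b. \<bar>a\<bar> \<le> K \<Longrightarrow> \<bar>arctan b - arctan a\<bar> < d \<Longrightarrow> \<bar>b - a\<bar> < e"
proof (cases "K \<ge> 0")
  case True
  define \<phi> where "\<phi> a = min (arctan (a + e) - arctan a) (arctan a - arctan (a - e))" for a
  have "continuous_on {-K..K} \<phi>" unfolding \<phi>_def by (intro continuous_intros)
  then obtain m where m: "m \<in> {-K..K}" "\<And>a. a \<in> {-K..K} \<Longrightarrow> \<phi> m \<le> \<phi> a"
    using continuous_attains_inf[of "{-K..K}" \<phi>] True by auto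
  have "\<phi> m > 0" using assms by (auto simp: \<phi>_def arctan_less_iff)
  then show ?thesis
  proof (rule that)
    fix a b :: real assume *: "\<bar>a\<bar> \<le> K" "\<bar>arctan b - arctan a\<bar> < \<phi> m"
    have "\<phi> m \<le> \<phi> a" by (rule m(2)) (use *(1) in auto)
    with *(2) have "\<bar>arctan b - arctan a\<bar> < \<phi> a" by linarith
    then have "arctan b < arctan (a + e)" "arctan (a - e) < arctan b" by (auto simp: \<phi>_def)
    then show "\<bar>b - a\<bar> < e" by (auto simp: arctan_less_iff)
  qed
next
  case False
  then show ?thesis by (intro that[of 1]) auto
qed

text \<open>The difficulty is the right end of the interval: the partner of a time near
  \<open>T\<close> may lie beyond \<open>T\<close>, whereas \<open>J2_dist_le\<close> asks for
  witnesses below \<open>T\<close>. Continuity of the limit at \<open>T\<close> allows times near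
  \<open>T\<close> to be moved to \<open>T - 2 * d\<close> at little cost.\<close>

lemma graph_dist_tendsto_imp_J2_converges:
  assumes F: "range F \<subseteq> Dplus" and f: "f \<in> Dplus"
    and lim: "(\<lambda>n. graph_dist (F n)) \<longlonglongrightarrow> graph_dist f"
  shows "J2_converges F f"
  unfolding J2_converges_def
proof (intro allI impI)
  fix T :: real assume T: "T > 0" "isCont f T"
  have cf: "cadlag f" "\<And>n. cadlag (F n)" using F f by (auto simp: Dplus_def)
  obtain K where K: "\<And>t. 0 \<le> t \<Longrightarrow> t \<le> T + 1 \<Longrightarrow> \<bar>f t\<bar> \<le> K"
    using cadlag_bounded_on_interval[OF cf(1), of "T + 1"] by blast
  have *: "\<forall>\<^sub>F n in sequentially. J2_dist {0..T} (F n) f \<le> e" if "e > 0" for e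
  proof -
    obtain d1 where d1: "d1 > 0" "\<And>a b. \<bar>a\<bar> \<le> K \<Longrightarrow> \<bar>arctan b - arctan a\<bar> < d1 \<Longrightarrow> \<bar>b - a\<bar> < e / 2"
      using arctan_inverse_uniform[of "e / 2" K] \<open>e > 0\<close> by (metis half_gt_zero)
    obtain d2 where d2: "d2 > 0" "\<And>u. \<bar>u - T\<bar> < d2 \<Longrightarrow> \<bar>f u - f T\<bar> < e / 8"
      using T(2) \<open>e > 0\<close> unfolding continuous_at_eps_delta
      by (metis dist_real_def real_norm_def zero_less_divide_iff zero_less_numeral)
    \<comment> \<open>In turn: the total time shift stays below \<open>e\<close>,
      \<open>arctan\<close> can be inverted, \<open>T - 2 * d\<close> and \<open>T + d\<close> are
      in the range of continuity at \<open>T\<close>, \<open>T - 2 * d\<close> is positive, and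
      times up to \<open>T + d\<close> are within the range of the bound \<open>K\<close>.\<close>
    define d where "d = Min {e / 8, d1, d2 / 4, T / 4, 1}"
    have d: "d > 0" "d \<le> e / 8" "d \<le> d1" "d \<le> d2 / 4" "d \<le> T / 4" "d \<le> 1"
      using \<open>e > 0\<close> d1(1) d2(1) T(1) by (auto simp: d_def)
    have shift: "\<bar>f (min t (T - 2 * d)) - f t\<bar> < e / 4 \<and> \<bar>min t (T - 2 * d) - t\<bar> < 3 * d"
      if "t < T + d" for t
    proof (cases "t \<le> T - 2 * d")
      case True then show ?thesis using \<open>e > 0\<close> d by simp
    next
      case False
      have "\<bar>f t - f T\<bar> < e / 8" using False that d by (intro d2(2)) linarith
      moreover have "\<bar>f (T - 2 * d) - f T\<bar> < e / 8" using d by (intro d2(2)) linarith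
      moreover have m: "min t (T - 2 * d) = T - 2 * d" using False by simp
      ultimately show ?thesis unfolding m using False that d(1) by (intro conjI) linarith+
    qed
    from graph_dist_tendsto_imp_hausdorff[OF lim \<open>d > 0\<close>, of "T + 1"] show ?thesis
    proof eventually_elim
      case (elim n)
      show ?case
      proof (rule J2_dist_le[OF cf(2) cf(1) T(1)])
        fix t assume t: "t \<in> {0..T}"
        \<comment> \<open>Moving the time of the limit path back by at least \<open>2 * d\<close>
          near the end leaves its partner, at distance below \<open>d\<close>, strictly before
          \<open>T\<close>.\<close>
        define t' where "t' = min t (T - 2 * d)"
        have t': "0 \<le> t'" "t' \<le> T - 2 * d" using t d by (auto simp: t'_def)
        then have "t' \<in> {0..T + 1}" using d by auto
        then obtain s where s: "s \<ge> 0" "\<bar>s - t'\<bar> < d" "\<bar>arctan (F n s) - arctan (f t')\<bar> < d"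
          using elim by blast
        have "\<bar>F n s - f t'\<bar> < e / 2" using s d t' by (intro d1(2) K) auto
        moreover have "\<bar>f t' - f t\<bar> < e / 4 \<and> \<bar>t' - t\<bar> < 3 * d"
          unfolding t'_def using t d by (intro shift) auto
        ultimately have "\<bar>s - t\<bar> < e" "\<bar>F n s - f t\<bar> < e" "s < T"
          using s t' d \<open>e > 0\<close> by linarith+
        with s(1) show "\<exists>s\<in>{0..<T}. \<bar>s - t\<bar> < e \<and> \<bar>F n s - f t\<bar> < e" by auto
      next
        fix s assume s: "s \<in> {0..T}"
        then have "s \<in> {0..T + 1}" by auto
        then obtain t where t: "t \<ge> 0" "\<bar>s - t\<bar> < d" "\<bar>arctan (F n s) - arctan (f t)\<bar> < d"
          using elim by blast
        have "\<bar>F n s - f t\<bar> < e / 2" using s t d by (intro d1(2) K) auto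
        \<comment> \<open>Here the partner is a time of the limit path and may exceed
          \<open>T\<close> by up to \<open>d\<close>; it is itself pulled back.\<close>
        moreover define t' where "t' = min t (T - 2 * d)"
        moreover have "\<bar>f t' - f t\<bar> < e / 4 \<and> \<bar>t' - t\<bar> < 3 * d"
          unfolding t'_def using t s by (intro shift) auto
        moreover have "0 \<le> t'" "t' < T" using t(1) d T(1) by (auto simp: t'_def)
        ultimately have "\<bar>s - t'\<bar> < e" "\<bar>F n s - f t'\<bar> < e" "0 \<le> t' \<and> t' < T"
          using t d \<open>e > 0\<close> by linarith+
        then show "\<exists>t\<in>{0..<T}. \<bar>s - t\<bar> < e \<and> \<bar>F n s - f t\<bar> < e" by (intro bexI[of _ t']) auto
      qed
    qed
  qed
  show "(\<lambda>n. J2_dist {0..T} (F n) f) \<longlonglongrightarrow> 0"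
  proof (rule tendstoI)
    fix e :: real assume "e > 0"
    then have "\<forall>\<^sub>F n in sequentially. J2_dist {0..T} (F n) f \<le> e / 2" by (intro *) auto
    then show "\<forall>\<^sub>F n in sequentially. dist (J2_dist {0..T} (F n) f) 0 < e"
      by eventually_elim (use \<open>e > 0\<close> T J2_dist_bounds(1) in \<open>simp add: dist_real_def\<close>)
  qed
qed

lemma J2_converges_imp_limitin:
  assumes "range F \<subseteq> Dplus" "f \<in> Dplus" "J2_converges F f"
  shows "limitin J2_topology F f sequentially"
  unfolding limitin_def topspace_J2_topology openin_J2_topology
proof (intro conjI allI impI assms(2))
  fix U assume "J2_open U \<and> f \<in> U"
  then have "\<forall>F. range F \<subseteq> Dplus \<longrightarrow> J2_converges F f \<longrightarrow> (\<forall>\<^sub>F n in sequentially. F n \<in> U)"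
    unfolding J2_open_def by blast
  then show "\<forall>\<^sub>F n in sequentially. F n \<in> U" using assms(1,3) by blast
qed

section \<open>Convergence in distribution through an embedding\<close>

text \<open>\<open>H\<close> is the infimal convolution of \<open>h\<close> with \<open>L\<close>
  times the metric, cut off at \<open>C\<close>. It is defined on the whole space although
  \<open>h\<close> matters only on \<open>S\<close>, and the cut-off keeps it bounded far away from
  \<open>S\<close>.\<close>

lemma Lipschitz_envelope:
  fixes h :: "'d::metric_space \<Rightarrow> real"
  assumes ne: "S \<noteq> {}" and bd: "\<And>y. y \<in> S \<Longrightarrow> \<bar>h y\<bar> \<le> C" and "L \<ge> 0"
  defines "H \<equiv> \<lambda>u. INF y\<in>S. min C (h y + L * dist u y)"
  shows "\<bar>H u\<bar> \<le> C" "\<bar>H u - H v\<bar> \<le> L * dist u v" "u \<in> S \<Longrightarrow> H u \<le> h u"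
proof -
  have C: "- C \<le> C" using ne bd by fastforce
  have lo: "- C \<le> min C (h y + L * dist u y)" if "y \<in> S" for u y
  proof -
    have "0 \<le> L * dist u y" using assms(3) by simp
    then show ?thesis using bd[OF that] C by (simp add: abs_le_iff)
  qed
  then have bb: "bdd_below ((\<lambda>y. min C (h y + L * dist u y)) ` S)" for u
    by (intro bdd_belowI[of _ "-C"]) auto
  obtain y0 where y0: "y0 \<in> S" using ne by blast
  have "H u \<le> C" unfolding H_def by (rule cINF_lower2[OF bb y0]) simp
  moreover have "- C \<le> H u" unfolding H_def by (rule cINF_greatest[OF ne lo])
  ultimately show "\<bar>H u\<bar> \<le> C" by simp
  have *: "H u - L * dist u v \<le> H v" for u v
    unfolding H_def
  proof (rule cINF_greatest[OF ne])
    fix y assume y: "y \<in> S"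
    have "(INF y\<in>S. min C (h y + L * dist u y)) \<le> min C (h y + L * dist u y)"
      by (rule cINF_lower[OF bb y])
    moreover have "L * dist u y \<le> L * dist u v + L * dist v y"
      using mult_left_mono[OF dist_triangle assms(3), of u y v] by (simp add: distrib_left)
    moreover have "0 \<le> L * dist u v" using assms(3) by simp
    ultimately show "(INF y\<in>S. min C (h y + L * dist u y)) - L * dist u v \<le> min C (h y + L * dist v y)"
      by linarith
  qed
  show "\<bar>H u - H v\<bar> \<le> L * dist u v" using *[of u v] *[of v u] by (simp add: dist_commute abs_le_iff)
  show "H u \<le> h u" if "u \<in> S"
    unfolding H_def by (rule cINF_lower2[OF bb that]) simp
qed

text \<open>For large slopes, points at distance at least \<open>d\<close> from \<open>u\<close> are
  penalized by more than \<open>2 * C\<close>, the largest possible oscillation of \<open>h\<close>;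
  nearer points are controlled by continuity on \<open>S\<close>.\<close>

lemma Lipschitz_envelope_tendsto:
  fixes h :: "'d::metric_space \<Rightarrow> real"
  assumes bd: "\<And>y. y \<in> S \<Longrightarrow> \<bar>h y\<bar> \<le> C" and u: "u \<in> S" and h: "continuous_on S h"
  shows "(\<lambda>n. INF y\<in>S. min C (h y + real n * dist u y)) \<longlonglongrightarrow> h u"
proof (rule metric_LIMSEQ_I)
  fix e :: real assume e: "e > 0"
  have ne: "S \<noteq> {}" using u by blast
  obtain d where d: "d > 0" "\<And>y. y \<in> S \<Longrightarrow> dist y u < d \<Longrightarrow> \<bar>h y - h u\<bar> < e / 2"
    using h u e unfolding continuous_on_iff dist_real_def by (metis half_gt_zero)
  obtain N :: nat where N: "2 * C / d < real N" using reals_Archimedean2 by blast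
  have "dist (INF y\<in>S. min C (h y + real n * dist u y)) (h u) < e" if "n \<ge> N" for n
  proof -
    have "h u - e / 2 \<le> (INF y\<in>S. min C (h y + real n * dist u y))"
    proof (rule cINF_greatest[OF ne])
      fix y assume y: "y \<in> S"
      have hu: "h u \<le> C" "- C \<le> h y" using bd[OF u] bd[OF y] by auto
      show "h u - e / 2 \<le> min C (h y + real n * dist u y)"
      proof (cases "dist y u < d")
        case True
        then have "\<bar>h y - h u\<bar> < e / 2" using d y by blast
        moreover have "0 \<le> real n * dist u y" by simp
        ultimately show ?thesis using hu e by (simp only: min_le_iff_disj min.bounded_iff) linarith
      next
        case False
        have "2 * C < real N * d" using N d(1) by (simp add: field_simps)
        also have "real N * d \<le> real n * dist u y"
          using that False d(1) by (intro mult_mono) (auto simp: dist_commute)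
        finally show ?thesis using hu e by (simp only: min.bounded_iff) linarith
      qed
    qed
    moreover have "(INF y\<in>S. min C (h y + real n * dist u y)) \<le> h u"
      using Lipschitz_envelope(3)[where S = S and h = h and C = C and L = "real n" and u = u] bd u ne by simp
    ultimately show ?thesis using e by (simp add: dist_real_def)
  qed
  then show "\<exists>N. \<forall>n\<ge>N. dist (INF y\<in>S. min C (h y + real n * dist u y)) (h u) < e" by blast
qed

text \<open>All that is asked of \<open>\<iota>\<close> is that convergence of images implies
  convergence in \<open>X\<close>. Membership of an open set then means positive distance from the
  image of its complement, which gives measurability. A bounded continuous function on
  \<open>X\<close> becomes a continuous one on the image, to which Lipschitz envelopes
  apply.\<close>

lemma converges_in_distribution_via_embedding:
  fixes X :: "'c topology" and \<iota> :: "'c \<Rightarrow> 'd::metric_space"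
  assumes M: "prob_space M" and N: "prob_space N"
    and A: "\<And>n x. x \<in> space M \<Longrightarrow> A n x \<in> topspace X" "\<And>n. (\<lambda>x. \<iota> (A n x)) \<in> borel_measurable M"
    and B: "\<And>y. y \<in> space N \<Longrightarrow> B y \<in> topspace X" "(\<lambda>y. \<iota> (B y)) \<in> borel_measurable N"
    and emb: "\<And>F f. range F \<subseteq> topspace X \<Longrightarrow> f \<in> topspace X \<Longrightarrow> (\<lambda>n. \<iota> (F n)) \<longlonglongrightarrow> \<iota> f \<Longrightarrow>
       limitin X F f sequentially"
    and lim: "\<And>H L C. (\<And>u. \<bar>H u\<bar> \<le> C) \<Longrightarrow> (\<And>u v. \<bar>H u - H v\<bar> \<le> L * dist u v) \<Longrightarrow>
       (\<lambda>n. \<integral>x. H (\<iota> (A n x)) \<partial>M) \<longlonglongrightarrow> (\<integral>y. H (\<iota> (B y)) \<partial>N :: real)"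
  shows "converges_in_distribution X M A N B"
proof -
  interpret M: prob_space M by fact
  interpret N: prob_space N by fact
  have meas: "G \<in> measurable Q (borel_sets_of X)"
    if G: "\<And>x. x \<in> space Q \<Longrightarrow> G x \<in> topspace X" "(\<lambda>x. \<iota> (G x)) \<in> borel_measurable Q"
    for G and Q :: "'q measure"
    unfolding borel_sets_of_def
  proof (rule measurable_sigma_sets)
    show "sets (sigma (topspace X) {U. openin X U}) = sigma_sets (topspace X) {U. openin X U}"
      using openin_subset by (intro sets_measure_of) auto
    show "{U. openin X U} \<subseteq> Pow (topspace X)" using openin_subset by auto
    show "G \<in> space Q \<rightarrow> topspace X" using G by auto
    fix U assume "U \<in> {U. openin X U}"
    then have U: "openin X U" by simp
    show "G -` U \<inter> space Q \<in> sets Q"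
    proof (cases "topspace X - U = {}")
      case True
      then have "G -` U \<inter> space Q = space Q" using G by auto
      then show ?thesis by simp
    next
      case False
      have "g \<in> U \<longleftrightarrow> 0 < infdist (\<iota> g) (\<iota> ` (topspace X - U))" if g: "g \<in> topspace X" for g
      proof
        assume "g \<in> U"
        show "0 < infdist (\<iota> g) (\<iota> ` (topspace X - U))"
        proof (rule ccontr)
          assume "\<not> ?thesis"
          then have "infdist (\<iota> g) (\<iota> ` (topspace X - U)) = 0"
            using infdist_nonneg[of "\<iota> g" "\<iota> ` (topspace X - U)"] by linarith
          then have "\<iota> g \<in> closure (\<iota> ` (topspace X - U))"
            using False by (subst in_closure_iff_infdist_zero) auto
          then obtain v where v: "\<And>n. v n \<in> \<iota> ` (topspace X - U)" "v \<longlonglongrightarrow> \<iota> g"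
            unfolding closure_sequential by blast
          then have "\<forall>n. \<exists>f. f \<in> topspace X - U \<and> v n = \<iota> f" by blast
          then obtain F where F: "\<And>n. F n \<in> topspace X - U" "\<And>n. v n = \<iota> (F n)" by metis
          have "limitin X F g sequentially"
            using F v(2) g by (intro emb) (auto simp flip: F(2))
          then have "\<forall>\<^sub>F n in sequentially. F n \<in> U" using U \<open>g \<in> U\<close> by (auto simp: limitin_def)
          then show False using F(1) by (auto simp: eventually_sequentially)
        qed
      next
        assume *: "0 < infdist (\<iota> g) (\<iota> ` (topspace X - U))"
        show "g \<in> U"
        proof (rule ccontr)
          assume "g \<notin> U"
          then have "infdist (\<iota> g) (\<iota> ` (topspace X - U)) = 0" using g by (intro infdist_zero) auto
          with * show False by simp
        qed
      qed
      then have "G -` U \<inter> space Q = {x \<in> space Q. 0 < infdist (\<iota> (G x)) (\<iota> ` (topspace X - U))}"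
        using G(1) by auto
      moreover have "(\<lambda>u. infdist u (\<iota> ` (topspace X - U))) \<in> borel_measurable borel"
        by (intro borel_measurable_continuous_onI continuous_intros)
      then have "(\<lambda>x. infdist (\<iota> (G x)) (\<iota> ` (topspace X - U))) \<in> borel_measurable Q"
        using G(2) by (rule measurable_compose[rotated])
      ultimately show ?thesis by simp
    qed
  qed
  \<comment> \<open>Lipschitz minorants give a lower bound on the limit inferior only. The upper
    bound is the same statement for the negated function.\<close>
  have lower: "\<forall>\<^sub>F n in sequentially. (\<integral>y. h (B y) \<partial>N) - e < (\<integral>x. h (A n x) \<partial>M)"
    if h: "continuous_map X euclideanreal h" and bd: "\<And>g. g \<in> topspace X \<Longrightarrow> \<bar>h g\<bar> \<le> C"
      and "e > 0" for h C and e :: real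
  proof -
    text \<open>\<open>h\<close> factors through \<open>\<iota>\<close>, since points with the same image are limits of each other.\<close>
    have lim_h: "(\<lambda>n. h (F n)) \<longlonglongrightarrow> h f"
      if "range F \<subseteq> topspace X" "f \<in> topspace X" "(\<lambda>n. \<iota> (F n)) \<longlonglongrightarrow> \<iota> f" for F f
      using continuous_map_limit[OF h emb[OF that]] by (simp add: comp_def)
    have fact_h: "h f = h g" if "f \<in> topspace X" "g \<in> topspace X" "\<iota> f = \<iota> g" for f g
      using lim_h[of "\<lambda>_. f" g] that LIMSEQ_const_iff by (auto simp: image_subset_iff)
    let ?S = "\<iota> ` topspace X"
    define k where "k u = h (SOME g. g \<in> topspace X \<and> \<iota> g = u)" for u
    have k: "k (\<iota> g) = h g" if "g \<in> topspace X" for g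
      unfolding k_def using someI[of "\<lambda>f. f \<in> topspace X \<and> \<iota> f = \<iota> g" g] that by (intro fact_h) auto
    have kb: "\<bar>k u\<bar> \<le> C" if "u \<in> ?S" for u using that k bd by auto
    have kc: "continuous_on ?S k"
      unfolding continuous_on_sequentially
    proof safe
      fix v g assume *: "g \<in> topspace X" "\<forall>n. v n \<in> ?S" "v \<longlonglongrightarrow> \<iota> g"
      then have "\<forall>n. \<exists>f. f \<in> topspace X \<and> v n = \<iota> f" by blast
      then obtain F where F: "\<And>n. F n \<in> topspace X" "\<And>n. v n = \<iota> (F n)" by metis
      have "(\<lambda>n. h (F n)) \<longlonglongrightarrow> h g"
        using F *(1,3) by (intro lim_h) (auto simp flip: F(2))
      then show "(k \<circ> v) \<longlonglongrightarrow> k (\<iota> g)" using F * by (simp add: comp_def k)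
    qed
    obtain x0 where "x0 \<in> space M" using M.not_empty by blast
    then have ne: "?S \<noteq> {}" using A(1) by blast
    define H where "H j u = (INF y\<in>?S. min C (k y + real j * dist u y))" for j :: nat and u
    have H: "\<bar>H j u\<bar> \<le> C" "\<bar>H j u - H j v\<bar> \<le> real j * dist u v" "u \<in> ?S \<Longrightarrow> H j u \<le> k u" for j u v
      unfolding H_def using Lipschitz_envelope[where S = ?S and h = k and C = C and L = "real j"] ne kb by auto
    have Hm [measurable]: "H j \<in> borel_measurable borel" for j
    proof (intro borel_measurable_continuous_onI)
      have "(real j)-lipschitz_on UNIV (H j)"
        by (rule lipschitz_onI) (use H(2) in \<open>auto simp: dist_real_def\<close>)
      then show "continuous_on UNIV (H j)" by (rule lipschitz_on_continuous_on)
    qed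
    note [measurable] = A(2) B(2)
    have hA: "(\<lambda>x. h (A n x)) \<in> borel_measurable M" for n
    proof (rule borel_measurable_LIMSEQ_real)
      fix x assume x: "x \<in> space M"
      show "(\<lambda>j. H j (\<iota> (A n x))) \<longlonglongrightarrow> h (A n x)"
        unfolding H_def using Lipschitz_envelope_tendsto[of ?S k C "\<iota> (A n x)"] kb kc A(1)[OF x] k by auto
    qed measurable
    have hB: "(\<lambda>j. H j (\<iota> (B y))) \<longlonglongrightarrow> h (B y)" if y: "y \<in> space N" for y
      unfolding H_def using Lipschitz_envelope_tendsto[of ?S k C "\<iota> (B y)"] kb kc B(1)[OF y] k by auto
    have hBm: "(\<lambda>y. h (B y)) \<in> borel_measurable N"
      by (rule borel_measurable_LIMSEQ_real[OF hB]) measurable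
    have "(\<lambda>j. \<integral>y. H j (\<iota> (B y)) \<partial>N) \<longlonglongrightarrow> (\<integral>y. h (B y) \<partial>N)"
      by (rule integral_dominated_convergence[where w = "\<lambda>_. C"]) (use hB hBm H(1) in auto)
    then have "\<forall>\<^sub>F j in sequentially. (\<integral>y. h (B y) \<partial>N) - e < (\<integral>y. H j (\<iota> (B y)) \<partial>N)"
      using \<open>e > 0\<close> by (intro order_tendstoD) auto
    then obtain j where j: "(\<integral>y. h (B y) \<partial>N) - e < (\<integral>y. H j (\<iota> (B y)) \<partial>N)"
      by (auto simp: eventually_sequentially)
    have "(\<lambda>n. \<integral>x. H j (\<iota> (A n x)) \<partial>M) \<longlonglongrightarrow> (\<integral>y. H j (\<iota> (B y)) \<partial>N)"
      using H by (intro lim) blast+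
    then have "\<forall>\<^sub>F n in sequentially. (\<integral>y. h (B y) \<partial>N) - e < (\<integral>x. H j (\<iota> (A n x)) \<partial>M)"
      using j by (rule order_tendstoD)
    then show ?thesis
    proof eventually_elim
      case (elim n)
      have "(\<integral>x. H j (\<iota> (A n x)) \<partial>M) \<le> (\<integral>x. h (A n x) \<partial>M)"
      proof (rule integral_mono)
        show "integrable M (\<lambda>x. H j (\<iota> (A n x)))"
          by (rule M.integrable_const_bound[of _ C]) (use H(1) in auto)
        show "integrable M (\<lambda>x. h (A n x))"
          by (rule M.integrable_const_bound[of _ C]) (use hA bd A(1) in auto)
        show "H j (\<iota> (A n x)) \<le> h (A n x)" if "x \<in> space M" for x
          using H(3)[of "\<iota> (A n x)" j] A(1)[OF that] k by auto
      qed
      with elim show ?case by linarith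
    qed
  qed
  show ?thesis
    unfolding converges_in_distribution_def
  proof (intro conjI allI impI)
    show "A n \<in> measurable M (borel_sets_of X)" for n using A by (intro meas)
    show "B \<in> measurable N (borel_sets_of X)" using B by (intro meas)
    fix h assume h: "continuous_map X euclideanreal h" "bounded (h ` topspace X)"
    then obtain C where C: "\<And>g. g \<in> topspace X \<Longrightarrow> \<bar>h g\<bar> \<le> C" unfolding bounded_iff by auto
    have h': "continuous_map X euclideanreal (\<lambda>g. - h g)" using h(1) by (rule continuous_map_minus)
    have C': "\<And>g. g \<in> topspace X \<Longrightarrow> \<bar>- h g\<bar> \<le> C" using C by simp
    show "(\<lambda>n. \<integral>x. h (A n x) \<partial>M) \<longlonglongrightarrow> (\<integral>y. h (B y) \<partial>N)"
    proof (rule tendstoI)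
      fix e :: real assume "e > 0"
      have "\<forall>\<^sub>F n in sequentially. (\<integral>y. h (B y) \<partial>N) - e < (\<integral>x. h (A n x) \<partial>M)"
        by (rule lower[OF h(1) _ \<open>e > 0\<close>]) (rule C)
      moreover have "\<forall>\<^sub>F n in sequentially. (\<integral>y. - h (B y) \<partial>N) - e < (\<integral>x. - h (A n x) \<partial>M)"
        by (rule lower[OF h' _ \<open>e > 0\<close>]) (rule C')
      ultimately show "\<forall>\<^sub>F n in sequentially. dist (\<integral>x. h (A n x) \<partial>M) (\<integral>y. h (B y) \<partial>N) < e"
        by eventually_elim (simp add: dist_real_def abs_less_iff)
    qed
  qed
qed

section \<open>Sequences of i.i.d. variables and increments of the Levy process\<close>

lemma distr_PiM_UNIV_compose:
  fixes Y :: "'b \<Rightarrow> real"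
  assumes \<Omega>: "prob_space \<Omega>" and [measurable]: "Y \<in> borel_measurable \<Omega>"
  shows "distr (Pi\<^sub>M UNIV (\<lambda>_::nat. \<Omega>)) (Pi\<^sub>M UNIV (\<lambda>_. borel)) (\<lambda>w k. Y (w k)) =
    Pi\<^sub>M UNIV (\<lambda>_::nat. distr \<Omega> borel Y)"
proof -
  let ?P = "Pi\<^sub>M UNIV (\<lambda>_::nat. \<Omega>)"
  interpret P: prob_space ?P by (intro prob_space_PiM \<Omega>)
  have comp: "distr ?P \<Omega> (\<lambda>w. w k) = \<Omega>" for k
    by (rule distr_PiM_component) (use \<Omega> in auto)
  have "P.indep_vars (\<lambda>_. \<Omega>) (\<lambda>k w. w k) UNIV"
    by (subst P.indep_vars_iff_distr_eq_PiM) (auto simp: comp restrict_UNIV distr_id2)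
  then have "P.indep_vars (\<lambda>_. borel) (\<lambda>k w. Y (w k)) UNIV"
    by (rule P.indep_vars_compose2) simp
  then have "distr ?P (Pi\<^sub>M UNIV (\<lambda>_. borel)) (\<lambda>w. \<lambda>k\<in>UNIV. Y (w k)) =
    Pi\<^sub>M UNIV (\<lambda>k. distr ?P borel (\<lambda>w. Y (w k)))"
    by (subst (asm) P.indep_vars_iff_distr_eq_PiM) auto
  moreover have "distr ?P borel (\<lambda>w. Y (w k)) = distr \<Omega> borel Y" for k
    using distr_distr[of Y \<Omega> borel "\<lambda>w. w k" ?P] by (simp add: comp comp_def)
  ultimately show ?thesis by (simp add: restrict_UNIV)
qed

lemma (in prob_space) expectation_iid_sequence:
  fixes X :: "nat \<Rightarrow> 'a \<Rightarrow> real" and \<Psi> :: "(nat \<Rightarrow> real) \<Rightarrow> real"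
  assumes ind: "indep_vars (\<lambda>_. borel) X UNIV" and law: "\<And>k. distr M borel (X k) = \<nu>"
    and \<Psi>: "\<Psi> \<in> borel_measurable borel"
  shows "expectation (\<lambda>x. \<Psi> (\<lambda>k. X k x)) = (\<integral>w. \<Psi> w \<partial>Pi\<^sub>M UNIV (\<lambda>_. \<nu>))"
proof -
  have X [measurable]: "X k \<in> borel_measurable M" for k using ind by (auto simp: indep_vars_def)
  have "distr M (Pi\<^sub>M UNIV (\<lambda>_. borel)) (\<lambda>x k. X k x) = Pi\<^sub>M UNIV (\<lambda>_. \<nu>)"
    using ind by (subst (asm) indep_vars_iff_distr_eq_PiM) (auto simp: law restrict_UNIV)
  moreover have "\<Psi> \<in> borel_measurable (Pi\<^sub>M UNIV (\<lambda>_. borel))"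
    using \<Psi> measurable_cong_sets[OF sets_PiM_equal_borel refl] by blast
  moreover have "(\<lambda>x k. X k x) \<in> measurable M (Pi\<^sub>M UNIV (\<lambda>_. borel))"
    by (rule measurable_PiM_single') auto
  ultimately show ?thesis by (metis integral_distr)
qed

text \<open>Skorohod's representation is applied to each coordinate separately.\<close>

lemma weak_conv_iid_sequences:
  fixes \<Psi> :: "nat \<Rightarrow> (nat \<Rightarrow> real) \<Rightarrow> real"
  assumes \<nu>: "\<And>n. real_distribution (\<nu> n)" "real_distribution \<nu>'" "weak_conv_m \<nu> \<nu>'"
    and \<Psi>: "\<And>n. \<Psi> n \<in> borel_measurable borel" "\<Psi>' \<in> borel_measurable borel" "\<And>n x. \<bar>\<Psi> n x\<bar> \<le> C"
    and lim: "\<And>x x'. (\<And>k. (\<lambda>n. x n k) \<longlonglongrightarrow> x' k) \<Longrightarrow> (\<lambda>n. \<Psi> n (x n)) \<longlonglongrightarrow> \<Psi>' x'"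
  shows "(\<lambda>n. \<integral>w. \<Psi> n w \<partial>Pi\<^sub>M UNIV (\<lambda>_. \<nu> n)) \<longlonglongrightarrow> (\<integral>w. \<Psi>' w \<partial>Pi\<^sub>M UNIV (\<lambda>_. \<nu>'))"
proof -
  obtain \<Omega> :: "real measure" and Ys :: "nat \<Rightarrow> real \<Rightarrow> real" and Y where \<Omega>: "prob_space \<Omega>"
    and Ys [measurable]: "\<And>n. Ys n \<in> borel_measurable \<Omega>" and law: "\<And>n. distr \<Omega> borel (Ys n) = \<nu> n"
    and Y: "Y \<in> measurable \<Omega> lborel" "distr \<Omega> borel Y = \<nu>'"
    and conv: "\<And>x. x \<in> space \<Omega> \<Longrightarrow> (\<lambda>n. Ys n x) \<longlonglongrightarrow> Y x"
    using Skorohod[OF \<nu>] by blast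
  have Ym [measurable]: "Y \<in> borel_measurable \<Omega>" using Y(1) by simp
  let ?P = "Pi\<^sub>M UNIV (\<lambda>_::nat. \<Omega>)"
  interpret P: prob_space ?P by (intro prob_space_PiM \<Omega>)
  have \<Psi>m: "\<Psi> n \<in> borel_measurable (Pi\<^sub>M UNIV (\<lambda>_. borel))" "\<Psi>' \<in> borel_measurable (Pi\<^sub>M UNIV (\<lambda>_. borel))" for n
    using \<Psi> measurable_cong_sets[OF sets_PiM_equal_borel refl] by blast+
  have m: "(\<lambda>w k. V (w k)) \<in> measurable ?P (Pi\<^sub>M UNIV (\<lambda>_. borel))"
    if [measurable]: "V \<in> borel_measurable \<Omega>" for V :: "real \<Rightarrow> real"
    by (rule measurable_PiM_single') auto
  have eq: "(\<integral>w. F w \<partial>Pi\<^sub>M UNIV (\<lambda>_::nat. distr \<Omega> borel V)) = (\<integral>w. F (\<lambda>k. V (w k)) \<partial>?P)"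
    if [measurable]: "V \<in> borel_measurable \<Omega>" and "F \<in> borel_measurable (Pi\<^sub>M UNIV (\<lambda>_. borel))"
    for V :: "real \<Rightarrow> real" and F :: "(nat \<Rightarrow> real) \<Rightarrow> real"
    by (subst distr_PiM_UNIV_compose[OF \<Omega> that(1), symmetric], subst integral_distr[OF m that(2)])
       (use that in auto)
  \<comment> \<open>The representation converges at every point of \<open>\<Omega>\<close>, hence in
    all coordinates simultaneously on the product space.\<close>
  have "(\<lambda>n. \<integral>w. \<Psi> n (\<lambda>k. Ys n (w k)) \<partial>?P) \<longlonglongrightarrow> (\<integral>w. \<Psi>' (\<lambda>k. Y (w k)) \<partial>?P)"
  proof (rule integral_dominated_convergence[where w = "\<lambda>_. C"])
    show "AE w in ?P. (\<lambda>n. \<Psi> n (\<lambda>k. Ys n (w k))) \<longlonglongrightarrow> \<Psi>' (\<lambda>k. Y (w k))"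
      by (rule AE_I2, rule lim, rule conv) (auto simp: space_PiM)
  qed (use \<Psi>(3) measurable_compose[OF m \<Psi>m(1)] measurable_compose[OF m \<Psi>m(2)] in auto)
  then show ?thesis
    using eq[OF Ys \<Psi>m(1)] eq[OF Ym \<Psi>m(2)] by (simp add: law Y(2))
qed

section \<open>Marginals of the limit process through characteristic functions\<close>

lemma continuous_roots_unique:
  fixes f g :: "real \<Rightarrow> complex"
  assumes "continuous_on UNIV f" "continuous_on UNIV g" "m > 0"
    and eq: "\<And>t. f t ^ m = g t ^ m" and nz: "\<And>t. g t \<noteq> 0" and "f 0 = g 0"
  shows "f = g"
proof -
  \<comment> \<open>The quotient maps the connected line continuously into the finite set of roots
    of unity, so it is constant, and at 0 it is 1.\<close>
  have r: "f t / g t \<in> {z. z ^ m = 1}" for t using eq nz by (simp add: power_divide)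
  have cont: "continuous_on UNIV (\<lambda>t. f t / g t)" using assms(1,2) nz by (intro continuous_intros) auto
  have fin: "finite ((\<lambda>t. f t / g t) ` UNIV)"
    by (rule finite_subset[OF _ finite_roots_unity[where n = m]]) (use r \<open>m > 0\<close> in auto)
  have "connected ((\<lambda>t. f t / g t) ` UNIV)"
    by (intro connected_continuous_image cont connected_UNIV)
  then have "\<exists>x. (\<lambda>t. f t / g t) ` UNIV = {x}" using fin connected_finite_iff_sing by blast
  then have "f t / g t = f 0 / g 0" for t by (metis UNIV_I image_eqI singletonD)
  then have "f t = g t" for t using nz[of t] nz[of 0] \<open>f 0 = g 0\<close> by (metis divide_self_if divide_eq_1_iff)
  then show ?thesis by blast
qed

lemma (in prob_space) char_iid_sum:
  fixes X :: "'i \<Rightarrow> 'a \<Rightarrow> real"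
  assumes "indep_vars (\<lambda>_. borel) X A" "\<And>i. i \<in> A \<Longrightarrow> distr M borel (X i) = \<nu>"
  shows "char (distr M borel (\<lambda>x. (\<Sum>i\<in>A. X i x) * c)) t = char \<nu> (t * c) ^ card A"
proof (cases "A = {}")
  case True
  then show ?thesis by (simp add: char_def integral_distr prob_space del: distr_const)
next
  case False
  have X [measurable]: "i \<in> A \<Longrightarrow> X i \<in> borel_measurable M" for i using assms(1) by (auto simp: indep_vars_def)
  have ind: "indep_vars (\<lambda>_. borel) (\<lambda>i x. X i x * c) A"
    by (rule indep_vars_compose2[OF assms(1)]) simp
  have "char (distr M borel (\<lambda>x. X i x * c)) t = char \<nu> (t * c)" if "i \<in> A" for i
    using that by (simp add: assms(2)[OF that, symmetric] char_def integral_distr mult_ac)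
  then show ?thesis
    by (simp add: sum_distrib_right char_distr_sum[OF ind])
qed

text \<open>Strict stability is read off the limit theorem itself, by comparing the normalized sums
  of \<open>n\<close> and of \<open>m * n\<close> variables. No computation with the parameters of
  \<open>stable_exponent\<close> is involved, in particular none with its shift.\<close>

lemma stable_char_root:
  assumes M: "prob_space M"
    and ind: "prob_space.indep_vars M (\<lambda>_. borel) X {1..}"
    and law: "\<And>i. i \<ge> 1 \<Longrightarrow> distr M borel (X i) = \<nu>"
    and att: "normally_attracted M X a 0 \<nu>'" and \<nu>': "real_distribution \<nu>'" and "m > 0"
  shows "char \<nu>' (t * real m powr (- 1 / a)) ^ m = char \<nu>' t"
proof -
  interpret prob_space M by fact
  have X [measurable]: "i \<ge> 1 \<Longrightarrow> X i \<in> borel_measurable M" for i using ind by (auto simp: indep_vars_def)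
  define D where "D n = distr M borel (\<lambda>x. (\<Sum>i=1..n. X i x) * real n powr (- 1 / a))" for n
  have D: "D n = distr M borel (\<lambda>x. (\<Sum>i=1..n. (X i x - 0)) / real n powr (1 / a))" for n
    unfolding D_def by (simp add: powr_minus divide_inverse)
  have rd: "real_distribution (D n)" for n
    unfolding D_def by (intro real_distribution_distr) (auto intro!: borel_measurable_sum borel_measurable_times)
  have "weak_conv_m D \<nu>'" using att unfolding normally_attracted_def D by simp
  then have lim: "(\<lambda>n. char (D n) t) \<longlonglongrightarrow> char \<nu>' t" for t
    by (rule levy_continuity1[OF rd \<nu>'])
  have cD: "char (D n) t = char \<nu> (t * real n powr (- 1 / a)) ^ n" for n t
    unfolding D_def using char_iid_sum[of X "{1..n}" \<nu> "real n powr (- 1 / a)" t]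
      indep_vars_subset[OF ind, of "{1..n}"] law by auto
  have "char (D (m * n)) t = char (D n) (t * real m powr (- 1 / a)) ^ m" for n
    unfolding cD by (simp add: powr_mult power_mult[symmetric] mult_ac)
  moreover have "(\<lambda>n. char (D (m * n)) t) \<longlonglongrightarrow> char \<nu>' t"
    using lim[of t] by (rule filterlim_compose) (use \<open>m > 0\<close> in \<open>auto intro!: mult_nat_left_at_top\<close>)
  ultimately have "(\<lambda>n. char (D n) (t * real m powr (- 1 / a)) ^ m) \<longlonglongrightarrow> char \<nu>' t" by simp
  moreover have "(\<lambda>n. char (D n) (t * real m powr (- 1 / a)) ^ m) \<longlonglongrightarrow> char \<nu>' (t * real m powr (- 1 / a)) ^ m"
    by (intro tendsto_intros lim)
  ultimately show ?thesis by (rule LIMSEQ_unique[rotated])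
qed

lemma levy_increments:
  assumes Z: "cadlag_levy_process N Z" and "m > 0"
  defines "X \<equiv> \<lambda>k y. Z (real (Suc k) / m) y - Z (real k / m) y"
  shows "prob_space.indep_vars N (\<lambda>_. borel) X UNIV"
    and "distr N borel (X k) = distr N borel (Z (1 / m))"
proof -
  interpret prob_space N using Z by (simp add: cadlag_levy_process_def)
  have X: "X = (\<lambda>i y. Z ((\<lambda>k. real k / m) (Suc i)) y - Z ((\<lambda>k. real k / m) i) y)"
    by (simp add: X_def)
  have fin: "indep_vars (\<lambda>_. borel) X {..<n}" for n
    using Z \<open>m > 0\<close> unfolding X cadlag_levy_process_def
    by (elim conjE allE[of _ n] allE[of _ "\<lambda>k. real k / m"]) (simp add: divide_strict_right_mono)
  show "indep_vars (\<lambda>_. borel) X UNIV"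
    unfolding indep_vars_def2
  proof
    show "\<forall>i\<in>UNIV. random_variable borel (X i)"
    proof
      fix i show "random_variable borel (X i)" using fin[of "Suc i"] by (auto simp: indep_vars_def)
    qed
    show "indep_sets (\<lambda>i. {X i -` A \<inter> space N |A. A \<in> sets borel}) UNIV"
    \<comment> \<open>Independence of an infinite family is tested on finite subfamilies, and each
      of these sits in an initial segment, which the definition of the process covers.\<close>
    proof (subst indep_sets_finite_index_sets, intro allI impI)
      fix J :: "nat set" assume "finite J"
      then obtain n where "J \<subseteq> {..<n}" using finite_nat_iff_bounded by blast
      then have "indep_vars (\<lambda>_. borel) X J" using fin indep_vars_subset by blast
      then show "indep_sets (\<lambda>i. {X i -` A \<inter> space N |A. A \<in> sets borel}) J"
        by (simp add: indep_vars_def2)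
    qed
  qed
  have "distr N borel (\<lambda>y. Z (real k / m + 1 / m) y - Z (real k / m) y) = distr N borel (Z (1 / m))"
    using Z \<open>m > 0\<close> by (simp add: cadlag_levy_process_def)
  then show "distr N borel (X k) = distr N borel (Z (1 / m))"
    by (simp add: X_def add_divide_distrib add.commute)
qed

lemma levy_char_power:
  assumes Z: "cadlag_levy_process N Z" and "m > 0"
  shows "char (distr N borel (Z (1 / real m))) t ^ m = char (distr N borel (Z 1)) t"
proof -
  interpret prob_space N using Z by (simp add: cadlag_levy_process_def)
  have mZ [measurable]: "t \<ge> 0 \<Longrightarrow> Z t \<in> borel_measurable N" for t using Z by (simp add: cadlag_levy_process_def)
  define X where "X k y = Z (real (Suc k) / m) y - Z (real k / m) y" for k y
  have mr: "real m > 0" using \<open>m > 0\<close> by simp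
  note inc = levy_increments[OF Z mr, folded X_def]
  have X: "X = (\<lambda>k y. Z (real (Suc k) / m) y - Z (real k / m) y)" by (simp add: X_def fun_eq_iff)
  have "(\<Sum>k<m. X k y) = Z 1 y - Z 0 y" for y
    unfolding X_def using sum_lessThan_telescope[of "\<lambda>k. Z (real k / real m) y" m] \<open>m > 0\<close> by simp
  moreover have "AE y in N. Z 0 y = 0" using Z by (simp add: cadlag_levy_process_def)
  ultimately have "distr N borel (\<lambda>y. (\<Sum>k<m. X k y) * 1) = distr N borel (Z 1)"
    by (intro distr_cong_AE) auto
  moreover have "char (distr N borel (\<lambda>y. (\<Sum>k<m. X k y) * 1)) t = char (distr N borel (Z (1 / m))) (t * 1) ^ card {..<m}"
    using inc by (intro char_iid_sum) (auto simp: X intro: indep_vars_subset)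
  ultimately show ?thesis by simp
qed

text \<open>Both characteristic functions are \<open>m\<close>-th roots of that of
  \<open>\<nu>'\<close>: one by independent stationary increments, the other by strict stability.
  Since the latter function is an exponential, it has no zeros, and its continuous root with value 1
  at 0 is unique.\<close>

lemma stable_levy_marginal:
  assumes M: "prob_space M"
    and ind: "prob_space.indep_vars M (\<lambda>_. borel) X {1..}"
    and law: "\<And>i. i \<ge> 1 \<Longrightarrow> distr M borel (X i) = \<nu>"
    and att: "normally_attracted M X a 0 \<nu>'" and \<nu>': "stable_law a' r \<nu>'"
    and Z: "cadlag_levy_process N Z" "distr N borel (Z 1) = \<nu>'" and "m > 0"
  shows "distr N borel (Z (1 / real m)) = distr \<nu>' borel (\<lambda>z. z * real m powr (- 1 / a))"
proof -
  interpret N: prob_space N using Z by (simp add: cadlag_levy_process_def)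
  have mZ [measurable]: "t \<ge> 0 \<Longrightarrow> Z t \<in> borel_measurable N" for t using Z by (simp add: cadlag_levy_process_def)
  interpret \<nu>': real_distribution \<nu>' using \<nu>' by (simp add: stable_law_def)
  let ?c = "real m powr (- 1 / a)"
  let ?D1 = "distr N borel (Z (1 / real m))" and ?D2 = "distr \<nu>' borel (\<lambda>z. z * ?c)"
  interpret D1: real_distribution ?D1 by (intro N.real_distribution_distr) simp
  interpret D2: real_distribution ?D2 by (intro \<nu>'.real_distribution_distr) simp
  have c2: "char ?D2 t = char \<nu>' (t * ?c)" for t
    by (simp add: char_def integral_distr mult_ac)
  have nz: "char \<nu>' t \<noteq> 0" for t using \<nu>' unfolding stable_law_def by auto
  have "char ?D1 = char ?D2"
  proof (rule continuous_roots_unique[OF _ _ \<open>m > 0\<close>])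
    show "char ?D1 t ^ m = char ?D2 t ^ m" for t
      using levy_char_power[OF Z(1) \<open>m > 0\<close>, of t] stable_char_root[OF M ind law att _ \<open>m > 0\<close>, of t]
        \<nu>'.real_distribution_axioms Z(2) c2 by simp
    show "char ?D2 t \<noteq> 0" for t unfolding c2 by (rule nz)
    show "char ?D1 0 = char ?D2 0" unfolding D1.char_zero D2.char_zero ..
    show "continuous_on UNIV (char ?D1)" "continuous_on UNIV (char ?D2)"
      by (intro continuous_at_imp_continuous_on ballI D1.isCont_char D2.isCont_char)+
  qed
  then show ?thesis
    using Levy_uniqueness D1.real_distribution_axioms D2.real_distribution_axioms by blast
qed

section \<open>Tails, truncated means and a uniform weak law\<close>

text \<open>Atoms are countable, so an uncountable interval far to the right contains a continuity
  point.\<close>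

lemma real_distribution_continuity_point:
  assumes "real_distribution \<nu>" "c < 1"
  obtains K where "K > 0" "isCont (cdf \<nu>) K" "cdf \<nu> K > c"
proof -
  interpret real_distribution \<nu> by fact
  have "\<forall>\<^sub>F x in at_top. c < cdf \<nu> x" using cdf_lim_at_top_prob assms(2) by (rule order_tendstoD)
  then obtain b where b: "\<And>x. x \<ge> b \<Longrightarrow> c < cdf \<nu> x" by (auto simp: eventually_at_top_linorder)
  have "uncountable ({max b 1<..<max b 1 + 1} - {x. measure \<nu> {x} > 0})"
    by (intro uncountable_minus_countable countable_atoms) (simp add: uncountable_open_interval)
  then obtain K where K: "K \<in> {max b 1<..<max b 1 + 1} - {x. measure \<nu> {x} > 0}"
    by (metis countable_empty equals0I)
  then have "measure \<nu> {K} = 0" using measure_nonneg[of \<nu> "{K}"] by simp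
  with K b[of K] show ?thesis by (intro that[of K]) (auto simp: isCont_cdf)
qed

text \<open>Nonnegative summands are all at most \<open>v\<close> when their sum is. Independence
  thus bounds the probability that the sum is at most \<open>v\<close> by
  \<open>(1 - p) ^ n \<le> exp (- n * p)\<close>, where \<open>p\<close> is the tail at
  \<open>v\<close>. At \<open>v = K * n powr (1 / a)\<close> convergence keeps this probability
  above 1/2, which forces \<open>n * p < 1\<close>; rounding then gives all levels.\<close>

lemma attracted_tail_bound:
  assumes M: "prob_space M"
    and ind: "prob_space.indep_vars M (\<lambda>_. borel) X {1..}"
    and law: "\<And>i. i \<ge> 1 \<Longrightarrow> distr M borel (X i) = \<nu>"
    and pos: "\<And>i. i \<ge> 1 \<Longrightarrow> AE x in M. 0 \<le> X i x"
    and att: "normally_attracted M X a 0 \<nu>'" and \<nu>': "real_distribution \<nu>'" and a: "a > 0"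
  obtains C where "C > 0" "\<And>u. u > 0 \<Longrightarrow> measure \<nu> {u<..} \<le> C * u powr (- a)"
proof -
  interpret prob_space M by fact
  have X [measurable]: "i \<ge> 1 \<Longrightarrow> X i \<in> borel_measurable M" for i using ind by (auto simp: indep_vars_def)
  interpret \<nu>: real_distribution \<nu> using law[of 1] X[of 1] by (metis order_refl real_distribution_distr)
  obtain K where K: "K > 0" "isCont (cdf \<nu>') K" "cdf \<nu>' K > 1 / 2"
    using real_distribution_continuity_point[OF \<nu>', of "1/2"] by auto
  let ?D = "\<lambda>n. distr M borel (\<lambda>x. (\<Sum>i=1..n. (X i x - 0)) / real n powr (1 / a))"
  have "(\<lambda>n. cdf (?D n) K) \<longlonglongrightarrow> cdf \<nu>' K"
    using att K(2) by (simp add: normally_attracted_def weak_conv_m_def weak_conv_def)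
  then have "\<forall>\<^sub>F n in sequentially. cdf (?D n) K > 1 / 2" using K(3) by (rule order_tendstoD)
  then obtain n1 where n1: "\<And>n. n \<ge> n1 \<Longrightarrow> cdf (?D n) K > 1 / 2" by (auto simp: eventually_sequentially)
  define n0 where "n0 = max n1 1"
  have main: "measure \<nu> {K * real n powr (1 / a)<..} \<le> 1 / real n" if n: "n \<ge> n0" for n
  proof -
    let ?v = "K * real n powr (1 / a)"
    have n': "n \<ge> n1" "n \<ge> 1" using n by (auto simp: n0_def)
    define p where "p = measure \<nu> {?v<..}"
    have q: "measure \<nu> {..?v} = 1 - p"
      using \<nu>.prob_compl[of "{..?v}"] unfolding p_def by (simp add: Compl_eq_Diff_UNIV[symmetric])
    have "cdf (?D n) K = prob {x \<in> space M. (\<Sum>i=1..n. (X i x - 0)) / real n powr (1 / a) \<le> K}"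
      unfolding cdf_def by (subst measure_distr) (auto intro!: arg_cong[where f = prob])
    also have "\<dots> = prob {x \<in> space M. (\<Sum>i=1..n. X i x) \<le> ?v}"
      using n' by (simp add: divide_le_eq)
    also have "\<dots> \<le> prob (\<Inter>i\<in>{1..n}. X i -` {..?v} \<inter> space M)"
    proof (rule finite_measure_mono_AE)
      have "AE x in M. \<forall>i\<in>{1..n}. 0 \<le> X i x" by (intro AE_ball_countable' countable_finite) (use pos in auto)
      then show "AE x in M. x \<in> {x \<in> space M. (\<Sum>i=1..n. X i x) \<le> ?v} \<longrightarrow>
          x \<in> (\<Inter>i\<in>{1..n}. X i -` {..?v} \<inter> space M)"
      proof eventually_elim
        case (elim x)
        then have "X i x \<le> (\<Sum>i=1..n. X i x)" if "i \<in> {1..n}" for i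
          by (intro member_le_sum) (use that in auto)
        then show ?case by fastforce
      qed
      show "(\<Inter>i\<in>{1..n}. X i -` {..?v} \<inter> space M) \<in> events"
        using n' by (intro sets.finite_INT) (auto intro!: measurable_sets)
    qed
    also have "\<dots> = (\<Prod>i\<in>{1..n}. prob (X i -` {..?v} \<inter> space M))"
      using n' by (intro indep_varsD[OF ind]) auto
    also have "\<dots> = (\<Prod>i\<in>{1..n}. measure \<nu> {..?v})"
      by (intro prod.cong refl) (subst law[symmetric], auto simp: measure_distr)
    also have "\<dots> = (1 - p) ^ n" by (simp add: q)
    also have "\<dots> \<le> exp (- p) ^ n"
      using \<nu>.prob_le_1[of "{?v<..}"] exp_ge_add_one_self[of "- p"] by (intro power_mono) (auto simp: p_def)
    also have "\<dots> = exp (- (real n * p))" by (simp add: exp_of_nat_mult[symmetric])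
    finally have "1 / 2 < exp (- (real n * p))" using n1[OF n'(1)] by linarith
    moreover have "exp (- 1) \<le> (1 / 2 :: real)"
      using exp_ge_add_one_self[of "1::real"] by (simp add: exp_minus field_simps)
    ultimately have "real n * p < 1"
      by (metis exp_less_cancel_iff less_le_not_le linorder_not_le neg_less_iff_less order_le_less_trans)
    then show ?thesis using n' by (simp add: p_def field_simps)
  qed
  define u0 where "u0 = K * real n0 powr (1 / a)"
  have u0: "u0 > 0" using K(1) by (simp add: u0_def n0_def)
  show ?thesis
  \<comment> \<open>The first summand serves \<open>u \<ge> u0\<close>, its factor 2 paying for the
    rounding; the second serves \<open>u < u0\<close>, where a probability of at most 1 is all that
    is used.\<close>
  proof (rule that[of "2 * K powr a + u0 powr a"])
    show "2 * K powr a + u0 powr a > 0" using K(1) by (simp add: add_pos_nonneg)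
    fix u :: real assume u: "u > 0"
    show "measure \<nu> {u<..} \<le> (2 * K powr a + u0 powr a) * u powr (- a)"
    proof (cases "u \<ge> u0")
      case True
      \<comment> \<open>The real solution of \<open>K * y powr (1 / a) = u\<close>. Its floor is at
        least half of it because \<open>y \<ge> 1\<close>.\<close>
      define y where "y = (u / K) powr a"
      define n where "n = nat \<lfloor>y\<rfloor>"
      have "real n0 = (real n0 powr (1 / a)) powr a" using a by (simp add: powr_powr n0_def)
      also have "\<dots> \<le> y"
        unfolding y_def using True K(1) a by (intro powr_mono2) (auto simp: u0_def field_simps)
      finally have ny: "real n0 \<le> y" .
      then have n: "n \<ge> n0" unfolding n_def by (simp add: le_nat_floor)
      have y1: "y \<ge> 1" using ny by (simp add: n0_def)
      have "real n = of_int \<lfloor>y\<rfloor>" using y1 by (simp add: n_def)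
      moreover have "of_int \<lfloor>y\<rfloor> \<ge> (1::real)" using y1 by simp
      ultimately have n2: "real n \<le> y" "y \<le> 2 * real n" by linarith+
      have "real n powr (1 / a) \<le> y powr (1 / a)" using n2 a by (intro powr_mono2) auto
      also have "\<dots> = u / K" using a u K(1) by (simp add: y_def powr_powr)
      finally have "K * real n powr (1 / a) \<le> u" using K(1) by (simp add: field_simps)
      then have "measure \<nu> {u<..} \<le> measure \<nu> {K * real n powr (1 / a)<..}"
        by (intro \<nu>.finite_measure_mono) auto
      also have "\<dots> \<le> 1 / real n" by (rule main[OF n])
      also have "\<dots> \<le> 2 / y" using n2 y1 by (simp add: field_simps)
      also have "\<dots> = 2 * K powr a * u powr (- a)"
        using u K(1) by (simp add: y_def powr_divide powr_minus field_simps)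
      also have "\<dots> \<le> (2 * K powr a + u0 powr a) * u powr (- a)" by (simp add: distrib_right)
      finally show ?thesis .
    next
      case False
      have "measure \<nu> {u<..} \<le> u powr a * u powr (- a)" using u by (simp add: powr_minus)
      also have "\<dots> \<le> u0 powr a * u powr (- a)" using u a False by (intro mult_right_mono powr_mono2) auto
      also have "\<dots> \<le> (2 * K powr a + u0 powr a) * u powr (- a)" by (simp add: distrib_right)
      finally show ?thesis .
    qed
  qed
qed

text \<open>Halving the truncation level costs at most \<open>v\<close> times the tail at
  \<open>v / 2\<close>, a multiple of \<open>v powr (1 - a)\<close>. Iterated, these costs form a
  geometric series of ratio \<open>2 powr (a - 1)\<close>, which is below 1 precisely for
  \<open>a < 1\<close>; this is the source of the negligibility of the small gaps.\<close>

lemma truncated_mean_bound: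
  assumes \<nu>: "real_distribution \<nu>" and "a < 1" "C > 0"
    and tail: "\<And>u. u > 0 \<Longrightarrow> measure \<nu> {u<..} \<le> C * u powr (- a)"
  obtains B where "B > 0" "\<And>v. v > 0 \<Longrightarrow> (\<integral>y. indicator {0<..v} y * y \<partial>\<nu>) \<le> B * v powr (1 - a)"
proof -
  interpret real_distribution \<nu> by fact
  define m where "m v = (\<integral>y. indicator {0<..v} y * y \<partial>\<nu>)" for v :: real
  have int: "integrable \<nu> (\<lambda>y. indicator {0<..v} y * y)" if "v > 0" for v
    by (rule integrable_const_bound[of _ v]) (use that in \<open>auto simp: indicator_def\<close>)
  define A where "A = C * 2 powr a"
  have half: "m v \<le> m (v / 2) + A * v powr (1 - a)" if v: "v > 0" for v
  proof -
    have int2: "integrable \<nu> (\<lambda>y. v * indicator {v / 2<..} y)"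
      by (intro integrable_mult_right integrable_real_indicator) (auto simp: emeasure_eq_measure)
    have int1: "integrable \<nu> (\<lambda>y. indicator {0<..v / 2} y * y)" using v by (intro int) simp
    have "m v \<le> (\<integral>y. indicator {0<..v / 2} y * y + v * indicator {v / 2<..} y \<partial>\<nu>)"
      unfolding m_def
      by (rule integral_mono[OF int[OF v] Bochner_Integration.integrable_add[OF int1 int2]])
         (use v in \<open>auto simp: indicator_def\<close>)
    also have "\<dots> = m (v / 2) + v * measure \<nu> {v / 2<..}"
      unfolding m_def Bochner_Integration.integral_add[OF int1 int2] by simp
    also have "v * measure \<nu> {v / 2<..} \<le> v * (C * (v / 2) powr (- a))"
      using v by (intro mult_left_mono tail) auto
    also have "v * (C * (v / 2) powr (- a)) = A * v powr (1 - a)"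
      using v by (simp add: A_def powr_diff powr_minus powr_divide field_simps)
    finally show ?thesis by simp
  qed
  define r where "r = (2::real) powr (a - 1)"
  have r: "0 < r" "r < 1" using \<open>a < 1\<close> by (auto simp: r_def powr_less_one)
  define B where "B = A / (1 - r)"
  have A: "A > 0" using \<open>C > 0\<close> by (simp add: A_def)
  have B: "B > 0" "A + B * r = B" using r A by (auto simp: B_def field_simps)
  have it: "m v \<le> m (v / 2 ^ j) + B * v powr (1 - a)" if "v > 0" for v j
    using that
  proof (induction j arbitrary: v)
    case 0 then show ?case using B by simp
  next
    case (Suc j)
    have "m v \<le> m (v / 2) + A * v powr (1 - a)" by (rule half[OF Suc.prems])
    also have "m (v / 2) \<le> m (v / 2 / 2 ^ j) + B * (v / 2) powr (1 - a)"
      using Suc.prems by (intro Suc.IH) simp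
    also have "(v / 2) powr (1 - a) = r * v powr (1 - a)"
      using Suc.prems by (simp add: r_def powr_divide powr_diff field_simps)
    finally have "m v \<le> m (v / 2 / 2 ^ j) + (A + B * r) * v powr (1 - a)"
      by (simp add: algebra_simps)
    then show ?case using B(2) by simp
  qed
  have small: "m v \<le> v" if "v > 0" for v
  proof -
    have "m v \<le> (\<integral>y. v \<partial>\<nu>)" unfolding m_def
      using that by (intro integral_mono int) (auto simp: indicator_def)
    then show ?thesis using prob_space by simp
  qed
  have "m v \<le> B * v powr (1 - a)" if v: "v > 0" for v
  proof (rule LIMSEQ_le_const)
    have "(\<lambda>j. v * (1 / 2) ^ j) \<longlonglongrightarrow> v * 0" by (intro tendsto_intros LIMSEQ_power_zero) simp
    then have "(\<lambda>j. v / 2 ^ j) \<longlonglongrightarrow> 0" by (simp add: power_divide)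
    from tendsto_add[OF this tendsto_const]
    show "(\<lambda>j. v / 2 ^ j + B * v powr (1 - a)) \<longlonglongrightarrow> B * v powr (1 - a)" by simp
    show "\<exists>N. \<forall>j\<ge>N. m v \<le> v / 2 ^ j + B * v powr (1 - a)"
    proof (intro exI allI impI)
      fix j
      have "m (v / 2 ^ j) \<le> v / 2 ^ j" using v by (intro small) simp
      then show "m v \<le> v / 2 ^ j + B * v powr (1 - a)" using it[OF v, of j] by linarith
    qed
  qed
  then show ?thesis using that[OF B(1)] by (simp add: m_def)
qed

text \<open>A first moment suffices, even uniformly in \<open>j\<close>. For the truncated variables
  Hoeffding's bound is exponentially small for each \<open>j\<close> and beats the union over about
  \<open>T * n\<close> values. The truncation errors, summed in absolute value, increase with
  \<open>j\<close>, so one application of Markov's inequality to the longest sum covers them all.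
  The third share of \<open>\<eta>\<close> is the shift of the mean.\<close>

lemma uniform_weak_law:
  assumes M: "prob_space M"
    and ind: "prob_space.indep_vars M (\<lambda>_. borel) X {1..}"
    and law: "\<And>i. i \<ge> 1 \<Longrightarrow> distr M borel (X i) = \<nu>"
    and int: "integrable \<nu> (\<lambda>y. y)" and \<mu>: "\<mu> = (\<integral>y. y \<partial>\<nu>)" and T: "T > 0" and \<eta>: "\<eta> > 0"
  shows "(\<lambda>n. measure M {x \<in> space M. \<exists>j. real j \<le> T * real n \<and> \<bar>(\<Sum>i=1..j. X i x) - \<mu> * real j\<bar> > \<eta> * real n})
    \<longlonglongrightarrow> 0"
proof -
  interpret prob_space M by fact
  have X [measurable]: "i \<ge> 1 \<Longrightarrow> X i \<in> borel_measurable M" for i using ind by (auto simp: indep_vars_def)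
  interpret \<nu>: real_distribution \<nu> using law[of 1] X[of 1] by (metis order_refl real_distribution_distr)
  let ?bad = "\<lambda>n. {x \<in> space M. \<exists>j. real j \<le> T * real n \<and> \<bar>(\<Sum>i=1..j. X i x) - \<mu> * real j\<bar> > \<eta> * real n}"
  define f where "f K y = indicator {-K..K} y * (y::real)" for K y
  have f [measurable]: "f K \<in> borel_measurable borel" for K unfolding f_def by simp
  have fb: "\<bar>f K y\<bar> \<le> \<bar>y\<bar>" "K \<ge> 0 \<Longrightarrow> f K y \<in> {-K..K}" for K y by (auto simp: f_def indicator_def)
  have E: "expectation (\<lambda>x. g (X i x)) = (\<integral>y. g y \<partial>\<nu>)" "integrable M (\<lambda>x. g (X i x)) \<longleftrightarrow> integrable \<nu> g"
    if "g \<in> borel_measurable borel" "i \<ge> 1" for g :: "real \<Rightarrow> real" and i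
    using that by (auto simp: law[OF that(2), symmetric] integral_distr integrable_distr_eq)
  have intf: "integrable \<nu> (f K)" for K
    by (rule Bochner_Integration.integrable_bound[OF int]) (use fb in auto)
  have intr: "integrable \<nu> (\<lambda>y. \<bar>y - f K y\<bar>)" for K
    using int intf by (intro integrable_abs Bochner_Integration.integrable_diff)
  define \<kappa> where "\<kappa> K = (\<integral>y. \<bar>y - f K y\<bar> \<partial>\<nu>)" for K
  have "(\<lambda>k. \<kappa> (real k)) \<longlonglongrightarrow> (\<integral>y. 0 \<partial>\<nu>)"
    unfolding \<kappa>_def
  proof (rule integral_dominated_convergence[where w = "\<lambda>y. \<bar>y\<bar>"])
    show "AE y in \<nu>. (\<lambda>k. \<bar>y - f (real k) y\<bar>) \<longlonglongrightarrow> 0"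
    proof (rule AE_I2, rule tendsto_eventually)
      fix y :: real
      have "\<forall>\<^sub>F k in sequentially. real k \<ge> \<bar>y\<bar>"
        using filterlim_real_sequentially by (simp add: filterlim_at_top)
      then show "\<forall>\<^sub>F k in sequentially. \<bar>y - f (real k) y\<bar> = 0"
        by eventually_elim (auto simp: f_def indicator_def)
    qed
    show "integrable \<nu> (\<lambda>y. \<bar>y\<bar>)" using int by (rule integrable_abs)
  qed (auto simp: f_def indicator_def)
  then have \<kappa>0: "(\<lambda>k. \<kappa> (real k)) \<longlonglongrightarrow> 0" by simp
  show ?thesis
  proof (rule tendstoI)
    fix e :: real assume e: "e > 0"
    have "\<forall>\<^sub>F k in sequentially. \<kappa> (real k) < min (\<eta> / (3 * T)) (e * \<eta> / (6 * T))"
      using \<kappa>0 by (rule order_tendstoD) (use e T \<eta> in auto)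
    then obtain k0 where k0: "\<And>k. k \<ge> k0 \<Longrightarrow> \<kappa> (real k) < min (\<eta> / (3 * T)) (e * \<eta> / (6 * T))"
      by (auto simp: eventually_sequentially)
    \<comment> \<open>The first bound on \<open>\<kappa> K\<close> keeps the shift of the mean over
      \<open>T * n\<close> steps within \<open>\<eta> / 3 * n\<close>; the second makes the Markov
      bound at most \<open>e / 2\<close>.\<close>
    define K where "K = real (max k0 1)"
    have K: "K > 0" "\<kappa> K < \<eta> / (3 * T)" "\<kappa> K < e * \<eta> / (6 * T)"
      using k0[of "max k0 1"] by (auto simp: K_def)
    define \<mu>' where "\<mu>' = (\<integral>y. f K y \<partial>\<nu>)"
    have "\<bar>\<mu> - \<mu>'\<bar> \<le> \<kappa> K"
    proof -
      have "\<mu> - \<mu>' = (\<integral>y. y - f K y \<partial>\<nu>)" unfolding \<mu> \<mu>'_def using int intf by simp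
      then show ?thesis unfolding \<kappa>_def by (simp add: integral_abs_bound)
    qed
    then have \<mu>\<mu>: "\<bar>\<mu> - \<mu>'\<bar> \<le> \<eta> / (3 * T)" using K by linarith
    \<comment> \<open>\<open>c * n\<close> is Hoeffding's exponent for deviation
      \<open>\<eta> / 3 * n\<close>, range \<open>2 * K\<close> and the largest admissible number
      \<open>T * n\<close> of summands.\<close>
    define c where "c = 2 * (\<eta> / 3)\<^sup>2 / (T * (2 * K)\<^sup>2)"
    have c: "c > 0" using T K \<eta> by (simp add: c_def)
    have pj: "prob {x \<in> space M. \<bar>(\<Sum>i=1..j. f K (X i x)) - \<mu>' * real j\<bar> \<ge> \<eta> / 3 * real n} \<le> 2 * exp (- c) ^ n" (is "?lhs \<le> _")
      if j: "real j \<le> T * real n" "j \<ge> 1" and n: "n \<ge> 1" for j n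
    proof -
      interpret H: Hoeffding_ineq M "{1..j}" "\<lambda>i x. f K (X i x)" "\<lambda>_. - K" "\<lambda>_. K"
        "\<Sum>i\<in>{1..j}. expectation (\<lambda>x. f K (X i x))"
      proof unfold_locales
        show "indep_vars (\<lambda>_. borel) (\<lambda>i x. f K (X i x)) {1..j}"
          by (rule indep_vars_compose2[OF indep_vars_subset[OF ind]]) auto
        show "AE x in M. f K (X i x) \<in> {- K..K}" for i
          by (rule AE_I2, rule fb(2)) (use K(1) in simp)
      qed simp
      have s: "(\<Sum>i\<in>{1..j}. expectation (\<lambda>x. f K (X i x))) = \<mu>' * real j"
        by (simp add: E(1) \<mu>'_def)
      have s2: "(\<Sum>i\<in>{1..j}. (K - - K)\<^sup>2) = real j * (2 * K)\<^sup>2"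
      proof -
        have "K - - K = 2 * K" by simp
        then show ?thesis by (simp only: sum_constant card_atLeastAtMost) simp
      qed
      have "?lhs \<le> 2 * exp (- 2 * (\<eta> / 3 * real n)\<^sup>2 / (real j * (2 * K)\<^sup>2))"
        using H.Hoeffding_ineq_abs_ge[of "\<eta> / 3 * real n"] \<eta> K j unfolding s s2 by simp
      also have "\<dots> \<le> 2 * exp (- c * real n)"
      proof -
        have "c * real n = 2 * (\<eta> / 3 * real n)\<^sup>2 / ((T * real n) * (2 * K)\<^sup>2)"
          using n by (simp add: c_def power2_eq_square field_simps)
        also have "\<dots> \<le> 2 * (\<eta> / 3 * real n)\<^sup>2 / (real j * (2 * K)\<^sup>2)"
          using j K T n by (intro divide_left_mono mult_right_mono mult_pos_pos) auto
        finally show ?thesis by simp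
      qed
      also have "\<dots> = 2 * exp (- c) ^ n" by (simp add: exp_of_nat_mult[symmetric] mult.commute)
      finally show ?thesis .
    qed
    have bound: "prob (?bad n) \<le> 2 * T * (real n * exp (- c) ^ n) + e / 2" if n: "n \<ge> 1" for n
    proof -
      define J where "J = nat \<lfloor>T * real n\<rfloor>"
      have J: "real j \<le> T * real n \<longleftrightarrow> j \<le> J" for j
        unfolding J_def using T by (simp add: le_nat_floor le_floor_iff nat_le_iff le_nat_iff)
      let ?A = "\<lambda>j. {x \<in> space M. \<bar>(\<Sum>i=1..j. f K (X i x)) - \<mu>' * real j\<bar> \<ge> \<eta> / 3 * real n}"
      let ?R = "{x \<in> space M. (\<Sum>i=1..J. \<bar>X i x - f K (X i x)\<bar>) \<ge> \<eta> / 3 * real n}"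
      have sub: "?bad n \<subseteq> (\<Union>j\<in>{1..J}. ?A j) \<union> ?R"
      proof
        fix x assume x: "x \<in> ?bad n"
        then obtain j where j: "j \<le> J" "\<bar>(\<Sum>i=1..j. X i x) - \<mu> * real j\<bar> > \<eta> * real n"
          using J by blast
        show "x \<in> (\<Union>j\<in>{1..J}. ?A j) \<union> ?R"
        proof (rule ccontr)
          assume not: "\<not> ?thesis"
          have "j \<noteq> 0" using j(2) \<eta> by (cases j) (auto simp: mult_less_0_iff)
          then have 1: "\<bar>(\<Sum>i=1..j. f K (X i x)) - \<mu>' * real j\<bar> < \<eta> / 3 * real n"
            using not x j by (auto simp: not_le)
          have 2: "(\<Sum>i=1..J. \<bar>X i x - f K (X i x)\<bar>) < \<eta> / 3 * real n" using not x by auto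
          have "\<bar>(\<Sum>i=1..j. X i x) - (\<Sum>i=1..j. f K (X i x))\<bar> \<le> (\<Sum>i=1..j. \<bar>X i x - f K (X i x)\<bar>)"
            unfolding sum_subtractf[symmetric] by (rule sum_abs)
          also have "\<dots> \<le> (\<Sum>i=1..J. \<bar>X i x - f K (X i x)\<bar>)"
            using j(1) by (intro sum_mono2) auto
          finally have 3: "\<bar>(\<Sum>i=1..j. X i x) - (\<Sum>i=1..j. f K (X i x))\<bar> < \<eta> / 3 * real n" using 2 by linarith
          have "\<bar>\<mu> * real j - \<mu>' * real j\<bar> = \<bar>\<mu> - \<mu>'\<bar> * real j" by (simp add: left_diff_distrib[symmetric] abs_mult)
          also have "\<dots> \<le> \<eta> / (3 * T) * (T * real n)"
            using \<mu>\<mu> j(1) J \<eta> T by (intro mult_mono) auto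
          also have "\<dots> = \<eta> / 3 * real n" using T by simp
          finally have "\<bar>\<mu> * real j - \<mu>' * real j\<bar> \<le> \<eta> / 3 * real n" .
          with 1 3 j(2) show False by linarith
        qed
      qed
      have sm: "(\<lambda>x. \<Sum>i=1..j. g (X i x)) \<in> borel_measurable M"
        if "g \<in> borel_measurable borel" for g :: "real \<Rightarrow> real" and j
        by (intro borel_measurable_sum measurable_compose[OF X that]) auto
      have [measurable]: "(\<lambda>x. \<Sum>i=1..j. f K (X i x)) \<in> borel_measurable M"
        "(\<lambda>x. \<Sum>i=1..j. \<bar>X i x - f K (X i x)\<bar>) \<in> borel_measurable M" for j
        by (rule sm, simp)+
      have Er: "expectation (\<lambda>x. \<bar>X i x - f K (X i x)\<bar>) = \<kappa> K" "integrable M (\<lambda>x. \<bar>X i x - f K (X i x)\<bar>)"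
        if "i \<ge> 1" for i
        using E[of "\<lambda>y. \<bar>y - f K y\<bar>" i] that intr by (auto simp: \<kappa>_def)
      have mA: "?A j \<in> events" for j by measurable
      have mR: "?R \<in> events" by measurable
      have "prob (?bad n) \<le> prob ((\<Union>j\<in>{1..J}. ?A j) \<union> ?R)"
        using sub mA mR by (intro finite_measure_mono) auto
      also have "\<dots> \<le> prob (\<Union>j\<in>{1..J}. ?A j) + prob ?R"
        using mA mR by (intro measure_Un_le) auto
      also have "prob (\<Union>j\<in>{1..J}. ?A j) \<le> (\<Sum>j\<in>{1..J}. prob (?A j))"
        using mA by (intro measure_UNION_le) auto
      also have "(\<Sum>j\<in>{1..J}. prob (?A j)) \<le> (\<Sum>j\<in>{1..J}. 2 * exp (- c) ^ n)"
        using J n by (intro sum_mono pj) auto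
      also have "\<dots> = real J * (2 * exp (- c) ^ n)" by simp
      also have "\<dots> \<le> (T * real n) * (2 * exp (- c) ^ n)" using J[of J] by (intro mult_right_mono) auto
      also have "prob ?R \<le> expectation (\<lambda>x. \<Sum>i=1..J. \<bar>X i x - f K (X i x)\<bar>) / (\<eta> / 3 * real n)"
      proof (rule integral_Markov_inequality_measure[where A = "{}"])
        show "integrable M (\<lambda>x. \<Sum>i=1..J. \<bar>X i x - f K (X i x)\<bar>)"
          using Er(2) by (intro Bochner_Integration.integrable_sum) auto
      qed (use \<eta> n in \<open>auto intro!: sum_nonneg\<close>)
      also have "expectation (\<lambda>x. \<Sum>i=1..J. \<bar>X i x - f K (X i x)\<bar>) = real J * \<kappa> K"
        using Er by (subst Bochner_Integration.integral_sum) auto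
      also have "real J * \<kappa> K / (\<eta> / 3 * real n) \<le> e / 2"
      proof -
        have "real J * \<kappa> K \<le> (T * real n) * (e * \<eta> / (6 * T))"
          using J[of J] K T by (intro mult_mono) (auto simp: \<kappa>_def)
        also have "\<dots> = (e / 2) * (\<eta> / 3 * real n)" using T by simp
        finally show ?thesis using \<eta> n by (simp add: pos_divide_le_eq)
      qed
      finally show ?thesis by (simp add: mult_ac)
    qed
    have "(\<lambda>n. 2 * T * (real n * exp (- c) ^ n)) \<longlonglongrightarrow> 2 * T * 0"
      by (intro tendsto_mult tendsto_const powser_times_n_limit_0) (use c in simp)
    then have "\<forall>\<^sub>F n in sequentially. 2 * T * (real n * exp (- c) ^ n) < e / 2"
      by (rule order_tendstoD) (use e in simp)
    moreover have "\<forall>\<^sub>F n in sequentially. n \<ge> (1::nat)" by (rule eventually_ge_at_top)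
    ultimately show "\<forall>\<^sub>F n in sequentially. dist (prob (?bad n)) 0 < e"
    proof eventually_elim
      case (elim n)
      then show ?case using bound[of n] by (simp add: dist_real_def)
    qed
  qed
qed

section \<open>The walk seen from a grid\<close>

text \<open>The increment of the medium from site \<open>p\<close> to site \<open>p + 1\<close>. The
  case distinction reflects that \<open>z 0\<close> does not enter the medium: the origin has
  \<open>z 1\<close> on its right and \<open>z (- 1)\<close> on its left.\<close>

definition gap :: "(int \<Rightarrow> real) \<Rightarrow> int \<Rightarrow> real" where
  "gap z p = z (if p \<ge> 0 then p + 1 else p)"

lemma medium_Suc: "medium z (p + 1) - medium z p = gap z p"
proof -
  consider "p > 0" | "p = 0" | "p = - 1" | "p < - 1" by linarith
  then show ?thesis
  proof cases
    case 1
    then have "{1..p + 1} = insert (p + 1) {1..p}" by auto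
    with 1 show ?thesis by (simp add: medium_def gap_def)
  next
    case 4
    then have "{p..- 1} = insert p {p + 1..- 1}" by auto
    with 4 show ?thesis by (simp add: medium_def gap_def)
  qed (simp_all add: medium_def gap_def)
qed

lemma medium_diff: "p \<le> p' \<Longrightarrow> medium z p' - medium z p = (\<Sum>i\<in>{p..<p'}. gap z i)"
proof (induction p' rule: int_ge_induct)
  case (step i)
  have "{p..<i + 1} = insert i {p..<i}" using step by auto
  then show ?case using step medium_Suc[of z i] by simp
qed simp

lemma small_gaps_sum:
  fixes w :: "int \<Rightarrow> real"
  assumes "finite D" "A \<subseteq> D" "\<And>i. i \<in> D \<Longrightarrow> 0 \<le> w i" "\<And>i. i \<in> A \<Longrightarrow> w i \<le> \<theta>"
    and "(\<Sum>i\<in>D. if w i \<le> \<theta> then w i else 0) \<le> \<delta>"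
  shows "0 \<le> (\<Sum>i\<in>A. w i)" "(\<Sum>i\<in>A. w i) \<le> \<delta>"
proof -
  show "0 \<le> (\<Sum>i\<in>A. w i)" using assms by (intro sum_nonneg) auto
  have "(\<Sum>i\<in>A. w i) = (\<Sum>i\<in>A. if w i \<le> \<theta> then w i else 0)"
    using assms(4) by (intro sum.cong) auto
  also have "\<dots> \<le> (\<Sum>i\<in>D. if w i \<le> \<theta> then w i else 0)"
    using assms by (intro sum_mono2) auto
  finally show "(\<Sum>i\<in>A. w i) \<le> \<delta>" using assms(5) by linarith
qed

text \<open>A block of \<open>2b\<close> consecutive gaps contains at most one big gap, so every position of the walk
  can be joined to a neighbouring grid point \<open>kb\<close>, and every grid point to a position in one of its two
  adjacent blocks, without crossing a big gap.\<close>

lemma hclose_walk_grid: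
  fixes z :: "int \<Rightarrow> real" and s :: "nat \<Rightarrow> int" and b L :: int and n m :: nat
  assumes n: "n \<ge> 1" and m: "m \<ge> 1" and \<mu>: "\<mu> > 0" and T: "T \<ge> 0"
    and b: "b = \<lfloor>real n * \<mu> / real m\<rfloor>" and b1: "b \<ge> 1" and L: "real n * \<mu> * (T + 2) \<le> of_int L"
    and s0: "s 0 = 0"
    and s: "\<And>j. real j \<le> (T + 1) * real n \<Longrightarrow> \<bar>of_int (s j) - \<mu> * real j\<bar> \<le> \<kappa>"
    and \<kappa>: "\<kappa> + \<mu> \<le> of_int b / 2"
    and pos: "\<And>i. i \<in> {-L..<L} \<Longrightarrow> 0 \<le> gap z i"
    and near0: "\<And>i. i \<in> {-b..<0} \<Longrightarrow> gap z i \<le> \<theta>"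
    and pairs: "\<And>i j. i \<in> {-L..<L} \<Longrightarrow> j \<in> {-L..<L} \<Longrightarrow> i < j \<Longrightarrow> j < i + 2 * b \<Longrightarrow> gap z i \<le> \<theta> \<or> gap z j \<le> \<theta>"
    and small: "(\<Sum>i\<in>{-L..<L}. if gap z i \<le> \<theta> then gap z i else 0) \<le> \<delta>"
    and \<rho>1: "(2 * real m * T + 2) / (real n * \<mu>) + 2 / real m \<le> \<rho>" and \<rho>2: "\<bar>a\<bar> * \<delta> \<le> \<rho>"
  shows "hclose T \<rho> (step_fun (real n) (\<lambda>j. a * medium z (s j)))
    (step_fun (real m) (\<lambda>k. a * medium z (b * int k)))"
proof -
  let ?f = "step_fun (real n) (\<lambda>j. a * medium z (s j))" and ?g = "step_fun (real m) (\<lambda>k. a * medium z (b * int k))"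
  define R where "R = real n * \<mu>"
  have R: "R > 0" using n \<mu> by (simp add: R_def)
  let ?b = "real_of_int b"
  have bR: "?b \<le> R / m" "R / m < ?b + 1" unfolding b R_def by linarith+
  have bR': "?b * m \<le> R" using bR(1) m by (simp add: field_simps)
  have Rb: "R / m \<le> R" using m R by (simp add: field_simps)
  \<comment> \<open>A block has real length \<open>R / m\<close> and integer length
    \<open>b\<close>; the error of at most 1 per block accumulates linearly in
    \<open>k\<close>.\<close>
  have kb: "\<bar>real k / m * R - real k * ?b\<bar> \<le> real k" for k :: nat
  proof -
    have "real k / m * R - real k * ?b = real k * (R / m - ?b)" by (simp add: algebra_simps)
    moreover have "0 \<le> R / m - ?b" "R / m - ?b \<le> 1" using bR by linarith+
    ultimately show ?thesis by (simp add: abs_mult mult_left_le)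
  qed
  have LR: "R * (T + 2) \<le> of_int L" using L by (simp add: R_def)
  have L2: "R * T + 2 * ?b \<le> of_int L"
  proof -
    have "R * (T + 2) = R * T + 2 * R" by (simp add: algebra_simps)
    then show ?thesis using LR bR(1) Rb by linarith
  qed
  have bL: "b \<le> L"
  proof -
    have "0 \<le> R * T" using R T by simp
    then have "?b \<le> of_int L" using L2 b1 by linarith
    then show ?thesis by simp
  qed
  have \<kappa>0: "\<kappa> \<ge> 0" using s[of 0] T s0 by simp
  have step: "\<bar>a * medium z p - a * medium z p'\<bar> \<le> \<rho>"
    if "p \<le> p'" "{p..<p'} \<subseteq> {-L..<L}" "\<And>i. i \<in> {p..<p'} \<Longrightarrow> gap z i \<le> \<theta>" for p p'
  proof -
    have "0 \<le> medium z p' - medium z p" "medium z p' - medium z p \<le> \<delta>"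
      unfolding medium_diff[OF that(1)]
      using small_gaps_sum[of "{-L..<L}" "{p..<p'}" "gap z" \<theta> \<delta>] that pos small by auto
    then have "\<bar>a\<bar> * \<bar>medium z p - medium z p'\<bar> \<le> \<bar>a\<bar> * \<delta>" by (intro mult_left_mono) auto
    then show ?thesis using \<rho>2 by (simp add: abs_mult[symmetric] right_diff_distrib)
  qed
  \<comment> \<open>Division by \<open>R\<close>, the drift per unit of rescaled time, turns
    distances into times. The budget \<open>2 * m * T + 2\<close> is for the accumulated rounding,
    \<open>2 * (R / m)\<close> for two block lengths.\<close>
  have \<rho>': "\<bar>t' - t\<bar> \<le> \<rho>" if "\<bar>R * t' - R * t\<bar> \<le> (2 * m * T + 2) + 2 * (R / m)" for t t'
  proof -
    have "R * \<bar>t' - t\<bar> \<le> (2 * m * T + 2) + 2 * (R / m)"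
      using that R by (simp add: right_diff_distrib[symmetric] abs_mult)
    also have "\<dots> = R * ((2 * m * T + 2) / R + 2 / m)" using R by (simp add: field_simps)
    also have "\<dots> \<le> R * \<rho>" using \<rho>1 R by (intro mult_left_mono) (auto simp: R_def)
    finally show ?thesis using R by simp
  qed
  show ?thesis
    unfolding hclose_def
  proof (intro conjI ballI)
    fix t assume t: "t \<in> {0..T}"
    define j where "j = nat \<lfloor>real n * t\<rfloor>"
    define p where "p = s j"
    have jr: "real j \<le> real n * t" "real n * t < real j + 1"
      using t unfolding j_def by (simp_all add: of_nat_nat)
    have jT: "real j \<le> (T + 1) * real n"
    proof -
      have "real n * t \<le> real n * (T + 1)" using t by (intro mult_left_mono) auto
      then show ?thesis using jr by (simp add: mult.commute)
    qed
    have "\<mu> * real j \<le> R * t" "R * t \<le> \<mu> * real j + \<mu>"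
      using mult_left_mono[OF jr(1), of \<mu>] mult_left_mono[OF less_imp_le[OF jr(2)], of \<mu>] \<mu>
      by (simp_all add: R_def algebra_simps)
    then have pt: "\<bar>of_int p - R * t\<bar> \<le> ?b / 2" using s[OF jT] \<kappa> \<mu> unfolding p_def by linarith
    have ft: "?f t = a * medium z p"
      using t by (simp add: step_fun_def j_def p_def)
    have gk: "?g (real k / m) = a * medium z (b * int k)" for k
      using m by (simp add: step_fun_def)
    have RtT: "R * t \<le> R * T" "0 \<le> R * t" using t R by (auto intro: mult_left_mono)
    have "\<exists>k. \<bar>of_int (b * int k) - of_int p\<bar> \<le> ?b \<and> \<bar>a * medium z (b * int k) - a * medium z p\<bar> \<le> \<rho>
      \<and> real k * ?b \<le> R * T + 2 * ?b"
    proof (cases "p \<ge> 0")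
      case False
      \<comment> \<open>To the left of the origin there is no grid point. A walk that fluctuates
        below 0 is joined to the grid point 0, through a block that \<open>near0\<close> keeps free
        of big gaps.\<close>
      have "-b \<le> p" using pt RtT b1 by linarith
      then have "\<bar>a * medium z p - a * medium z 0\<bar> \<le> \<rho>"
        using False near0 bL by (intro step) auto
      moreover have "\<bar>0 - of_int p\<bar> \<le> ?b" using False \<open>-b \<le> p\<close> by simp
      ultimately show ?thesis using RtT b1 by (intro exI[of _ 0]) (auto simp: abs_minus_commute)
    next
      case True
      define k where "k = nat (p div b)"
      have k: "int k = p div b" using True b1 by (simp add: k_def pos_imp_zdiv_nonneg_iff)
      have kp: "b * int k \<le> p" "p < b * int k + b"
        unfolding k using b1 by (metis mult.commute mult_div_mod_eq le_add_same_cancel1 pos_mod_sign zero_less_one order_less_le_trans,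
          metis add_strict_left_mono mult_div_mod_eq pos_mod_bound zero_less_one order_less_le_trans)
      have pL: "real_of_int p + ?b \<le> R * T + 2 * ?b" using pt RtT b1 by linarith
      then have pL': "p + b \<le> L" using L2 by linarith
      have bk0: "0 \<le> b * int k" using b1 by simp
      have gL: "- L \<le> b * int k - b" "- L \<le> b * int k" using bk0 bL b1 by linarith+
      show ?thesis
      proof (cases "\<exists>i\<in>{b * int k..<p}. gap z i > \<theta>")
        case False
        then have "\<bar>a * medium z (b * int k) - a * medium z p\<bar> \<le> \<rho>"
          using kp pL' b1 gL by (intro step) (auto simp: not_less)
        moreover have "\<bar>of_int (b * int k) - of_int p\<bar> \<le> ?b" using kp by linarith
        moreover have "real k * ?b \<le> R * T + 2 * ?b"
        proof -
          have "of_int (b * int k) \<le> real_of_int p" using kp by linarith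
          then show ?thesis using pL b1 by (simp add: mult.commute)
        qed
        ultimately show ?thesis by blast
      next
        case True
        then obtain i0 where i0: "i0 \<in> {b * int k..<p}" "gap z i0 > \<theta>" by blast
        have e: "b * int (Suc k) = b * int k + b" by (simp add: algebra_simps)
        have "\<bar>a * medium z p - a * medium z (b * int (Suc k))\<bar> \<le> \<rho>"
        proof (rule step)
          show "p \<le> b * int (Suc k)" using kp e by linarith
          show "{p..<b * int (Suc k)} \<subseteq> {- L..<L}" using kp pL' e gL b1 by auto
          fix i assume i: "i \<in> {p..<b * int (Suc k)}"
          have "gap z i0 \<le> \<theta> \<or> gap z i \<le> \<theta>"
            by (rule pairs) (use i i0 kp pL' e gL b1 in auto)
          then show "gap z i \<le> \<theta>" using i0 by simp
        qed
        moreover have "\<bar>of_int (b * int (Suc k)) - of_int p\<bar> \<le> ?b" using kp e by linarith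
        moreover have "real (Suc k) * ?b \<le> R * T + 2 * ?b"
        proof -
          have "of_int (b * int (Suc k)) \<le> real_of_int p + ?b" using kp e by linarith
          then show ?thesis using pL by (simp add: mult.commute)
        qed
        ultimately show ?thesis by (metis abs_minus_commute)
      qed
    qed
    then obtain k where k: "\<bar>of_int (b * int k) - of_int p\<bar> \<le> ?b"
      "\<bar>a * medium z (b * int k) - a * medium z p\<bar> \<le> \<rho>" "real k * ?b \<le> R * T + 2 * ?b" by blast
    \<comment> \<open>The factor 2 comes from \<open>R / m < b + 1 \<le> 2 * b\<close>.\<close>
    have kT: "real k \<le> 2 * m * T + 2"
    proof -
      have "R \<le> m * (?b + 1)" using bR(2) m by (simp add: field_simps)
      also have "\<dots> \<le> m * (2 * ?b)" using b1 by (intro mult_left_mono) auto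
      finally have "R * T \<le> 2 * m * T * ?b" using T mult_right_mono[of R "m * (2 * ?b)" T] by (simp add: mult_ac)
      then have "real k * ?b \<le> (2 * m * T + 2) * ?b" using k(3) by (simp add: distrib_right)
      then show ?thesis using b1 by simp
    qed
    have "of_int (b * int k) = real k * ?b" by simp
    then have "\<bar>real k * ?b - R * t\<bar> \<le> 3 / 2 * ?b" using k(1) pt by linarith
    moreover have "R * (real k / m) = real k / m * R" by simp
    ultimately have "\<bar>R * (real k / m) - R * t\<bar> \<le> (2 * m * T + 2) + 2 * (R / m)"
      using kb[of k] kT bR b1 by linarith
    then have "\<bar>real k / m - t\<bar> \<le> \<rho>" by (rule \<rho>')
    then show "\<exists>u\<ge>0. \<bar>u - t\<bar> \<le> \<rho> \<and> \<bar>?g u -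
        ?f t\<bar> \<le> \<rho>"
      using k(2) by (intro exI[of _ "real k / m"]) (simp only: gk ft, simp)
  next
    fix t assume t: "t \<in> {0..T}"
    define k where "k = nat \<lfloor>real m * t\<rfloor>"
    have kr: "real k \<le> real m * t" "real m * t < real k + 1"
      using t unfolding k_def by (simp_all add: of_nat_nat)
    have kT: "real k \<le> m * T"
    proof -
      have "real m * t \<le> real m * T" using t by (intro mult_left_mono) auto
      then show ?thesis using kr by linarith
    qed
    have kt: "\<bar>real k / m * R - R * t\<bar> \<le> R / m"
    proof -
      have "\<bar>real k - m * t\<bar> \<le> 1" using kr by linarith
      moreover have "real k / m * R - R * t = (real k - m * t) * (R / m)" using m by (simp add: field_simps)
      moreover have "0 \<le> R / m" using R by simp
      ultimately show ?thesis using mult_right_mono[of "\<bar>real k - m * t\<bar>" 1 "R / m"]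
        by (simp only: abs_mult abs_of_nonneg) simp
    qed
    have gt: "?g t = a * medium z (b * int k)"
      using t by (simp add: step_fun_def k_def)
    have fj: "?f (real j / n) = a * medium z (s j)" for j
      using n by (simp add: step_fun_def)
    have kbR: "real k * ?b + ?b \<le> R * (T + 1)"
    proof -
      have "(real k + 1) * ?b \<le> (m * T + m) * ?b" using kT m b1 by (intro mult_right_mono) auto
      also have "\<dots> = (?b * m) * (T + 1)" by (simp add: algebra_simps)
      also have "\<dots> \<le> R * (T + 1)" using bR' T by (intro mult_right_mono) auto
      finally show ?thesis by (simp add: distrib_right)
    qed
    have kL: "b * int k + b \<le> L"
    proof -
      have "R * (T + 2) = R * (T + 1) + R" by (simp add: algebra_simps)
      then have "real k * ?b + ?b \<le> of_int L" using kbR LR R by linarith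
      then have "real_of_int (b * int k + b) \<le> of_int L" by (simp add: mult.commute)
      then show ?thesis by linarith
    qed
    have bk0: "0 \<le> b * int k" using b1 by simp
    have gL: "- L \<le> b * int k - b" "- L \<le> b * int k" using bk0 bL b1 by linarith+
    text \<open>At a time when the linear drift is at the midpoint of a block, the walk is inside it.\<close>
    have visit: "\<exists>j. l \<le> s j \<and> s j \<le> l + b \<and> \<bar>real j / n - t\<bar> \<le> \<rho>"
      if l: "l = b * int k \<or> l = b * int k - b" "0 \<le> l" for l
    proof -
      define y where "y = (of_int l + ?b / 2) / \<mu>"
      define j where "j = nat \<lfloor>y\<rfloor>"
      have y0: "y \<ge> 0" using l(2) b1 \<mu> by (simp add: y_def)
      have jy: "real j \<le> y" "y < real j + 1" using y0 unfolding j_def by (simp_all add: of_nat_nat)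
      have y\<mu>: "\<mu> * y = of_int l + ?b / 2" using \<mu> by (simp add: y_def)
      have j\<mu>: "\<mu> * real j \<le> of_int l + ?b / 2" "of_int l + ?b / 2 \<le> \<mu> * real j + \<mu>"
        using mult_left_mono[OF jy(1), of \<mu>] mult_left_mono[OF less_imp_le[OF jy(2)], of \<mu>] \<mu> y\<mu>
        by (simp_all add: algebra_simps)
      have lk: "\<bar>of_int l + ?b / 2 - real k * ?b\<bar> \<le> ?b / 2"
        using l(1) b1 by (auto simp: mult.commute)
      have "\<mu> * real j \<le> R * (T + 1)" using j\<mu> lk kbR b1 by linarith
      then have "real j \<le> (T + 1) * n" using \<mu> by (simp add: R_def mult_ac)
      from s[OF this] have sj: "\<bar>of_int (s j) - (of_int l + ?b / 2)\<bar> \<le> ?b / 2"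
        using j\<mu> \<kappa> \<mu> by linarith
      have "of_int l \<le> real_of_int (s j)" "real_of_int (s j) \<le> of_int l + ?b" using sj by linarith+
      then have "l \<le> s j" "s j \<le> l + b" by linarith+
      moreover have "\<bar>real j / n - t\<bar> \<le> \<rho>"
      proof (rule \<rho>')
        have "R * (real j / n) = \<mu> * real j" using n by (simp add: R_def)
        then show "\<bar>R * (real j / n) - R * t\<bar> \<le> (2 * m * T + 2) + 2 * (R / m)"
          using j\<mu> lk kb[of k] kT kt bR \<kappa> \<kappa>0 T by linarith
      qed
      ultimately show ?thesis by blast
    qed
    have "\<exists>j. \<bar>a * medium z (s j) - a * medium z (b * int k)\<bar> \<le> \<rho> \<and> \<bar>real j / n - t\<bar> \<le> \<rho>"
    proof (cases "\<exists>i\<in>{b * int k - b..<b * int k}. gap z i > \<theta>")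
      case True
      then obtain i0 where i0: "i0 \<in> {b * int k - b..<b * int k}" "gap z i0 > \<theta>" by blast
      obtain j where j: "b * int k \<le> s j" "s j \<le> b * int k + b" "\<bar>real j / n - t\<bar> \<le> \<rho>"
        using visit[of "b * int k"] bk0 by auto
      have "\<bar>a * medium z (b * int k) - a * medium z (s j)\<bar> \<le> \<rho>"
      proof (rule step[OF j(1)])
        show "{b * int k..<s j} \<subseteq> {- L..<L}" using j kL gL b1 by auto
        fix i assume i: "i \<in> {b * int k..<s j}"
        have "gap z i0 \<le> \<theta> \<or> gap z i \<le> \<theta>"
          by (rule pairs) (use i i0 j kL gL b1 in auto)
        then show "gap z i \<le> \<theta>" using i0 by simp
      qed
      with j show ?thesis by (metis abs_minus_commute)
    next
      case False
      show ?thesis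
      \<comment> \<open>For \<open>k = 0\<close> the left block consists of negative sites, which
        the drift does not visit. Time 0 serves instead, as the walk starts exactly at this grid
        point.\<close>
      proof (cases "k = 0")
        case True
        have "\<bar>real 0 / n - t\<bar> \<le> \<rho>"
        proof (rule \<rho>')
          have "0 \<le> R / m" "0 \<le> 2 * m * T" using R T by simp_all
          moreover have "R * (real 0 / n) = 0" "real k / m * R = 0" using True by simp_all
          ultimately show "\<bar>R * (real 0 / n) - R * t\<bar> \<le> (2 * m * T + 2) + 2 * (R / m)"
            using kt by linarith
        qed
        moreover have "a * medium z (s 0) - a * medium z (b * int k) = 0" using True s0 by simp
        moreover have "0 \<le> \<rho>" using \<open>\<bar>real 0 / n - t\<bar> \<le> \<rho>\<close> by linarith
        ultimately show ?thesis by (intro exI[of _ 0] conjI) linarith+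
      next
        case k0: False
        have "b * 1 \<le> b * int k" using k0 b1 by (intro mult_left_mono) auto
        then have l0: "0 \<le> b * int k - b" by simp
        obtain j where j: "b * int k - b \<le> s j" "s j \<le> b * int k - b + b" "\<bar>real j / n - t\<bar> \<le> \<rho>"
          using visit[of "b * int k - b"] l0 by auto
        have "\<bar>a * medium z (s j) - a * medium z (b * int k)\<bar> \<le> \<rho>"
          by (rule step) (use False j gL kL b1 in \<open>auto simp: not_less\<close>)
        with j show ?thesis by blast
      qed
    qed
    then obtain j where "\<bar>a * medium z (s j) - a * medium z (b * int k)\<bar> \<le> \<rho>" "\<bar>real j / n - t\<bar> \<le> \<rho>" by blast
    then show "\<exists>u\<ge>0. \<bar>u - t\<bar> \<le> \<rho> \<and> \<bar>?f u -
        ?g t\<bar> \<le> \<rho>"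
      by (intro exI[of _ "real j / n"]) (simp only: gt fj, simp)
  qed
qed

section \<open>Gaps of the medium\<close>

lemma (in prob_space) indep_vars_block_sums:
  fixes X :: "'i \<Rightarrow> 'a \<Rightarrow> real"
  assumes "indep_vars (\<lambda>_. borel) X I" "\<And>j. j \<in> J \<Longrightarrow> K j \<subseteq> I" "disjoint_family_on K J"
  shows "indep_vars (\<lambda>_. borel) (\<lambda>j x. (\<Sum>i\<in>K j. X i x) * c) J"
proof -
  have "indep_vars (\<lambda>_. borel) (\<lambda>j x. (\<lambda>f. (\<Sum>i\<in>K j. f i) * c) (restrict (\<lambda>i. X i x) (K j))) J"
    by (rule indep_vars_compose2[OF indep_vars_restrict[OF assms]]) auto
  moreover have "(\<lambda>f. (\<Sum>i\<in>K j. f i) * c) (restrict (\<lambda>i. X i x) (K j)) = (\<Sum>i\<in>K j. X i x) * c" for j x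
    by (simp cong: sum.cong)
  ultimately show ?thesis by simp
qed

lemma (in prob_space) indep_vars_inj_reindex:
  fixes X :: "'i \<Rightarrow> 'a \<Rightarrow> real"
  assumes "indep_vars (\<lambda>_. borel) X I" "inj_on \<sigma> J" "\<sigma> ` J \<subseteq> I"
  shows "indep_vars (\<lambda>_. borel) (\<lambda>j. X (\<sigma> j)) J"
  using indep_vars_block_sums[OF assms(1), of J "\<lambda>j. {\<sigma> j}" 1] assms(2,3)
  by (auto simp: disjoint_family_on_def inj_on_def)

text \<open>This lets sums over an arbitrary block of gaps, or over reflected indices, be replaced
  by the sums over an initial segment to which the attraction hypothesis refers.\<close>

lemma (in prob_space) distr_iid_sum_eq:
  fixes X :: "'i \<Rightarrow> 'a \<Rightarrow> real" and Y :: "'j \<Rightarrow> 'a \<Rightarrow> real"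
  assumes "indep_vars (\<lambda>_. borel) X A" "\<And>i. i \<in> A \<Longrightarrow> distr M borel (X i) = \<nu>"
    and "indep_vars (\<lambda>_. borel) Y B" "\<And>i. i \<in> B \<Longrightarrow> distr M borel (Y i) = \<nu>" and "card A = card B"
  shows "distr M borel (\<lambda>x. (\<Sum>i\<in>A. X i x) * c) = distr M borel (\<lambda>x. (\<Sum>i\<in>B. Y i x) * c)"
proof (rule Levy_uniqueness)
  have [measurable]: "i \<in> A \<Longrightarrow> X i \<in> borel_measurable M" "j \<in> B \<Longrightarrow> Y j \<in> borel_measurable M" for i j
    using assms(1,3) by (auto simp: indep_vars_def)
  show "real_distribution (distr M borel (\<lambda>x. (\<Sum>i\<in>A. X i x) * c))"
    "real_distribution (distr M borel (\<lambda>x. (\<Sum>i\<in>B. Y i x) * c))"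
    by (intro real_distribution_distr borel_measurable_times borel_measurable_sum; simp)+
  show "char (distr M borel (\<lambda>x. (\<Sum>i\<in>A. X i x) * c)) = char (distr M borel (\<lambda>x. (\<Sum>i\<in>B. Y i x) * c))"
    using char_iid_sum[OF assms(1,2)] char_iid_sum[OF assms(3,4)] assms(5) by (simp add: fun_eq_iff)
qed

lemma (in prob_space) prob_exists_big:
  fixes X :: "'i \<Rightarrow> 'a \<Rightarrow> real"
  assumes X: "\<And>i. i \<in> A \<Longrightarrow> X i \<in> borel_measurable M" and law: "\<And>i. i \<in> A \<Longrightarrow> distr M borel (X i) = \<nu>"
    and "finite A"
  shows "{x \<in> space M. \<exists>i\<in>A. v < X i x} \<in> events"
    and "prob {x \<in> space M. \<exists>i\<in>A. v < X i x} \<le> card A * measure \<nu> {v<..}"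
proof -
  have eq: "{x \<in> space M. \<exists>i\<in>A. v < X i x} = (\<Union>i\<in>A. X i -` {v<..} \<inter> space M)" by auto
  have m: "X i -` {v<..} \<inter> space M \<in> events" if "i \<in> A" for i
    using X[OF that] by (rule measurable_sets) simp
  show "{x \<in> space M. \<exists>i\<in>A. v < X i x} \<in> events"
    unfolding eq using m \<open>finite A\<close> by (intro sets.finite_UN) auto
  have "prob (\<Union>i\<in>A. X i -` {v<..} \<inter> space M) \<le> (\<Sum>i\<in>A. prob (X i -` {v<..} \<inter> space M))"
    using m \<open>finite A\<close> by (intro measure_UNION_le) auto
  also have "\<dots> = (\<Sum>i\<in>A. measure \<nu> {v<..})"
    using X by (intro sum.cong refl) (subst law[symmetric], auto simp: measure_distr)
  finally show "prob {x \<in> space M. \<exists>i\<in>A. v < X i x} \<le> card A * measure \<nu> {v<..}"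
    by (simp add: eq)
qed

text \<open>A union bound over the pairs, each contributing the squared tail by independence. With
  about \<open>n\<close> sites, blocks of length about \<open>n / m\<close> and a tail of order
  \<open>1 / n\<close>, the bound is of order \<open>1 / m\<close>.\<close>

lemma (in prob_space) prob_two_close_big:
  fixes X :: "int \<Rightarrow> 'a \<Rightarrow> real"
  assumes ind: "indep_vars (\<lambda>_. borel) X UNIV" and law: "\<And>i. distr M borel (X i) = \<nu>"
    and D: "finite D" and b: "b \<ge> 0"
  shows "{x \<in> space M. \<exists>i\<in>D. \<exists>j\<in>D. i < j \<and> j < i + 2 * b \<and> v < X i x \<and> v < X j x} \<in> events" (is "?E \<in> _")
    and "prob {x \<in> space M. \<exists>i\<in>D. \<exists>j\<in>D. i < j \<and> j < i + 2 * b \<and> v < X i x \<and> v < X j x}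
      \<le> real (card D) * (2 * real_of_int b) * (measure \<nu> {v<..})\<^sup>2"
proof -
  have X [measurable]: "X i \<in> borel_measurable M" for i using ind by (auto simp: indep_vars_def)
  let ?F = "\<lambda>i k. \<Inter>l\<in>{i, i + k}. X l -` {v<..} \<inter> space M"
  have "?E = (\<Union>i\<in>D. \<Union>j\<in>{j\<in>D. i < j \<and> j < i + 2 * b}. {x \<in> space M. v < X i x \<and> v < X j x})" by auto
  moreover have "{x \<in> space M. v < X i x \<and> v < X j x} \<in> events" for i j by measurable
  ultimately show "?E \<in> events" using D by (auto intro!: sets.finite_UN)
  have m: "?F i k \<in> events" for i k by (intro sets.finite_INT) auto
  have "?E \<subseteq> (\<Union>i\<in>D. \<Union>k\<in>{1..<2 * b}. ?F i k)"
  proof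
    fix x assume "x \<in> ?E"
    then obtain i j where ij: "x \<in> space M" "i \<in> D" "i < j" "j < i + 2 * b" "v < X i x" "v < X j x" by blast
    then have "x \<in> ?F i (j - i)" by auto
    moreover have "j - i \<in> {1..<2 * b}" using ij by auto
    ultimately show "x \<in> (\<Union>i\<in>D. \<Union>k\<in>{1..<2 * b}. ?F i k)" using ij(2) by blast
  qed
  then have "prob ?E \<le> prob (\<Union>i\<in>D. \<Union>k\<in>{1..<2 * b}. ?F i k)"
    using m D by (intro finite_measure_mono sets.finite_UN) auto
  also have "\<dots> \<le> (\<Sum>i\<in>D. prob (\<Union>k\<in>{1..<2 * b}. ?F i k))"
    using m D by (intro measure_UNION_le sets.finite_UN) auto
  also have "\<dots> \<le> (\<Sum>i\<in>D. \<Sum>k\<in>{1..<2 * b}. prob (?F i k))"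
    using m by (intro sum_mono measure_UNION_le) auto
  also have "\<dots> = (\<Sum>i\<in>D. \<Sum>k\<in>{1..<2 * b}. (measure \<nu> {v<..})\<^sup>2)"
  proof (intro sum.cong refl)
    fix i k assume "k \<in> {1..<2 * b}"
    then have ne: "i \<noteq> i + k" by simp
    have p: "prob (X l -` {v<..} \<inter> space M) = measure \<nu> {v<..}" for l
      by (subst law[of l, symmetric]) (simp add: measure_distr)
    have "prob (?F i k) = (\<Prod>l\<in>{i, i + k}. prob (X l -` {v<..} \<inter> space M))"
      by (rule indep_varsD[OF ind]) auto
    also have "\<dots> = (measure \<nu> {v<..})\<^sup>2" using ne by (simp add: p power2_eq_square)
    finally show "prob (?F i k) = (measure \<nu> {v<..})\<^sup>2" .
  qed
  also have "\<dots> = card D * real (nat (2 * b - 1)) * (measure \<nu> {v<..})\<^sup>2" by simp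
  also have "\<dots> \<le> real (card D) * (2 * real_of_int b) * (measure \<nu> {v<..})\<^sup>2"
  proof -
    have "real (nat (2 * b - 1)) \<le> 2 * of_int b" using b by linarith
    then show ?thesis by (rule mult_right_mono[OF mult_left_mono]) auto
  qed
  finally show "prob ?E \<le> real (card D) * (2 * real_of_int b) * (measure \<nu> {v<..})\<^sup>2" .
qed

text \<open>Markov's inequality. The truncation to positive values in the integral is harmless as
  the variables are almost surely nonnegative.\<close>

lemma (in prob_space) prob_small_part_sum:
  fixes X :: "'i \<Rightarrow> 'a \<Rightarrow> real"
  assumes X: "\<And>i. i \<in> D \<Longrightarrow> X i \<in> borel_measurable M" and law: "\<And>i. i \<in> D \<Longrightarrow> distr M borel (X i) = \<nu>"
    and pos: "\<And>i. i \<in> D \<Longrightarrow> AE x in M. 0 \<le> X i x" and "finite D" "\<delta> > 0" "v > 0"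
  shows "{x \<in> space M. \<delta> < (\<Sum>i\<in>D. if X i x \<le> v then X i x else 0)} \<in> events" (is "?E \<in> _")
    and "prob {x \<in> space M. \<delta> < (\<Sum>i\<in>D. if X i x \<le> v then X i x else 0)}
      \<le> card D * (\<integral>y. indicator {0<..v} y * y \<partial>\<nu>) / \<delta>"
proof -
  let ?g = "\<lambda>y::real. indicator {0<..v} y * y"
  let ?S = "\<lambda>x. \<Sum>i\<in>D. ?g (X i x)"
  have g: "?g \<in> borel_measurable borel" by simp
  have m: "(\<lambda>x. \<Sum>i\<in>D. h (X i x)) \<in> borel_measurable M" if "h \<in> borel_measurable borel" for h :: "real \<Rightarrow> real"
    by (intro borel_measurable_sum measurable_compose[OF X that])
  have [measurable]: "?S \<in> borel_measurable M" by (rule m[OF g])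
  have [measurable]: "(\<lambda>x. \<Sum>i\<in>D. if X i x \<le> v then X i x else 0) \<in> borel_measurable M"
    by (rule m) simp
  show ev: "?E \<in> events" by measurable
  have int: "integrable M (\<lambda>x. ?g (X i x))" if "i \<in> D" for i
    by (rule integrable_const_bound[of _ v])
       (use \<open>v > 0\<close> measurable_compose[OF X[OF that] g] in \<open>auto simp: indicator_def\<close>)
  have "prob ?E \<le> prob {x \<in> space M. \<delta> \<le> ?S x}"
  proof (rule finite_measure_mono_AE)
    have "AE x in M. \<forall>i\<in>D. 0 \<le> X i x"
      using \<open>finite D\<close> pos by (intro AE_ball_countable' countable_finite) auto
    then show "AE x in M. x \<in> ?E \<longrightarrow> x \<in> {x \<in> space M. \<delta> \<le> ?S x}"
    proof eventually_elim
      case (elim x)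
      then have "(\<Sum>i\<in>D. if X i x \<le> v then X i x else 0) = ?S x"
        by (intro sum.cong) (auto simp: indicator_def order.order_iff_strict)
      then show ?case by auto
    qed
  qed measurable
  also have "\<dots> \<le> expectation ?S / \<delta>"
    by (rule integral_Markov_inequality_measure[where A = "{}"])
       (use \<open>\<delta> > 0\<close> int in \<open>auto intro!: sum_nonneg simp: indicator_def\<close>)
  also have "expectation ?S = (\<Sum>i\<in>D. expectation (\<lambda>x. ?g (X i x)))"
    by (rule Bochner_Integration.integral_sum[OF int])
  also have "\<dots> = (\<Sum>i\<in>D. \<integral>y. ?g y \<partial>\<nu>)"
    using X by (intro sum.cong refl) (subst law[symmetric], auto simp: integral_distr[OF _ g])
  finally show "prob ?E \<le> card D * (\<integral>y. ?g y \<partial>\<nu>) / \<delta>" by simp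
qed

lemma distr_gap_medium:
  fixes \<zeta> :: "int \<Rightarrow> 'a \<Rightarrow> real"
  assumes "prob_space M" and \<zeta>: "iid M borel \<zeta> UNIV"
  shows "prob_space.indep_vars M (\<lambda>_. borel) (\<lambda>p x. gap (\<lambda>i. \<zeta> i x) p) UNIV"
    and "distr M borel (\<lambda>x. gap (\<lambda>i. \<zeta> i x) p) = distr M borel (\<zeta> 1)"
proof -
  interpret prob_space M by fact
  have ind: "indep_vars (\<lambda>_. borel) \<zeta> UNIV" and law: "distr M borel (\<zeta> i) = distr M borel (\<zeta> 1)" for i
    using \<zeta> unfolding iid_def by blast+
  have "inj (\<lambda>p::int. if p \<ge> 0 then p + 1 else p)" by (auto simp: inj_def split: if_splits)
  then have "indep_vars (\<lambda>_. borel) (\<lambda>p. \<zeta> (if p \<ge> 0 then p + 1 else p)) UNIV"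
    by (rule indep_vars_inj_reindex[OF ind]) simp
  then show "indep_vars (\<lambda>_. borel) (\<lambda>p x. gap (\<lambda>i. \<zeta> i x) p) UNIV" by (simp add: gap_def)
  show "distr M borel (\<lambda>x. gap (\<lambda>i. \<zeta> i x) p) = distr M borel (\<zeta> 1)"
    unfolding gap_def by (rule law)
qed

section \<open>The walk path and its grid approximation in probability\<close>

abbreviation (input) walk_path ::
    "real \<Rightarrow> real \<Rightarrow> (int \<Rightarrow> 'a \<Rightarrow> real) \<Rightarrow> (nat \<Rightarrow> 'a \<Rightarrow> int) \<Rightarrow> nat \<Rightarrow> 'a \<Rightarrow> real \<Rightarrow> real" where
  "walk_path \<beta> c \<zeta> \<xi> n x \<equiv>
     step_fun (real n) (\<lambda>j. c / real n powr (1 / \<beta>) * medium (\<lambda>i. \<zeta> i x) (walk (\<lambda>i. \<xi> i x) j))"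

abbreviation (input) grid_path ::
    "real \<Rightarrow> real \<Rightarrow> real \<Rightarrow> (int \<Rightarrow> 'a \<Rightarrow> real) \<Rightarrow> nat \<Rightarrow> nat \<Rightarrow> 'a \<Rightarrow> real \<Rightarrow> real" where
  "grid_path \<beta> c \<mu> \<zeta> m n x \<equiv>
     step_fun (real m) (\<lambda>k. c / real n powr (1 / \<beta>) *
       medium (\<lambda>i. \<zeta> i x) (\<lfloor>real n * \<mu> / real m\<rfloor> * int k))"

abbreviation (input) levy_grid_path ::
    "real \<Rightarrow> real \<Rightarrow> real \<Rightarrow> (real \<Rightarrow> 'b \<Rightarrow> real) \<Rightarrow> nat \<Rightarrow> 'b \<Rightarrow> real \<Rightarrow> real" where
  "levy_grid_path \<beta> c \<mu> Z m y \<equiv>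
     step_fun (real m) (\<lambda>k. c * \<mu> powr (1 / \<beta>) * Z (real k / real m) y)"

text \<open>Outside four events, each of probability at most \<open>e / 4\<close>, the deterministic
  comparison \<open>hclose_walk_grid\<close> applies: \<open>W\<close> that the walk leaves a tube
  around its drift, \<open>S\<close> that the small gaps add up to too much, \<open>P\<close> that
  two big gaps are close together, \<open>Q\<close> that a big gap lies just left of the origin. The
  factor \<open>c\<close> will be 1 or -1, the latter for a reflected medium.\<close>

lemma walk_close_to_grid:
  fixes \<zeta> :: "int \<Rightarrow> 'a \<Rightarrow> real" and \<xi> :: "nat \<Rightarrow> 'a \<Rightarrow> int"
  assumes M: "prob_space M" and \<beta>: "0 < \<beta>" "\<beta> < 1" and \<mu>: "\<mu> > 0"
    and \<zeta>: "iid M borel \<zeta> UNIV" and pos: "\<And>i. AE x in M. 0 < \<zeta> i x"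
    and C: "C > 0" "\<And>u. u > 0 \<Longrightarrow> measure (distr M borel (\<zeta> 1)) {u<..} \<le> C * u powr (- \<beta>)"
    and \<xi>: "\<And>i. i \<ge> 1 \<Longrightarrow> (\<lambda>x. real_of_int (\<xi> i x)) \<in> borel_measurable M"
    and weak_law: "\<And>T \<eta>. T > 0 \<Longrightarrow> \<eta> > 0 \<Longrightarrow> (\<lambda>n. measure M {x \<in> space M. \<exists>j. real j \<le> T * real n \<and>
        \<bar>(\<Sum>i=1..j. real_of_int (\<xi> i x)) - \<mu> * real j\<bar> > \<eta> * real n}) \<longlonglongrightarrow> 0"
    and d: "d > 0" and e: "e > 0"
  obtains m0 :: nat where "m0 \<ge> 1" "\<And>m. m \<ge> m0 \<Longrightarrow> \<forall>\<^sub>F n in sequentially. measure M {x \<in> space M.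
      d \<le> dist (graph_dist (walk_path \<beta> c \<zeta> \<xi> n x))
        (graph_dist (grid_path \<beta> c \<mu> \<zeta> m n x))} \<le> e"
proof -
  interpret prob_space M by fact
  let ?\<nu> = "distr M borel (\<zeta> 1)"
  have \<zeta>m: "\<zeta> i \<in> borel_measurable M" for i using \<zeta> unfolding iid_def indep_vars_def by blast
  define w where "w p x = gap (\<lambda>i. \<zeta> i x) p" for p x
  have w_ind: "indep_vars (\<lambda>_. borel) w UNIV" and w_law: "distr M borel (w p) = ?\<nu>" for p
    using distr_gap_medium[OF M \<zeta>] unfolding w_def by blast+
  have wm: "w p \<in> borel_measurable M" for p using w_ind unfolding indep_vars_def by blast
  have w_pos: "AE x in M. 0 \<le> w p x" for p
    unfolding w_def gap_def using pos[of "if p \<ge> 0 then p + 1 else p"] by eventually_elim simp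
  have "real_distribution ?\<nu>" using \<zeta>m by (rule real_distribution_distr)
  then obtain B where B: "B > 0" "\<And>v. v > 0 \<Longrightarrow> (\<integral>y. indicator {0<..v} y * y \<partial>?\<nu>) \<le> B * v powr (1 - \<beta>)"
    using truncated_mean_bound[OF _ \<beta>(2) C] by blast
  obtain T \<rho> where T: "T > 0" and \<rho>: "\<rho> > 0" and close: "\<And>f g. hclose T \<rho> f g \<Longrightarrow> dist (graph_dist f) (graph_dist g) < d"
    using hclose_imp_graph_dist_close[OF d] by metis
  \<comment> \<open>\<open>n * \<Lambda>\<close> bounds the number of relevant sites on either side
    of the origin; the summand 1 absorbs the ceiling in \<open>L\<close>.\<close>
  define \<Lambda> where "\<Lambda> = \<mu> * (T + 2) + 1"
  have \<Lambda>: "\<Lambda> > 1" using \<mu> T by (simp add: \<Lambda>_def)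
  define \<delta> where "\<delta> = \<rho> / (\<bar>c\<bar> + 1)"
  have \<delta>: "\<delta> > 0" "\<bar>c\<bar> * \<delta> \<le> \<rho>" using \<rho> by (auto simp: \<delta>_def field_simps)
  \<comment> \<open>Solves \<open>2 * n * \<Lambda> * B * (\<theta> * q) powr (1 - \<beta>) = e / 4
    * (\<delta> * q)\<close> with \<open>q = n powr (1 / \<beta>)\<close>. Here \<open>n\<close>
    cancels because \<open>q powr (- \<beta>) = 1 / n\<close>.\<close>
  define \<theta> where "\<theta> = (e * \<delta> / (8 * \<Lambda> * B)) powr (1 / (1 - \<beta>))"
  have pp: "u > 0 \<Longrightarrow> (u powr (1 / (1 - \<beta>))) powr (1 - \<beta>) = u" for u :: real
    using \<beta> by (simp add: powr_powr)
  have "e * \<delta> / (8 * \<Lambda> * B) > 0" using e \<delta> \<Lambda> B by simp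
  then have \<theta>: "\<theta> > 0" "\<theta> powr (1 - \<beta>) = e * \<delta> / (8 * \<Lambda> * B)"
    unfolding \<theta>_def using pp by (simp_all only: powr_gt_zero)
  define E where "E = C * \<theta> powr (- \<beta>)"
  have E: "E > 0" using C \<theta> by (simp add: E_def)
  \<comment> \<open>The three thresholds control, in turn, the probability of two big gaps close
    together, that of a big gap just left of the origin, and the time width \<open>2 / m\<close> of
    two blocks.\<close>
  define m0 where "m0 = nat \<lceil>max (max (16 * \<Lambda> * \<mu> * E\<^sup>2 / e) (4 * \<mu> * E / e)) (4 / \<rho>)\<rceil> + 1"
  have m0: "m \<ge> m0 \<Longrightarrow> 16 * \<Lambda> * \<mu> * E\<^sup>2 / e \<le> real m \<and> 4 * \<mu> * E / e \<le> real m \<and> 4 / \<rho> \<le> real m" for m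
    unfolding m0_def by linarith
  show ?thesis
  proof (rule that[of m0])
    show "m0 \<ge> 1" by (simp add: m0_def)
    fix m assume "m \<ge> m0"
    then have m: "m \<ge> 1" "16 * \<Lambda> * \<mu> * E\<^sup>2 / e \<le> real m" "4 * \<mu> * E / e \<le> real m" "4 / \<rho> \<le> real m"
      using m0[of m] by (auto simp: m0_def)
    \<comment> \<open>The tolerance \<open>\<eta> * n\<close> is an eighth of the real block length,
      so that with one mean step and the rounding of \<open>b\<close> it stays below half a block
      for large \<open>n\<close>.\<close>
    define \<eta> where "\<eta> = \<mu> / (8 * real m)"
    have \<eta>: "\<eta> > 0" using \<mu> m by (simp add: \<eta>_def)
    define W where "W n = {x \<in> space M. \<exists>j. real j \<le> (T + 1) * real n \<and>
        \<bar>(\<Sum>i=1..j. real_of_int (\<xi> i x)) - \<mu> * real j\<bar> > \<eta> * real n}" for n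
    have Wm: "W n \<in> events" for n
    proof -
      have [measurable]: "(\<lambda>x. \<Sum>i=1..j. real_of_int (\<xi> i x)) \<in> borel_measurable M" for j
        by (intro borel_measurable_sum \<xi>) auto
      show ?thesis unfolding W_def by measurable
    qed
    have "(\<lambda>n. prob (W n)) \<longlonglongrightarrow> 0" unfolding W_def by (rule weak_law) (use T \<eta> in auto)
    then have "\<forall>\<^sub>F n in sequentially. prob (W n) < e / 4" by (rule order_tendstoD) (use e in simp)
    \<comment> \<open>The first bound makes \<open>8 * (\<mu> + 1)\<close> at most three block
      lengths, whence \<open>b \<ge> 1\<close> and the half-block condition; the second keeps the
      accumulated rounding below \<open>\<rho> / 2\<close>.\<close>
    moreover have "\<forall>\<^sub>F n in sequentially. max (max (8 * real m * (\<mu> + 1) / (3 * \<mu>)) (2 * (2 * real m * T + 2) / (\<rho> * \<mu>))) 1 \<le> real n"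
      using filterlim_real_sequentially unfolding filterlim_at_top by blast
    ultimately show "\<forall>\<^sub>F n in sequentially. prob {x \<in> space M.
      d \<le> dist (graph_dist (walk_path \<beta> c \<zeta> \<xi> n x))
        (graph_dist (grid_path \<beta> c \<mu> \<zeta> m n x))} \<le> e"
    proof eventually_elim
      case (elim n)
      then have n: "real n \<ge> 8 * real m * (\<mu> + 1) / (3 * \<mu>)" "real n \<ge> 2 * (2 * real m * T + 2) / (\<rho> * \<mu>)" "n \<ge> 1"
        by auto
      define q where "q = real n powr (1 / \<beta>)"
      have q: "q > 0" using n by (simp add: q_def)
      have q\<beta>: "q powr (- \<beta>) = 1 / real n" proof -
        have "1 / \<beta> * - \<beta> = -1" using \<beta> by simp
        then show ?thesis using n(3) by (simp only: q_def powr_powr) (simp add: powr_neg_one)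
      qed
      define b where "b = \<lfloor>real n * \<mu> / real m\<rfloor>"
      define y where "y = real n * \<mu> / real m"
      have b_eq: "b = \<lfloor>y\<rfloor>" by (simp only: b_def y_def)
      have bR: "real_of_int b \<le> y" "y < real_of_int b + 1" unfolding b_eq by linarith+
      have nm: "8 * (\<mu> + 1) \<le> 3 * y"
      proof -
        have "8 * real m * (\<mu> + 1) \<le> real n * (3 * \<mu>)"
          using n(1) \<mu> pos_divide_le_eq[of "3 * \<mu>"] by simp
        then have "(8 * (\<mu> + 1)) * m \<le> 3 * (real n * \<mu>)" by (simp only: mult_ac)
        then have "8 * (\<mu> + 1) \<le> 3 * (real n * \<mu>) / m" using m(1) pos_le_divide_eq[of "real m"] by simp
        then show ?thesis by (simp add: y_def)
      qed
      have "real_of_int b > 1" using nm bR \<mu> by argo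
      then have b1: "b \<ge> 1" by simp
      have \<kappa>: "\<eta> * real n + \<mu> \<le> of_int b / 2"
      proof -
        have "\<eta> * real n = y / 8" by (simp add: \<eta>_def y_def mult_ac)
        then show ?thesis using nm bR \<mu> by argo
      qed
      define L where "L = \<lceil>real n * \<mu> * (T + 2)\<rceil>"
      have L: "real n * \<mu> * (T + 2) \<le> of_int L" "of_int L \<le> real n * \<Lambda>"
      proof -
        show "real n * \<mu> * (T + 2) \<le> of_int L" unfolding L_def by linarith
        have "real n * \<Lambda> = real n * \<mu> * (T + 2) + real n" by (simp add: \<Lambda>_def algebra_simps)
        moreover have "of_int L \<le> real n * \<mu> * (T + 2) + 1" unfolding L_def by linarith
        ultimately show "of_int L \<le> real n * \<Lambda>" using n(3) by linarith
      qed
      have "0 \<le> real n * \<mu> * (T + 2)" using \<mu> T by simp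
      then have "0 \<le> real_of_int L" using L(1) by linarith
      then have L0: "L \<ge> 0" by simp
      have cD: "real (card {-L..<L}) \<le> 2 * (real n * \<Lambda>)" using L L0 by simp
      have \<theta>q: "\<theta> * q > 0" using \<theta> q by simp
      let ?p = "measure ?\<nu> {\<theta> * q<..}"
      have p: "?p \<le> E / real n"
        using C(2)[OF \<theta>q] \<theta> q by (simp add: powr_mult q\<beta> E_def)
      define S where "S = {x \<in> space M. \<delta> * q < (\<Sum>i\<in>{-L..<L}. if w i x \<le> \<theta> * q then w i x else 0)}"
      define P where "P = {x \<in> space M. \<exists>i\<in>{-L..<L}. \<exists>j\<in>{-L..<L}. i < j \<and> j < i + 2 * b \<and> \<theta> * q < w i x \<and> \<theta> * q < w j x}"
      define Q where "Q = {x \<in> space M. \<exists>i\<in>{-b..<0}. \<theta> * q < w i x}"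
      let ?I = "\<integral>y. indicator {0<..\<theta> * q} y * y \<partial>?\<nu>"
      have S: "S \<in> events" "prob S \<le> e / 4"
      proof -
        note * = prob_small_part_sum[of "{-L..<L}" w ?\<nu> "\<delta> * q" "\<theta> * q"]
        have ineq: "prob S \<le> card {-L..<L} * ?I / (\<delta> * q)" and "S \<in> events"
          unfolding S_def using * wm w_law w_pos \<delta> q \<theta>q by auto
        then show "S \<in> events" by simp
        have "?I \<le> B * (\<theta> * q) powr (1 - \<beta>)" by (rule B(2)[OF \<theta>q])
        also have "(\<theta> * q) powr (1 - \<beta>) = \<theta> powr (1 - \<beta>) * q powr (1 - \<beta>)"
          using \<theta>(1) q by (simp add: powr_mult)
        also have "q powr (1 - \<beta>) = q * q powr (- \<beta>)"
          using q by (simp add: powr_diff powr_minus divide_inverse)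
        also have "B * (\<theta> powr (1 - \<beta>) * (q * q powr (- \<beta>))) = B * (e * \<delta> / (8 * \<Lambda> * B)) * (q * q powr (- \<beta>))"
          by (simp only: \<theta>(2) mult.assoc)
        also have "\<dots> = e * \<delta> * q / (8 * \<Lambda> * n)" using B \<Lambda> n(3) by (simp add: q\<beta> field_simps)
        finally have "real (card {-L..<L}) * ?I \<le> (2 * (real n * \<Lambda>)) * (e * \<delta> * q / (8 * \<Lambda> * n))"
          using cD e \<delta> q \<Lambda> by (intro mult_mono) (auto intro!: integral_nonneg_AE AE_I2 simp: indicator_def)
        also have "\<dots> = e / 4 * (\<delta> * q)" using \<Lambda> n(3) by (simp add: field_simps)
        finally have "real (card {-L..<L}) * ?I / (\<delta> * q) \<le> e / 4"
          using \<delta> q by (subst pos_divide_le_eq) auto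
        then show "prob S \<le> e / 4" using ineq by linarith
      qed
      have P: "P \<in> events" "prob P \<le> e / 4"
      proof -
        show "P \<in> events" unfolding P_def
          by (rule prob_two_close_big(1)[OF w_ind w_law]) (use b1 in simp_all)
        have ineq: "prob P \<le> real (card {-L..<L}) * (2 * real_of_int b) * ?p\<^sup>2" unfolding P_def
          by (rule prob_two_close_big(2)[OF w_ind w_law]) (use b1 in simp_all)
        have "real (card {-L..<L}) * (2 * real_of_int b) * ?p\<^sup>2 \<le> (2 * (real n * \<Lambda>)) * (2 * y) * (E / n)\<^sup>2"
          using cD bR(1) p b1 \<Lambda> by (intro mult_mono power_mono) auto
        also have "\<dots> = 4 * \<Lambda> * \<mu> * E\<^sup>2 / m" using n(3) m(1) by (simp add: power2_eq_square y_def field_simps)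
        also have "\<dots> \<le> e / 4" using m(1,2) e by (simp add: field_simps)
        finally show "prob P \<le> e / 4" using ineq by linarith
      qed
      have Q: "Q \<in> events" "prob Q \<le> e / 4"
      proof -
        show "Q \<in> events" unfolding Q_def by (rule prob_exists_big(1)[OF wm w_law]) simp
        have ineq: "prob Q \<le> real (card {-b..<0}) * ?p"
          unfolding Q_def by (rule prob_exists_big(2)[OF wm w_law]) simp
        have "real (card {-b..<0}) * ?p \<le> y * (E / n)"
          using bR(1) p b1 by (intro mult_mono) auto
        also have "\<dots> = \<mu> * E / m" using n(3) m(1) by (simp add: y_def field_simps)
        also have "\<dots> \<le> e / 4" using m(1,3) e by (simp add: field_simps)
        finally show "prob Q \<le> e / 4" using ineq by linarith
      qed
      have \<rho>1: "(2 * real m * T + 2) / (real n * \<mu>) + 2 / real m \<le> \<rho>"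
      proof -
        have "2 / real m \<le> \<rho> / 2" using m(1,4) \<rho> by (simp add: field_simps)
        moreover have "(2 * real m * T + 2) / (real n * \<mu>) \<le> \<rho> / 2"
          using n(2,3) \<rho> \<mu> by (simp add: field_simps)
        ultimately show ?thesis by linarith
      qed
      let ?bad = "{x \<in> space M. d \<le> dist (graph_dist (step_fun (real n) (\<lambda>j. c / q * medium (\<lambda>i. \<zeta> i x) (walk (\<lambda>i. \<xi> i x) j))))
        (graph_dist (step_fun (real m) (\<lambda>k. c / q * medium (\<lambda>i. \<zeta> i x) (b * int k))))}"
      have "AE x in M. \<forall>p. 0 \<le> w p x" unfolding AE_all_countable using w_pos by blast
      then have "AE x in M. x \<in> ?bad \<longrightarrow> x \<in> (W n \<union> S) \<union> (P \<union> Q)"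
      proof eventually_elim
        case (elim x)
        show ?case
        proof (intro impI, rule ccontr)
          assume x: "x \<in> ?bad" and not: "x \<notin> (W n \<union> S) \<union> (P \<union> Q)"
          have xM: "x \<in> space M" using x by blast
          have "hclose T \<rho> (step_fun (real n) (\<lambda>j. c / q * medium (\<lambda>i. \<zeta> i x) (walk (\<lambda>i. \<xi> i x) j)))
            (step_fun (real m) (\<lambda>k. c / q * medium (\<lambda>i. \<zeta> i x) (b * int k)))"
          proof (rule hclose_walk_grid[OF n(3) m(1) \<mu> less_imp_le[OF T] b_def b1 L(1) _ _ \<kappa> _ _ _ _ \<rho>1])
            show "walk (\<lambda>i. \<xi> i x) 0 = 0" by (simp add: walk_def)
            show "\<bar>of_int (walk (\<lambda>i. \<xi> i x) j) - \<mu> * real j\<bar> \<le> \<eta> * real n" if "real j \<le> (T + 1) * real n" for j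
              using not xM that unfolding W_def walk_def by (auto simp: not_less)
            show "0 \<le> gap (\<lambda>i. \<zeta> i x) i" for i using elim by (simp add: w_def)
            show "gap (\<lambda>i. \<zeta> i x) i \<le> \<theta> * q" if "i \<in> {-b..<0}" for i
              using not xM that unfolding Q_def w_def by (auto simp: not_less)
            show "gap (\<lambda>i. \<zeta> i x) i \<le> \<theta> * q \<or> gap (\<lambda>i. \<zeta> i x) j \<le> \<theta> * q"
              if "i \<in> {-L..<L}" "j \<in> {-L..<L}" "i < j" "j < i + 2 * b" for i j
              using not xM that unfolding P_def w_def by (metis (mono_tags, lifting) UnCI mem_Collect_eq not_le)
            show "(\<Sum>i\<in>{-L..<L}. if gap (\<lambda>i. \<zeta> i x) i \<le> \<theta> * q then gap (\<lambda>i. \<zeta> i x) i else 0) \<le> \<delta> * q"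
              using not xM unfolding S_def w_def by (simp add: not_less)
            show "\<bar>c / q\<bar> * (\<delta> * q) \<le> \<rho>" using \<delta> q by (simp add: abs_divide)
          qed
          then show False using close x by fastforce
        qed
      qed
      then have "prob ?bad \<le> prob ((W n \<union> S) \<union> (P \<union> Q))"
        using Wm S P Q by (intro finite_measure_mono_AE) auto
      also have "\<dots> \<le> prob (W n \<union> S) + prob (P \<union> Q)" using Wm S P Q by (intro measure_Un_le) auto
      also have "prob (W n \<union> S) \<le> prob (W n) + prob S" using Wm S by (intro measure_Un_le) auto
      also have "prob (P \<union> Q) \<le> prob P + prob Q" using P Q by (intro measure_Un_le) auto
      finally have "prob ?bad \<le> e" using elim S P Q by linarith
      then show ?case by (simp only: q_def b_def)
    qed
  qed
qed

section \<open>Limit along the grid\<close>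

lemma step_functional_tendsto:
  assumes "continuous_on UNIV H" "r \<longlonglongrightarrow> r'" "\<And>k. (\<lambda>n. x n k) \<longlonglongrightarrow> x' k"
  shows "(\<lambda>n. H (graph_dist (step_fun R (\<lambda>k. r n * (\<Sum>j<k. x n j)))))
    \<longlonglongrightarrow> H (graph_dist (step_fun R (\<lambda>k. r' * (\<Sum>j<k. x' j))))"
proof -
  have "(\<lambda>n. graph_dist (step_fun R (\<lambda>k. r n * (\<Sum>j<k. x n j))))
    \<longlonglongrightarrow> graph_dist (step_fun R (\<lambda>k. r' * (\<Sum>j<k. x' j)))"
    by (intro graph_dist_step_fun_tendsto tendsto_intros assms)
  then show ?thesis by (rule continuous_on_tendsto_compose[OF assms(1)]) auto
qed

lemma step_functional_measurable:
  fixes H :: "(rat \<times> rat \<Rightarrow> real) \<Rightarrow> real"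
  assumes H: "continuous_on UNIV H"
  shows "(\<lambda>x. H (graph_dist (step_fun R (\<lambda>k. r * (\<Sum>j<k. x j))))) \<in> borel_measurable borel"
proof (rule borel_measurable_continuous_onI)
  show "continuous_on UNIV (\<lambda>x. H (graph_dist (step_fun R (\<lambda>k. r * (\<Sum>j<k. x j)))))"
    unfolding continuous_on_sequentially
  proof safe
    fix x :: "nat \<Rightarrow> nat \<Rightarrow> real" and a assume "x \<longlonglongrightarrow> a"
    then have "(\<lambda>n. x n k) \<longlonglongrightarrow> a k" for k by (simp add: tendsto_fun_iff)
    from step_functional_tendsto[OF H tendsto_const this]
    show "((\<lambda>x. H (graph_dist (step_fun R (\<lambda>k. r * (\<Sum>j<k. x j))))) \<circ> x)
      \<longlonglongrightarrow> H (graph_dist (step_fun R (\<lambda>k. r * (\<Sum>j<k. a j))))"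
      by (simp add: comp_def)
  qed
qed

lemma Lipschitz_continuous_on:
  fixes H :: "'d::metric_space \<Rightarrow> real"
  assumes "\<And>u v. \<bar>H u - H v\<bar> \<le> L * dist u v"
  shows "continuous_on UNIV H"
proof -
  have le: "L * dist u v \<le> \<bar>L\<bar> * dist u v" for u v :: 'd by (intro mult_right_mono) auto
  then have "\<bar>L\<bar>-lipschitz_on UNIV H"
    using order_trans[OF assms le] by (intro lipschitz_onI) (auto simp: dist_real_def)
  then show ?thesis by (rule lipschitz_on_continuous_on)
qed

lemma medium_block_sum:
  "medium z (int (b * k)) = (\<Sum>j<k. \<Sum>p\<in>{int (b * j)..<int (b * Suc j)}. gap z p)"
proof (induction k)
  case (Suc k)
  have "medium z (int (b * Suc k)) - medium z (int (b * k)) = (\<Sum>p\<in>{int (b * k)..<int (b * Suc k)}. gap z p)"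
    by (rule medium_diff) simp
  with Suc show ?case by simp
qed (simp add: medium_def)

lemma floor_ratio_limits:
  fixes \<gamma> :: real
  assumes "\<gamma> > 0"
  shows "filterlim (\<lambda>n. nat \<lfloor>real n * \<gamma>\<rfloor>) sequentially sequentially"
    and "(\<lambda>n. real (nat \<lfloor>real n * \<gamma>\<rfloor>) / real n) \<longlonglongrightarrow> \<gamma>"
proof -
  have r: "real n * \<gamma> - 1 \<le> real (nat \<lfloor>real n * \<gamma>\<rfloor>) \<and> real (nat \<lfloor>real n * \<gamma>\<rfloor>) \<le> real n * \<gamma>" for n
  proof -
    have "real (nat \<lfloor>real n * \<gamma>\<rfloor>) = of_int \<lfloor>real n * \<gamma>\<rfloor>" using assms by simp
    then show ?thesis by linarith
  qed
  have "filterlim (\<lambda>n. - 1 + real n * \<gamma>) at_top sequentially"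
    by (intro filterlim_tendsto_add_at_top[OF tendsto_const]
      filterlim_at_top_mult_tendsto_pos[OF tendsto_const assms] filterlim_real_sequentially)
  then have "filterlim (\<lambda>n. real (nat \<lfloor>real n * \<gamma>\<rfloor>)) at_top sequentially"
    by (rule filterlim_at_top_mono) (use r in \<open>auto intro!: always_eventually simp: algebra_simps\<close>)
  then show "filterlim (\<lambda>n. nat \<lfloor>real n * \<gamma>\<rfloor>) sequentially sequentially"
    by (simp add: filterlim_sequentially_iff_filterlim_real)
  show "(\<lambda>n. real (nat \<lfloor>real n * \<gamma>\<rfloor>) / real n) \<longlonglongrightarrow> \<gamma>"
  proof (rule real_tendsto_sandwich)
    show "\<forall>\<^sub>F n in sequentially. \<gamma> - 1 / real n \<le> real (nat \<lfloor>real n * \<gamma>\<rfloor>) / real n"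
      using eventually_gt_at_top[of 0]
    proof eventually_elim
      case (elim n)
      then have "\<gamma> - 1 / real n = (real n * \<gamma> - 1) / real n" by (simp add: field_simps)
      then show ?case using r[of n] by (simp only: divide_right_mono of_nat_0_le_iff)
    qed
    show "\<forall>\<^sub>F n in sequentially. real (nat \<lfloor>real n * \<gamma>\<rfloor>) / real n \<le> \<gamma>"
      using eventually_gt_at_top[of 0]
    proof eventually_elim
      case (elim n)
      then show ?case using r[of n] by (simp add: divide_le_eq mult.commute)
    qed
    show "(\<lambda>n. \<gamma> - 1 / real n) \<longlonglongrightarrow> \<gamma>"
      using tendsto_diff[OF tendsto_const lim_1_over_n, of \<gamma>] by simp
  qed simp
qed

lemma iid_nat_part:
  fixes \<zeta> :: "int \<Rightarrow> 'a \<Rightarrow> real"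
  assumes "prob_space M" and \<zeta>: "iid M borel \<zeta> UNIV"
  shows "prob_space.indep_vars M (\<lambda>_. borel) (\<lambda>i. \<zeta> (int i)) A"
    and "distr M borel (\<zeta> i) = distr M borel (\<zeta> 1)"
proof -
  interpret prob_space M by fact
  have ind: "indep_vars (\<lambda>_. borel) \<zeta> UNIV" and law: "distr M borel (\<zeta> i) = distr M borel (\<zeta> 1)" for i
    using \<zeta> unfolding iid_def by blast+
  show "indep_vars (\<lambda>_. borel) (\<lambda>i. \<zeta> (int i)) A"
    by (rule indep_vars_inj_reindex[OF ind]) (auto simp: inj_on_def)
  show "distr M borel (\<zeta> i) = distr M borel (\<zeta> 1)" by (rule law)
qed

text \<open>For fixed \<open>m\<close> both paths are the same functional of an i.i.d. sequence. On
  the grid these are normalized sums over blocks of length \<open>b n\<close>, with the factor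
  \<open>r n\<close> converging; on the other side they are the increments of \<open>Z\<close> over
  intervals of length \<open>1 / m\<close>, which have the law \<open>Z1\<close> once multiplied by
  \<open>m powr (1 / \<beta>)\<close>.\<close>

lemma grid_limit:
  fixes \<zeta> :: "int \<Rightarrow> 'a \<Rightarrow> real" and Z :: "real \<Rightarrow> 'b \<Rightarrow> real" and H :: "(rat \<times> rat \<Rightarrow> real) \<Rightarrow> real"
  assumes M: "prob_space M" and \<beta>: "0 < \<beta>" and \<mu>: "\<mu> > 0"
    and \<zeta>: "iid M borel \<zeta> UNIV" and Z1: "stable_law \<beta> 1 Z1"
    and att: "normally_attracted M (\<lambda>i. \<zeta> (int i)) \<beta> 0 Z1"
    and Z: "cadlag_levy_process N Z" "distr N borel (Z 1) = Z1" and m: "m \<ge> 1"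
    and H: "continuous_on UNIV H" "\<And>u. \<bar>H u\<bar> \<le> C"
  shows "(\<lambda>n. \<integral>x. H (graph_dist (grid_path \<beta> c \<mu> \<zeta> m n x)) \<partial>M)
    \<longlonglongrightarrow> (\<integral>y. H (graph_dist (levy_grid_path \<beta> c \<mu> Z m y)) \<partial>N)"
proof -
  interpret prob_space M by fact
  interpret N: prob_space N using Z by (simp add: cadlag_levy_process_def)
  interpret Z1: real_distribution Z1 using Z1 by (simp add: stable_law_def)
  have mr: "real m > 0" using m by simp
  note nat_part = iid_nat_part[OF M \<zeta>]
  define w where "w p x = gap (\<lambda>i. \<zeta> i x) p" for p x
  have w_ind: "indep_vars (\<lambda>_. borel) w UNIV" and w_law: "distr M borel (w p) = distr M borel (\<zeta> 1)" for p
    using distr_gap_medium[OF M \<zeta>] unfolding w_def by blast+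
  define D where "D j = distr M borel (\<lambda>x. (\<Sum>i\<in>{1..j}. \<zeta> (int i) x) * real j powr (- 1 / \<beta>))" for j
  have \<zeta>m: "\<zeta> i \<in> borel_measurable M" for i using \<zeta> unfolding iid_def indep_vars_def by blast
  have rD: "real_distribution (D j)" for j
    unfolding D_def by (intro real_distribution_distr borel_measurable_times borel_measurable_sum \<zeta>m) simp
  have "weak_conv_m D Z1"
    using att unfolding normally_attracted_def D_def by (simp add: powr_minus divide_inverse)
  define b where "b n = nat \<lfloor>real n * (\<mu> / real m)\<rfloor>" for n
  have b_int: "int (b n) = \<lfloor>real n * \<mu> / real m\<rfloor>" for n using \<mu> by (simp add: b_def)
  note b_lim = floor_ratio_limits[of "\<mu> / real m", folded b_def]
  have \<mu>m: "\<mu> / real m > 0" using \<mu> mr by simp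
  \<comment> \<open>The block length tends to infinity, so the limit theorem holds for the sum over
    one block.\<close>
  have wD: "weak_conv_m (\<lambda>n. D (b n)) Z1"
    unfolding weak_conv_m_def weak_conv_def
  proof (intro allI impI)
    fix x assume "isCont (cdf Z1) x"
    then have "(\<lambda>n. cdf (D n) x) \<longlonglongrightarrow> cdf Z1 x"
      using \<open>weak_conv_m D Z1\<close> by (simp add: weak_conv_m_def weak_conv_def)
    then show "(\<lambda>n. cdf (D (b n)) x) \<longlonglongrightarrow> cdf Z1 x"
      using b_lim(1)[OF \<mu>m] by (rule filterlim_compose)
  qed
  let ?\<kappa> = "c * (\<mu> / real m) powr (1 / \<beta>)"
  define r where "r n = c * (real (b n) / real n) powr (1 / \<beta>)" for n
  have r: "r \<longlonglongrightarrow> ?\<kappa>"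
    unfolding r_def using \<mu>m \<beta> by (intro tendsto_intros b_lim(2)) auto
  let ?F = "\<lambda>\<rho> x. H (graph_dist (step_fun (real m) (\<lambda>k. \<rho> * (\<Sum>j<k. x j))))"
  have Fm: "?F \<rho> \<in> borel_measurable borel" for \<rho> by (rule step_functional_measurable[OF H(1)])
  have lim: "(\<lambda>n. \<integral>x. ?F (r n) x \<partial>Pi\<^sub>M UNIV (\<lambda>_. D (b n))) \<longlonglongrightarrow>
      (\<integral>x. ?F ?\<kappa> x \<partial>Pi\<^sub>M UNIV (\<lambda>_. Z1))"
    by (rule weak_conv_iid_sequences[OF rD Z1.real_distribution_axioms wD Fm Fm H(2)])
       (rule step_functional_tendsto[OF H(1) r])
  define K where "K n j = {int (b n * j)..<int (b n * Suc j)}" for n j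
  define X where "X n j x = (\<Sum>p\<in>K n j. w p x) * real (b n) powr (- 1 / \<beta>)" for n j x
  have Kdisj: "disjoint_family_on (K n) UNIV" for n
    unfolding disjoint_family_on_def
  proof (intro ballI impI)
    fix i j :: nat assume "i \<noteq> j"
    then have "Suc i \<le> j \<or> Suc j \<le> i" by linarith
    then have "b n * Suc i \<le> b n * j \<or> b n * Suc j \<le> b n * i" by (metis mult_le_mono2)
    then have "int (b n * Suc i) \<le> int (b n * j) \<or> int (b n * Suc j) \<le> int (b n * i)" by linarith
    then show "K n i \<inter> K n j = {}" unfolding K_def by auto
  qed
  have X_ind: "indep_vars (\<lambda>_. borel) (X n) UNIV" for n
    unfolding X_def by (rule indep_vars_block_sums[OF w_ind]) (auto simp: Kdisj)
  have X_law: "distr M borel (X n j) = D (b n)" for n j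
    unfolding X_def D_def
  proof (rule distr_iid_sum_eq)
    show "indep_vars (\<lambda>_. borel) w (K n j)" by (rule indep_vars_subset[OF w_ind]) simp
    show "indep_vars (\<lambda>_. borel) (\<lambda>i. \<zeta> (int i)) {1..b n}" by (rule nat_part)
    show "card (K n j) = card {1..b n}" by (simp add: K_def)
  qed (rule w_law nat_part)+
  have fX: "c / real n powr (1 / \<beta>) * medium (\<lambda>i. \<zeta> i x) (\<lfloor>real n * \<mu> / real m\<rfloor> * int k) =
      r n * (\<Sum>j<k. X n j x)" for n k x
  proof -
    have "medium (\<lambda>i. \<zeta> i x) (\<lfloor>real n * \<mu> / real m\<rfloor> * int k) = (\<Sum>j<k. \<Sum>p\<in>K n j. w p x)"
      unfolding b_int[symmetric] K_def w_def by (simp only: of_nat_mult[symmetric] medium_block_sum)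
    also have "\<dots> = real (b n) powr (1 / \<beta>) * (\<Sum>j<k. X n j x)"
    \<comment> \<open>For small \<open>n\<close> the blocks are empty and both sides vanish; the
      normalization cancels only when \<open>b n\<close> is positive.\<close>
    proof (cases "b n = 0")
      case True then show ?thesis by (simp add: K_def)
    next
      case False
      then have "real (b n) powr (1 / \<beta>) * real (b n) powr (- 1 / \<beta>) = 1"
        by (simp add: powr_minus)
      then show ?thesis
        by (simp add: X_def sum_distrib_right[symmetric] sum_distrib_left mult.left_commute)
    qed
    finally show ?thesis by (simp add: r_def powr_divide)
  qed
  have Mside: "(\<integral>x. H (graph_dist (grid_path \<beta> c \<mu> \<zeta> m n x)) \<partial>M) =
      (\<integral>x. ?F (r n) x \<partial>Pi\<^sub>M UNIV (\<lambda>_. D (b n)))" for n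
    unfolding fX by (rule expectation_iid_sequence[OF X_ind X_law Fm])
  have mZ [measurable]: "t \<ge> 0 \<Longrightarrow> Z t \<in> borel_measurable N" for t using Z by (simp add: cadlag_levy_process_def)
  define I where "I k y = Z (real (Suc k) / real m) y - Z (real k / real m) y" for k y
  have I: "I = (\<lambda>k y. Z (real (Suc k) / real m) y - Z (real k / real m) y)" by (simp add: I_def fun_eq_iff)
  have I_ind: "N.indep_vars (\<lambda>_. borel) I UNIV" and I_law: "distr N borel (I k) = distr N borel (Z (1 / real m))" for k
    unfolding I using levy_increments[OF Z(1) mr] by blast+
  define X' where "X' k y = I k y * real m powr (1 / \<beta>)" for k y
  have X'_ind: "N.indep_vars (\<lambda>_. borel) X' UNIV"
    unfolding X'_def by (rule N.indep_vars_compose2[OF I_ind]) simp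
  have Im [measurable]: "I k \<in> borel_measurable N" for k unfolding I_def by simp
  have X'_law: "distr N borel (X' k) = Z1" for k
  proof -
    have "distr N borel (X' k) = distr (distr N borel (I k)) borel (\<lambda>z. z * real m powr (1 / \<beta>))"
      unfolding X'_def by (subst distr_distr) (auto simp: comp_def)
    also have "distr N borel (I k) = distr Z1 borel (\<lambda>z. z * real m powr (- 1 / \<beta>))"
      unfolding I_law using nat_part(2) m
      by (intro stable_levy_marginal[OF M nat_part(1) _ att Z1 Z]) auto
    also have "distr (distr Z1 borel (\<lambda>z. z * real m powr (- 1 / \<beta>))) borel (\<lambda>z. z * real m powr (1 / \<beta>)) =
        distr Z1 borel (\<lambda>z. z * (real m powr (- 1 / \<beta>) * real m powr (1 / \<beta>)))"
      by (subst distr_distr) (auto simp: comp_def mult.assoc)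
    also have "real m powr (- 1 / \<beta>) * real m powr (1 / \<beta>) = 1" using m by (simp add: powr_minus)
    finally show ?thesis by (simp add: distr_id2)
  qed
  have Nside: "(\<integral>x. ?F ?\<kappa> x \<partial>Pi\<^sub>M UNIV (\<lambda>_. Z1)) =
     (\<integral>y. H (graph_dist (levy_grid_path \<beta> c \<mu> Z m y)) \<partial>N)"
  proof -
    have "(\<integral>x. ?F ?\<kappa> x \<partial>Pi\<^sub>M UNIV (\<lambda>_. Z1)) =
       (\<integral>y. ?F ?\<kappa> (\<lambda>k. X' k y) \<partial>N)"
      by (rule N.expectation_iid_sequence[OF X'_ind X'_law Fm, symmetric])
    also have "\<dots> = (\<integral>y. H (graph_dist (levy_grid_path \<beta> c \<mu> Z m y)) \<partial>N)"
    proof (rule integral_cong_AE)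
      have Hm: "H \<in> borel_measurable borel" using H(1) by (rule borel_measurable_continuous_onI)
      have sm: "(\<lambda>y. H (graph_dist (step_fun (real m) (\<lambda>k. V k y)))) \<in> borel_measurable N"
        if [measurable]: "\<And>k. V k \<in> borel_measurable N" for V :: "nat \<Rightarrow> 'b \<Rightarrow> real"
      proof (rule measurable_compose[OF graph_dist_measurable Hm])
        show "(\<lambda>y. step_fun (real m) (\<lambda>k. V k y) t) \<in> borel_measurable N" if "t \<ge> 0" for t
          using that by (simp add: step_fun_def)
        show "cadlag (step_fun (real m) (\<lambda>k. V k y))" for y
          using step_fun_Dplus[of "real m" "\<lambda>k. V k y"] by (simp add: Dplus_def)
      qed
      have X'm [measurable]: "X' k \<in> borel_measurable N" for k unfolding X'_def by simp
      show "(\<lambda>y. ?F ?\<kappa> (\<lambda>k. X' k y)) \<in> borel_measurable N"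
        by (rule sm) simp
      show "(\<lambda>y. H (graph_dist (levy_grid_path \<beta> c \<mu> Z m y))) \<in> borel_measurable N"
        by (rule sm) simp
      \<comment> \<open>The partial sums of increments recover \<open>Z\<close> only up to its value
        at 0, which is 0 almost surely; so the integrands agree almost everywhere.\<close>
      have "AE y in N. Z 0 y = 0" using Z by (simp add: cadlag_levy_process_def)
      then show "AE y in N. ?F ?\<kappa> (\<lambda>k. X' k y) =
        H (graph_dist (levy_grid_path \<beta> c \<mu> Z m y))"
      proof eventually_elim
        case (elim y)
        have "?\<kappa> * (\<Sum>j<k. X' j y) = c * \<mu> powr (1 / \<beta>) * Z (real k / real m) y" for k
        proof -
          have "(\<Sum>j<k. X' j y) = (\<Sum>j<k. I j y) * real m powr (1 / \<beta>)" by (simp add: X'_def sum_distrib_right)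
          also have "(\<Sum>j<k. I j y) = Z (real k / real m) y"
            unfolding I_def using sum_lessThan_telescope[of "\<lambda>k. Z (real k / real m) y" k] elim by simp
          finally show ?thesis using \<mu> m by (simp add: powr_divide)
        qed
        then show ?case by (simp only:)
      qed
    qed
    finally show ?thesis .
  qed
  show ?thesis using lim unfolding Mside Nside .
qed

section \<open>Paths as random elements and the limit for positive drift\<close>

lemma levy_path_Dplus:
  assumes "cadlag_levy_process N Z" "y \<in> space N"
  shows "(\<lambda>t\<in>{0..}. c * Z t y) \<in> Dplus"
proof -
  have Z: "cadlag (\<lambda>t. Z t y)" using assms by (simp add: cadlag_levy_process_def)
  have "cadlag (\<lambda>t\<in>{0..}. c * Z t y)"
    unfolding cadlag_def
  proof safe
    fix t :: real assume t: "t \<ge> 0"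
    have "((\<lambda>t. c * Z t y) \<longlongrightarrow> c * Z t y) (at_right t)"
      using Z t by (intro tendsto_intros) (auto simp: cadlag_def)
    moreover have "\<forall>\<^sub>F s in at_right t. c * Z s y = (\<lambda>t\<in>{0..}. c * Z t y) s"
      using eventually_at_right_less[of t] by eventually_elim (use t in auto)
    ultimately have "((\<lambda>t\<in>{0..}. c * Z t y) \<longlongrightarrow> c * Z t y) (at_right t)" by (rule Lim_transform_eventually)
    then show "((\<lambda>t\<in>{0..}. c * Z t y) \<longlongrightarrow> (\<lambda>t\<in>{0..}. c * Z t y) t) (at_right t)" using t by simp
  next
    fix t :: real assume t: "t > 0"
    then obtain l where "((\<lambda>t. Z t y) \<longlongrightarrow> l) (at_left t)" using Z by (auto simp: cadlag_def)
    then have "((\<lambda>t. c * Z t y) \<longlongrightarrow> c * l) (at_left t)" by (intro tendsto_intros)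
    moreover have "\<forall>\<^sub>F s in at_left t. s > 0" using t by (rule order_tendstoD[OF tendsto_ident_at])
    then have "\<forall>\<^sub>F s in at_left t. c * Z s y = (\<lambda>t\<in>{0..}. c * Z t y) s" by eventually_elim auto
    ultimately have "((\<lambda>t\<in>{0..}. c * Z t y) \<longlongrightarrow> c * l) (at_left t)" by (rule Lim_transform_eventually)
    then show "\<exists>l. ((\<lambda>t\<in>{0..}. c * Z t y) \<longlongrightarrow> l) (at_left t)" by blast
  qed
  then show ?thesis by (simp add: Dplus_def)
qed

lemma step_path_graph_dist_measurable:
  assumes "\<And>k. (\<lambda>x. V k x) \<in> borel_measurable M" "r \<ge> 0"
  shows "(\<lambda>x. graph_dist (step_fun r (\<lambda>k. V k x))) \<in> borel_measurable M"
proof (rule graph_dist_measurable)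
  show "(\<lambda>x. step_fun r (\<lambda>k. V k x) t) \<in> borel_measurable M" if "t \<ge> 0" for t
    using that assms(1) by (simp add: step_fun_def)
  show "cadlag (step_fun r (\<lambda>k. V k x))" for x
    using step_fun_Dplus[OF assms(2)] by (simp add: Dplus_def)
qed

text \<open>The site is random but integer valued, so measurability reduces to fixed sites.\<close>

lemma medium_measurable:
  assumes "\<And>i. \<zeta> i \<in> borel_measurable M" and "K \<in> measurable M (count_space UNIV)"
  shows "(\<lambda>x. medium (\<lambda>i. \<zeta> i x) (K x)) \<in> borel_measurable M"
proof (rule measurable_compose_countable[OF _ assms(2)])
  fix k
  note [measurable] = assms(1)
  show "(\<lambda>x. medium (\<lambda>i. \<zeta> i x) k) \<in> borel_measurable M"
    unfolding medium_def by measurable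
qed

lemma walk_measurable:
  assumes "\<And>i. i \<ge> 1 \<Longrightarrow> \<xi> i \<in> measurable M (count_space UNIV)"
  shows "(\<lambda>x. walk (\<lambda>i. \<xi> i x) j) \<in> measurable M (count_space UNIV)"
proof (induction j)
  case (Suc j)
  have "(\<lambda>x. (case (walk (\<lambda>i. \<xi> i x) j, \<xi> (Suc j) x) of (a, b) \<Rightarrow> a + b)) \<in> measurable M (count_space UNIV)"
    by (rule measurable_compose_countable'[OF _ Suc])
       (use assms[of "Suc j"] in \<open>auto intro: measurable_compose[OF _ measurable_count_space_const] measurable_compose_countable'\<close>)
  then show ?case by (simp add: walk_def)
qed (simp add: walk_def)

lemma rw_on_medium_graph_dist_measurable:
  assumes "\<And>i. \<zeta> i \<in> borel_measurable M" "\<And>i. i \<ge> 1 \<Longrightarrow> \<xi> i \<in> measurable M (count_space UNIV)"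
  shows "(\<lambda>x. graph_dist (step_fun (real n) (\<lambda>j. c * medium (\<lambda>i. \<zeta> i x) (walk (\<lambda>i. \<xi> i x) j)))) \<in> borel_measurable M"
proof (rule step_path_graph_dist_measurable)
  show "(\<lambda>x. c * medium (\<lambda>i. \<zeta> i x) (walk (\<lambda>i. \<xi> i x) k)) \<in> borel_measurable M" for k
    by (intro borel_measurable_times borel_measurable_const medium_measurable[OF assms(1)] walk_measurable assms(2))
qed simp

text \<open>A converging-together argument: the grid path is close in probability to the walk path
  for all large \<open>n\<close>, it converges in distribution for fixed \<open>m\<close>, and its
  limits converge as the grid is refined. Hence \<open>m\<close> is fixed first, and
  \<open>n\<close> tends to infinity afterwards.\<close>

lemma positive_drift_limit:
  fixes \<zeta> :: "int \<Rightarrow> 'a \<Rightarrow> real" and \<xi> :: "nat \<Rightarrow> 'a \<Rightarrow> int" and Z :: "real \<Rightarrow> 'b \<Rightarrow> real"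
    and H :: "(rat \<times> rat \<Rightarrow> real) \<Rightarrow> real"
  assumes M: "prob_space M" and \<beta>: "0 < \<beta>" "\<beta> < 1" and \<mu>: "\<mu> > 0"
    and \<zeta>: "iid M borel \<zeta> UNIV" and pos: "\<And>i. AE x in M. 0 < \<zeta> i x"
    and Z1: "stable_law \<beta> 1 Z1" and att: "normally_attracted M (\<lambda>i. \<zeta> (int i)) \<beta> 0 Z1"
    and \<xi>: "iid M (count_space UNIV) \<xi> {1..}" and int: "integrable M (\<lambda>x. real_of_int (\<xi> 1 x))"
    and \<mu>_eq: "\<mu> = (\<integral>x. real_of_int (\<xi> 1 x) \<partial>M)"
    and Z: "cadlag_levy_process N Z" "distr N borel (Z 1) = Z1"
    and H: "\<And>u. \<bar>H u\<bar> \<le> C" "\<And>u v. \<bar>H u - H v\<bar> \<le> L * dist u v"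
  shows "(\<lambda>n. \<integral>x. H (graph_dist (walk_path \<beta> c \<zeta> \<xi> n x)) \<partial>M)
    \<longlonglongrightarrow> (\<integral>y. H (graph_dist (\<lambda>t\<in>{0..}. c * \<mu> powr (1 / \<beta>) * Z t y)) \<partial>N)"
proof -
  interpret prob_space M by fact
  interpret N: prob_space N using Z by (simp add: cadlag_levy_process_def)
  have \<zeta>m: "\<zeta> i \<in> borel_measurable M" for i using \<zeta> unfolding iid_def indep_vars_def by blast
  have \<xi>m: "\<xi> i \<in> measurable M (count_space UNIV)" if "i \<ge> 1" for i
    using \<xi> that unfolding iid_def indep_vars_def by blast
  have rZ1: "real_distribution Z1" using Z1 by (simp add: stable_law_def)
  have \<zeta>0: "AE x in M. 0 \<le> \<zeta> (int i) x" for i using pos[of "int i"] by eventually_elim simp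
  obtain B where B: "B > 0" "\<And>u. u > 0 \<Longrightarrow> measure (distr M borel (\<zeta> 1)) {u<..} \<le> B * u powr (- \<beta>)"
    using attracted_tail_bound[OF M iid_nat_part(1)[OF M \<zeta>] _ \<zeta>0 att rZ1 \<beta>(1), of "distr M borel (\<zeta> 1)"]
      iid_nat_part(2)[OF M \<zeta>] by blast
  let ?X = "\<lambda>i x. real_of_int (\<xi> i x)"
  have rm: "real_of_int \<in> measurable (count_space UNIV) borel" by simp
  have X_ind: "indep_vars (\<lambda>_. borel) ?X {1..}"
    by (rule indep_vars_compose2[where M' = "\<lambda>_. count_space UNIV"]) (use \<xi> in \<open>auto simp: iid_def\<close>)
  have Xm: "?X i \<in> borel_measurable M" if "i \<ge> 1" for i using measurable_compose[OF \<xi>m[OF that] rm] .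
  have X_law: "distr M borel (?X i) = distr M borel (?X 1)" if "i \<ge> 1" for i
  proof -
    have "distr M borel (?X k) = distr (distr M (count_space UNIV) (\<xi> k)) borel real_of_int" if "k \<ge> 1" for k
      using \<xi>m[OF that] by (subst distr_distr) (auto simp: comp_def)
    moreover have "distr M (count_space UNIV) (\<xi> i) = distr M (count_space UNIV) (\<xi> 1)"
      using \<xi> that unfolding iid_def by (meson atLeast_iff order_refl)
    ultimately show ?thesis using that by simp
  qed
  have weak_law: "(\<lambda>n. prob {x \<in> space M. \<exists>j. real j \<le> T * real n \<and>
      \<bar>(\<Sum>i=1..j. real_of_int (\<xi> i x)) - \<mu> * real j\<bar> > \<eta> * real n}) \<longlonglongrightarrow> 0" if "T > 0" "\<eta> > 0" for T \<eta>
  proof (rule uniform_weak_law[OF M X_ind X_law _ _ that])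
    show "integrable (distr M borel (?X 1)) (\<lambda>y. y)" using int Xm[of 1] by (subst integrable_distr_eq) auto
    show "\<mu> = (\<integral>y. y \<partial>distr M borel (?X 1))" unfolding \<mu>_eq using Xm[of 1] by (subst integral_distr) auto
  qed
  define f where "f y = (\<lambda>t\<in>{0..}. c * \<mu> powr (1 / \<beta>) * Z t y)" for y
  define A where "A n x = graph_dist (walk_path \<beta> c \<zeta> \<xi> n x)" for n x
  define G where "G m n x = graph_dist (grid_path \<beta> c \<mu> \<zeta> m n x)" for m n :: nat and x
  define F where "F m y = graph_dist (levy_grid_path \<beta> c \<mu> Z m y)" for m :: nat and y
  have Hc: "continuous_on UNIV H" by (rule Lipschitz_continuous_on[OF H(2)])
  have Hm [measurable]: "H \<in> borel_measurable borel" by (rule borel_measurable_continuous_onI[OF Hc])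
  have Am [measurable]: "A n \<in> borel_measurable M" for n
    unfolding A_def by (rule rw_on_medium_graph_dist_measurable[OF \<zeta>m \<xi>m])
  have Gm [measurable]: "G m n \<in> borel_measurable M" for m n
    unfolding G_def
    by (intro step_path_graph_dist_measurable borel_measurable_times borel_measurable_const
      medium_measurable[OF \<zeta>m] measurable_const) simp_all
  have mZ: "t \<ge> 0 \<Longrightarrow> Z t \<in> borel_measurable N" for t using Z by (simp add: cadlag_levy_process_def)
  have Fm [measurable]: "F m \<in> borel_measurable N" for m
    unfolding F_def
    by (intro step_path_graph_dist_measurable borel_measurable_times borel_measurable_const mZ) simp_all
  have fD: "f y \<in> Dplus" if "y \<in> space N" for y
    unfolding f_def using levy_path_Dplus[OF Z(1) that] .
  have fm: "(\<lambda>y. graph_dist (f y)) \<in> borel_measurable N"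
  proof (rule graph_dist_measurable)
    show "(\<lambda>y. f y t) \<in> borel_measurable N" if "t \<ge> 0" for t using that mZ[OF that] by (simp add: f_def)
    show "cadlag (f y)" if "y \<in> space N" for y using fD[OF that] by (simp add: Dplus_def)
  qed
  have Flim: "(\<lambda>m. F (Suc m) y) \<longlonglongrightarrow> graph_dist (f y)" if "y \<in> space N" for y
    using graph_dist_discretize[OF fD[OF that]] by (simp add: F_def f_def del: of_nat_Suc)
  have F_conv: "(\<lambda>m. \<integral>y. H (F (Suc m) y) \<partial>N) \<longlonglongrightarrow> (\<integral>y. H (graph_dist (f y)) \<partial>N)"
  proof (rule integral_dominated_convergence[where w = "\<lambda>_. C"])
    show "AE y in N. (\<lambda>m. H (F (Suc m) y)) \<longlonglongrightarrow> H (graph_dist (f y))"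
      by (rule AE_I2, rule continuous_on_tendsto_compose[OF Hc Flim]) auto
    show "(\<lambda>y. H (graph_dist (f y))) \<in> borel_measurable N" by (rule measurable_compose[OF fm Hm])
  qed (use H(1) in auto)
  have "(\<lambda>n. \<integral>x. H (A n x) \<partial>M) \<longlonglongrightarrow> (\<integral>y. H (graph_dist (f y)) \<partial>N)"
  proof (rule tendstoI)
    fix e :: real assume e: "e > 0"
    have C: "C \<ge> 0" using H(1)[of undefined] by linarith
    \<comment> \<open>Each of four errors gets \<open>e / 4\<close>: the Lipschitz error on the good
      event, the bad event, the limit in \<open>n\<close> along the grid, and the discretization of
      the limit. The summands 1 in the denominators of \<open>d\<close> and \<open>p\<close> exclude
      division by zero.\<close>
    define d where "d = e / (4 * (\<bar>L\<bar> + 1))"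
    define p where "p = e / (8 * (C + 1))"
    have d: "d > 0" "\<bar>L\<bar> * d \<le> e / 4" using e by (auto simp: d_def field_simps)
    have p: "p > 0" "2 * C * p \<le> e / 4" using e C by (auto simp: p_def field_simps)
    from walk_close_to_grid[OF M \<beta> \<mu> \<zeta> pos B Xm weak_law d(1) p(1), of c]
    obtain m0 :: nat where m0: "m0 \<ge> 1" "\<And>m. m \<ge> m0 \<Longrightarrow>
      \<forall>\<^sub>F n in sequentially. prob {x \<in> space M. d \<le> dist (A n x) (G m n x)} \<le> p"
      unfolding A_def G_def by blast
    have "\<forall>\<^sub>F m in sequentially. dist (\<integral>y. H (F (Suc m) y) \<partial>N) (\<integral>y. H (graph_dist (f y)) \<partial>N) < e / 4"
      using F_conv e by (intro tendstoD) auto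
    then obtain m1 where m1: "\<And>m. m \<ge> m1 \<Longrightarrow> dist (\<integral>y. H (F (Suc m) y) \<partial>N) (\<integral>y. H (graph_dist (f y)) \<partial>N) < e / 4"
      by (auto simp: eventually_sequentially)
    define m where "m = Suc (max m0 m1)"
    have m: "m \<ge> 1" "m \<ge> m0" "dist (\<integral>y. H (F m y) \<partial>N) (\<integral>y. H (graph_dist (f y)) \<partial>N) < e / 4"
      using m1[of "max m0 m1"] by (auto simp: m_def)
    have "(\<lambda>n. \<integral>x. H (G m n x) \<partial>M) \<longlonglongrightarrow> (\<integral>y. H (F m y) \<partial>N)"
      unfolding G_def F_def by (rule grid_limit[OF M \<beta>(1) \<mu> \<zeta> Z1 att Z m(1) Hc H(1)])
    then have "\<forall>\<^sub>F n in sequentially. dist (\<integral>x. H (G m n x) \<partial>M) (\<integral>y. H (F m y) \<partial>N) < e / 4"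
      using e by (intro tendstoD) auto
    with m0(2)[OF m(2)] show "\<forall>\<^sub>F n in sequentially. dist (\<integral>x. H (A n x) \<partial>M) (\<integral>y. H (graph_dist (f y)) \<partial>N) < e"
    proof eventually_elim
      case (elim n)
      let ?bad = "{x \<in> space M. d \<le> dist (A n x) (G m n x)}"
      have bad: "?bad \<in> events" by measurable
      have intH: "integrable M (\<lambda>x. H (V x))" if [measurable]: "V \<in> borel_measurable M" for V
        by (rule integrable_const_bound[of _ C]) (use H(1) in auto)
      have "\<bar>(\<integral>x. H (A n x) \<partial>M) - (\<integral>x. H (G m n x) \<partial>M)\<bar> = \<bar>\<integral>x. H (A n x) - H (G m n x) \<partial>M\<bar>"
        by (simp add: intH)
      also have "\<dots> \<le> (\<integral>x. \<bar>H (A n x) - H (G m n x)\<bar> \<partial>M)" by (rule integral_abs_bound)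
      also have "\<dots> \<le> (\<integral>x. \<bar>L\<bar> * d + 2 * C * indicator ?bad x \<partial>M)"
      proof (rule integral_mono)
        show "integrable M (\<lambda>x. \<bar>H (A n x) - H (G m n x)\<bar>)" by (intro integrable_abs Bochner_Integration.integrable_diff intH Am Gm)
        show "integrable M (\<lambda>x. \<bar>L\<bar> * d + 2 * C * indicator ?bad x)"
          using bad by (intro Bochner_Integration.integrable_add integrable_const integrable_mult_right
            integrable_real_indicator) (auto simp: emeasure_eq_measure)
        fix x assume x: "x \<in> space M"
        show "\<bar>H (A n x) - H (G m n x)\<bar> \<le> \<bar>L\<bar> * d + 2 * C * indicator ?bad x"
        proof (cases "x \<in> ?bad")
          case True
          have "\<bar>H (A n x) - H (G m n x)\<bar> \<le> 2 * C" using H(1)[of "A n x"] H(1)[of "G m n x"] by linarith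
          moreover have "0 \<le> \<bar>L\<bar> * d" using d by simp
          ultimately show ?thesis using True by simp
        next
          case False
          then have "dist (A n x) (G m n x) \<le> d" using x by auto
          then have "L * dist (A n x) (G m n x) \<le> \<bar>L\<bar> * d" by (intro mult_mono) auto
          moreover have "indicator ?bad x = (0::real)" using False by simp
          ultimately show ?thesis using H(2)[of "A n x" "G m n x"] by simp
        qed
      qed
      also have "\<dots> = \<bar>L\<bar> * d + 2 * C * prob ?bad"
        using bad by (subst Bochner_Integration.integral_add) (auto simp: emeasure_eq_measure prob_space)
      also have "\<dots> \<le> e / 4 + e / 4"
        using d(2) p(2) elim(1) C mult_left_mono[of "prob ?bad" p "2 * C"] by linarith
      finally show ?case using elim(2) m(3) e unfolding dist_real_def by linarith
    qed
  qed
  then show ?thesis unfolding A_def f_def .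
qed

section \<open>The limit theorem\<close>

text \<open>The sum for negative sites runs from \<open>k\<close> to -1 with a minus sign, so
  reflecting the indices exchanges it exactly with the sum for positive sites.\<close>

lemma medium_reflect: "medium z (- k) = - medium (\<lambda>i. z (- i)) k"
proof -
  have "(\<Sum>i=a..b. z (- i)) = (\<Sum>i=- b..- a. z i)" for a b :: int
    by (rule sum.reindex_bij_witness[of _ uminus uminus]) auto
  then show ?thesis by (simp add: medium_def)
qed

lemma iid_reflect:
  fixes \<zeta> :: "int \<Rightarrow> 'a \<Rightarrow> real"
  assumes "prob_space M" "iid M borel \<zeta> UNIV"
  shows "iid M borel (\<lambda>i. \<zeta> (- i)) UNIV"
proof -
  interpret prob_space M by fact
  have ind: "indep_vars (\<lambda>_. borel) \<zeta> UNIV" and law: "distr M borel (\<zeta> i) = distr M borel (\<zeta> j)" for i j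
    using assms(2) unfolding iid_def by blast+
  have "indep_vars (\<lambda>_. borel) (\<lambda>i. \<zeta> (- i)) UNIV"
    by (rule indep_vars_inj_reindex[OF ind]) auto
  then show ?thesis unfolding iid_def using law by blast
qed

text \<open>Attraction is assumed for the positive half of the medium only; identical laws carry it
  over to the negative half.\<close>

lemma normally_attracted_reflect:
  fixes \<zeta> :: "int \<Rightarrow> 'a \<Rightarrow> real"
  assumes M: "prob_space M" and \<zeta>: "iid M borel \<zeta> UNIV"
    and att: "normally_attracted M (\<lambda>i. \<zeta> (int i)) a 0 \<nu>"
  shows "normally_attracted M (\<lambda>i. \<zeta> (- int i)) a 0 \<nu>"
proof -
  interpret prob_space M by fact
  note \<zeta>' = iid_reflect[OF M \<zeta>]
  have law: "distr M borel (\<zeta> (- i)) = distr M borel (\<zeta> 1)" for i by (rule iid_nat_part(2)[OF M \<zeta>])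
  have "distr M borel (\<lambda>x. (\<Sum>i=1..n. \<zeta> (- int i) x) * c) = distr M borel (\<lambda>x. (\<Sum>i=1..n. \<zeta> (int i) x) * c)" for n c
    by (rule distr_iid_sum_eq[OF iid_nat_part(1)[OF M \<zeta>'] law iid_nat_part(1)[OF M \<zeta>] iid_nat_part(2)[OF M \<zeta>]]) simp
  then show ?thesis using att by (simp add: normally_attracted_def divide_inverse)
qed

theorem theorem2p2:
  fixes M :: "'a measure" and N :: "'b measure"
    and \<zeta> :: "int \<Rightarrow> 'a \<Rightarrow> real" and \<xi> :: "nat \<Rightarrow> 'a \<Rightarrow> int"
    and Z :: "real \<Rightarrow> 'b \<Rightarrow> real"
    and \<alpha> \<beta> \<rho> \<mu> :: real
    and Z1 W1 :: "real measure"
  assumes "prob_space M"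
    and "0 < \<beta>" "\<beta> < 1" and "1 < \<alpha>" "\<alpha> < 2"
    \<comment> \<open>the medium\<close>
    and "iid M borel \<zeta> UNIV"
    and "\<And>i. AE x in M. 0 < \<zeta> i x"
    and "stable_law \<beta> 1 Z1"
    and "normally_attracted M (\<lambda>i. \<zeta> (int i)) \<beta> 0 Z1"
    \<comment> \<open>the underlying random walk\<close>
    and "iid M (count_space UNIV) \<xi> {1..}"
    and "integrable M (\<lambda>x. real_of_int (\<xi> 1 x))"
    and "\<mu> = (\<integral>x. real_of_int (\<xi> 1 x) \<partial>M)"
    and "stable_law \<alpha> \<rho> W1"
    and "normally_attracted M (\<lambda>i x. real_of_int (\<xi> i x)) \<alpha> \<mu> W1"
    \<comment> \<open>independence of walk and medium\<close>
    and "independent_of M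
           (PiM UNIV (\<lambda>_. borel)) (\<lambda>x. \<lambda>i::int. \<zeta> i x)
           (PiM {1..} (\<lambda>_. count_space UNIV)) (\<lambda>x. \<lambda>i\<in>{1::nat..}. \<xi> i x)"
    \<comment> \<open>the limit process\<close>
    and "cadlag_stable_levy_process \<beta> 1 N Z"
    and "distr N borel (Z 1) = Z1"
    and "\<mu> \<noteq> 0"
  shows "converges_in_distribution J2_topology
           M (\<lambda>n x. \<lambda>t\<in>{0..}.
                rw_on_medium (\<lambda>i. \<zeta> i x) (\<lambda>i. \<xi> i x) (nat \<lfloor>real n * t\<rfloor>) / real n powr (1 / \<beta>))
           N (\<lambda>y. \<lambda>t\<in>{0..}. sgn \<mu> * \<bar>\<mu>\<bar> powr (1 / \<beta>) * Z t y)"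
proof -
  note M = assms(1) and \<beta> = assms(2,3) and \<zeta> = assms(6) and pos = assms(7) and Z1 = assms(8)
    and att = assms(9) and \<xi> = assms(10) and int = assms(11) and \<mu> = assms(12) and ZN = assms(17)
  interpret prob_space M by fact
  have Z: "cadlag_levy_process N Z" using assms(16) by (simp add: cadlag_stable_levy_process_def)
  have N: "prob_space N" using Z by (simp add: cadlag_levy_process_def)
  have \<zeta>m: "\<zeta> i \<in> borel_measurable M" for i using \<zeta> unfolding iid_def indep_vars_def by blast
  have \<xi>m: "\<xi> i \<in> measurable M (count_space UNIV)" if "i \<ge> 1" for i
    using \<xi> that unfolding iid_def indep_vars_def by blast
  have path: "(\<lambda>t\<in>{0..}. rw_on_medium (\<lambda>i. \<zeta> i x) (\<lambda>i. \<xi> i x) (nat \<lfloor>real n * t\<rfloor>) / real n powr (1 / \<beta>)) =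
      walk_path \<beta> 1 \<zeta> \<xi> n x" for n x
    by (simp add: step_fun_def rw_on_medium_def)
  let ?c = "sgn \<mu> * \<bar>\<mu>\<bar> powr (1 / \<beta>)"
  show ?thesis
    unfolding path
  proof (rule converges_in_distribution_via_embedding[OF M N, where \<iota> = graph_dist])
    fix n x
    show "walk_path \<beta> 1 \<zeta> \<xi> n x \<in> topspace J2_topology"
      unfolding topspace_J2_topology by (rule step_fun_Dplus) simp
  next
    fix n
    show "(\<lambda>x. graph_dist (walk_path \<beta> 1 \<zeta> \<xi> n x)) \<in> borel_measurable M"
      by (rule rw_on_medium_graph_dist_measurable[OF \<zeta>m \<xi>m])
  next
    fix y assume "y \<in> space N"
    then show "(\<lambda>t\<in>{0..}. ?c * Z t y) \<in> topspace J2_topology"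
      unfolding topspace_J2_topology by (rule levy_path_Dplus[OF Z])
  next
    have mZ: "t \<ge> 0 \<Longrightarrow> Z t \<in> borel_measurable N" for t using Z by (simp add: cadlag_levy_process_def)
    show "(\<lambda>y. graph_dist (\<lambda>t\<in>{0..}. ?c * Z t y)) \<in> borel_measurable N"
    proof (rule graph_dist_measurable)
      show "(\<lambda>y. (\<lambda>t\<in>{0..}. ?c * Z t y) t) \<in> borel_measurable N" if "t \<ge> 0" for t
        using that mZ[OF that] by simp
      show "cadlag (\<lambda>t\<in>{0..}. ?c * Z t y)" if "y \<in> space N" for y
        using levy_path_Dplus[OF Z that] by (simp add: Dplus_def)
    qed
  next
    fix F f assume "range F \<subseteq> topspace J2_topology" "f \<in> topspace J2_topology"
      "(\<lambda>n. graph_dist (F n)) \<longlonglongrightarrow> graph_dist f"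
    then show "limitin J2_topology F f sequentially"
      unfolding topspace_J2_topology
      by (intro J2_converges_imp_limitin graph_dist_tendsto_imp_J2_converges)
  next
    fix H :: "(rat \<times> rat \<Rightarrow> real) \<Rightarrow> real" and L C
    assume H: "\<And>u. \<bar>H u\<bar> \<le> C" "\<And>u v. \<bar>H u - H v\<bar> \<le> L * dist u v"
    show "(\<lambda>n. \<integral>x. H (graph_dist (walk_path \<beta> 1 \<zeta> \<xi> n x)) \<partial>M)
      \<longlonglongrightarrow> (\<integral>y. H (graph_dist (\<lambda>t\<in>{0..}. ?c * Z t y)) \<partial>N)"
    proof (cases "\<mu> > 0")
      case True
      then show ?thesis
        using positive_drift_limit[OF M \<beta> True \<zeta> pos Z1 att \<xi> int \<mu> Z ZN H, of 1] by simp
    next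
      case False
      then have neg: "- \<mu> > 0" using assms(18) by simp
      text \<open>Reflecting medium and walk at the origin reverses the sign of the drift and of the process.\<close>
      let ?\<zeta> = "\<lambda>i. \<zeta> (- i)" and ?\<xi> = "\<lambda>i x. - \<xi> i x"
      have \<xi>': "iid M (count_space UNIV) ?\<xi> {1..}"
        unfolding iid_def
      proof
        show "indep_vars (\<lambda>_. count_space UNIV) ?\<xi> {1..}"
          by (rule indep_vars_compose2[where M' = "\<lambda>_. count_space UNIV"]) (use \<xi> in \<open>auto simp: iid_def\<close>)
        have "distr M (count_space UNIV) (?\<xi> i) = distr (distr M (count_space UNIV) (\<xi> i)) (count_space UNIV) uminus"
          if "i \<ge> 1" for i using \<xi>m[OF that] by (subst distr_distr) (auto simp: comp_def)
        moreover have "distr M (count_space UNIV) (\<xi> i) = distr M (count_space UNIV) (\<xi> 1)" if "i \<ge> 1" for i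
          using \<xi> that unfolding iid_def by (meson atLeast_iff order_refl)
        ultimately show "\<forall>i\<in>{1..}. \<forall>j\<in>{1..}. distr M (count_space UNIV) (?\<xi> i) = distr M (count_space UNIV) (?\<xi> j)"
          by (metis atLeast_iff)
      qed
      have int': "integrable M (\<lambda>x. real_of_int (?\<xi> 1 x))" using int by simp
      have \<mu>': "- \<mu> = (\<integral>x. real_of_int (?\<xi> 1 x) \<partial>M)" using \<mu> by simp
      have "walk (\<lambda>i. - \<xi> i x) j = - walk (\<lambda>i. \<xi> i x) j" for x j by (simp add: walk_def sum_negf)
      then have "- 1 / real n powr (1 / \<beta>) * medium (\<lambda>i. ?\<zeta> i x) (walk (\<lambda>i. ?\<xi> i x) j) =
          1 / real n powr (1 / \<beta>) * medium (\<lambda>i. \<zeta> i x) (walk (\<lambda>i. \<xi> i x) j)" for n x j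
        using medium_reflect[of "\<lambda>i. \<zeta> i x" "- walk (\<lambda>i. \<xi> i x) j"] by simp
      \<comment> \<open>Here \<open>sgn \<mu>\<close> is -1 and \<open>\<bar>\<mu>\<bar>\<close> is
        \<open>- \<mu>\<close>, so the factor \<open>c = - 1\<close> undoes the sign introduced by
        the reflection.\<close>
      then show ?thesis
        using positive_drift_limit[OF M \<beta> neg iid_reflect[OF M \<zeta>] pos Z1 normally_attracted_reflect[OF M \<zeta> att]
            \<xi>' int' \<mu>' Z ZN H, of "- 1"] neg by simp
    qed
  qed
qed

end
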